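(* Let $\mathcal{T}=\{T_t:t\ge 0\}$ be a $C_0$ contraction semigroup on a Hilbert space $\mathcal{H}$ all of whose vectors are flight vectors, let $T$ be its cogenerator, and let $\mathcal{U}$ and $\mathcal{C}$ be the unitary groups defined by $\mathcal{T}$ and by $T$ on the unitary subspace $\mathcal{H}_u$. Then the following are equivalent: (a) $\mathcal{U}$ and $\mathcal{C}$ are entangled, i.e. for all $x\in\mathcal{H}$, $\Omega_{\mathcal{U}}\cdot x\subset M(x,\mathcal{C})$ and $\Omega_{\mathcal{C}}\cdot x\subset M(x,\mathcal{U})$; (b) $\mathcal{U}$ and $\mathcal{C}$ have a common limit algebra $\mathcal{M}^{\Omega}=\mathcal{M}^{\Omega_{\mathcal{C}}}=\mathcal{M}^{\Omega_{\mathcal{U}}}$ with unit $P_m=P_{m_{\mathcal{U}}}=P_{m_{\mathcal{C}}}$; (c) $\mathcal{H}_m(\mathcal{C})=\mathcal{H}_m(\mathcal{U})$.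
   Context: Flight vectors: $x\in\mathcal{H}$ is a flight (almost weakly stable) vector if $0$ lies in the weak closure of its orbit $\{T_tx:t\ge 0\}$. The flight vectors of $\mathcal{T}$ and of $\mathcal{D}=\{T^n:n\ge 0\}$ form the same subspace $\mathcal{H}_0$; it is assumed throughout that $\mathcal{H}=\mathcal{H}_0$. Cogenerator: if $G$ is the generator of $\mathcal{T}$, then $T=(G+I)(G-I)^{-1}$. Unitary part: $\mathcal{H}_u$ is the largest closed reducing subspace on which every $T_t$ is unitary; equivalently, the largest one on which $T$ is unitary. $P_u$ is the orthogonal projection onto $\mathcal{H}_u$. $\mathcal{U}=\{U_t:t\in\mathbb{R}\}$ is the unitary group on $\mathcal{H}_u$ with $U_t=T_t|_{\mathcal{H}_u}$ and $U_{-t}=U_t^*$ for $t\ge0$. $\mathcal{C}=\{U^n:n\in\mathbb{Z}\}$, where $U=T|_{\mathcal{H}_u}$ is the cogenerator of $\mathcal{U}$. Limit operators: $\Omega_{\mathcal{U}}$ is the set of all weak operator limits $V=\lim_k U_{t_k}$ over sequences $t_k\uparrow+\infty$, and $\Omega_{\mathcal{C}}$ is the set of all weak operator limits $V=\lim_k U^{n_k}$ over sequences of integers $n_k\uparrow+\infty$. For $x\in\mathcal{H}$ an operator $V$ on $\mathcal{H}_u$ acts by $Vx:=VP_ux$. For $\mathcal{S}=\mathcal{U}$ or $\mathcal{C}$: $\Omega_{\mathcal{S}}\cdot x=\{Vx:V\in\Omega_{\mathcal{S}}\}$, and $M(x,\mathcal{S})$ is the closed linear span of $\Omega_{\mathcal{S}}\cdot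 x$ in $\mathcal{H}$. Weakly Poisson recurrent vectors: $\mathcal{H}_m(\mathcal{S})=\{x\in\mathcal{H}:x\in M(x,\mathcal{S})\}$. This is a closed reducing subspace contained in $\mathcal{H}_u$; $P_{m_{\mathcal{S}}}$ is the orthogonal projection onto it. Limit algebra: for a commutative collection $\mathcal{A}\subset\mathcal{L}(\mathcal{H}_u)$ of bounded operators, $\mathcal{M}^{\mathcal{A}}$ is the least $*$-closed, weakly closed subalgebra of $\mathcal{L}(\mathcal{H}_u)$ containing $\mathcal{A}$ (its unit need not be the identity). The limit algebra of $\mathcal{S}$ is $\mathcal{M}^{\Omega_{\mathcal{S}}}$. *)

theory Defs
  imports "HOL-Analysis.Analysis"
begin

text \<open>The inner product is linear in its first argument. Completeness comes from \<^class>\<open>banach\<close>,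
  and positive definiteness from the last axiom.\<close>

class complex_hilbert = banach +
  fixes scaleC :: "complex \<Rightarrow> 'a \<Rightarrow> 'a"  (infixr \<open>*\<^sub>C\<close> 75)
    and cinner :: "'a \<Rightarrow> 'a \<Rightarrow> complex"
  assumes scaleC_add_right: "c *\<^sub>C (x + y) = c *\<^sub>C x + c *\<^sub>C y"
    and scaleC_add_left: "(c + d) *\<^sub>C x = c *\<^sub>C x + d *\<^sub>C x"
    and scaleC_scaleC: "c *\<^sub>C d *\<^sub>C x = (c * d) *\<^sub>C x"
    and scaleC_of_real: "complex_of_real r *\<^sub>C x = r *\<^sub>R x"
    and cinner_commute: "cinner x y = cnj (cinner y x)"
    and cinner_add_left: "cinner (x + y) z = cinner x z + cinner y z"
    and cinner_scaleC_left: "cinner (c *\<^sub>C x) y = c * cinner x y"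
    and norm_eq_sqrt_cinner: "norm x = sqrt (Re (cinner x x))"

instantiation complex :: complex_hilbert
begin

definition scaleC_complex :: "complex \<Rightarrow> complex \<Rightarrow> complex" where
  "scaleC_complex c x = c * x"

definition cinner_complex :: "complex \<Rightarrow> complex \<Rightarrow> complex" where
  "cinner_complex x y = x * cnj y"

instance
  by intro_classes
    (auto simp: scaleC_complex_def cinner_complex_def algebra_simps scaleR_conv_of_real
      cmod_def power2_eq_square)

end

global_interpretation complex_hilbert: vector_space
    "scaleC :: complex \<Rightarrow> 'a \<Rightarrow> 'a :: complex_hilbert"
  defines csubspace = complex_hilbert.subspace
    and cspan = complex_hilbert.span
proof unfold_locales
  show "1 *\<^sub>C x = x" for x :: 'a
    using scaleC_of_real[of 1 x] by simp
qed (simp_all add: scaleC_add_right scaleC_add_left scaleC_scaleC)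

definition closed_csubspace :: "'a::complex_hilbert set \<Rightarrow> bool" where
  "closed_csubspace M \<longleftrightarrow> csubspace M \<and> closed M"

definition ortho_proj :: "'a::complex_hilbert set \<Rightarrow> 'a \<Rightarrow> 'a" where
  "ortho_proj M x = (THE p. p \<in> M \<and> (\<forall>y\<in>M. cinner (x - p) y = 0))"

definition bounded_clinear :: "('a::complex_hilbert \<Rightarrow> 'a) \<Rightarrow> bool" where
  "bounded_clinear A \<longleftrightarrow> bounded_linear A \<and> (\<forall>c x. A (c *\<^sub>C x) = c *\<^sub>C A x)"

definition cadjoint :: "('a::complex_hilbert \<Rightarrow> 'a) \<Rightarrow> 'a \<Rightarrow> 'a" where
  "cadjoint A = (SOME B. \<forall>x y. cinner (A x) y = cinner x (B y))"

definition weak_topology :: "'a::complex_hilbert topology" where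
  "weak_topology = pullback_topology UNIV (\<lambda>x y. cinner x y) euclidean"

text \<open>For a closed subspace \<open>M\<close>, the algebra of bounded operators on \<open>M\<close> is represented inside the
  operators on the whole space: an operator \<open>V\<close> on \<open>M\<close> is identified with \<open>V P\<close>, where \<open>P\<close> is the
  orthogonal projection onto \<open>M\<close>. Under this identification sums, products and adjoints are the
  ones of the whole space, the identity of \<open>M\<close> becomes \<open>P\<close>, and \<open>V\<close> acts on
  every vector \<open>x\<close> by \<open>V x = V P x\<close>.\<close>

definition operators_on :: "'a::complex_hilbert set \<Rightarrow> ('a \<Rightarrow> 'a) set" where
  "operators_on M = {A. bounded_clinear A \<and> range A \<subseteq> M \<and> A \<circ> ortho_proj M = A}"

definition restrict_op :: "'a::complex_hilbert set \<Rightarrow> ('a \<Rightarrow> 'a) \<Rightarrow> 'a \<Rightarrow> 'a" where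
  "restrict_op M A = A \<circ> ortho_proj M"

definition weak_operator_topology :: "'a::complex_hilbert set \<Rightarrow> ('a \<Rightarrow> 'a) topology" where
  "weak_operator_topology M =
     pullback_topology (operators_on M) (\<lambda>A (x, y). cinner (A x) y) euclidean"

definition star_subalgebra :: "'a::complex_hilbert set \<Rightarrow> ('a \<Rightarrow> 'a) set \<Rightarrow> bool" where
  "star_subalgebra M B \<longleftrightarrow>
     B \<subseteq> operators_on M \<and> (\<lambda>x. 0) \<in> B \<and>
     (\<forall>V\<in>B. \<forall>W\<in>B. (\<lambda>x. V x + W x) \<in> B) \<and>
     (\<forall>c. \<forall>V\<in>B. (\<lambda>x. c *\<^sub>C V x) \<in> B) \<and>
     (\<forall>V\<in>B. \<forall>W\<in>B. V \<circ> W \<in> B) \<and>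
     (\<forall>V\<in>B. cadjoint V \<in> B)"

definition weakly_closed_star_subalgebra ::
    "'a::complex_hilbert set \<Rightarrow> ('a \<Rightarrow> 'a) set \<Rightarrow> bool" where
  "weakly_closed_star_subalgebra M B \<longleftrightarrow>
     star_subalgebra M B \<and> closedin (weak_operator_topology M) B"

definition generated_algebra ::
    "'a::complex_hilbert set \<Rightarrow> ('a \<Rightarrow> 'a) set \<Rightarrow> ('a \<Rightarrow> 'a) set" where
  "generated_algebra M \<A> = weakly_closed_star_subalgebra M hull \<A>"

definition is_unit_of :: "('a \<Rightarrow> 'a) set \<Rightarrow> ('a \<Rightarrow> 'a) \<Rightarrow> bool" where
  "is_unit_of B E \<longleftrightarrow> E \<in> B \<and> (\<forall>V\<in>B. E \<circ> V = V \<and> V \<circ> E = V)"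

text \<open>Only the values at times \<open>t \<ge> 0\<close> of \<open>T\<close> are relevant.\<close>

definition c0_contraction_semigroup :: "(real \<Rightarrow> 'a::complex_hilbert \<Rightarrow> 'a) \<Rightarrow> bool" where
  "c0_contraction_semigroup T \<longleftrightarrow>
     (\<forall>t\<ge>0. bounded_clinear (T t) \<and> (\<forall>x. norm (T t x) \<le> norm x)) \<and>
     T 0 = id \<and>
     (\<forall>s\<ge>0. \<forall>t\<ge>0. T (s + t) = T s \<circ> T t) \<and>
     (\<forall>x. ((\<lambda>t. T t x) \<longlongrightarrow> x) (at_right 0))"

definition flight_vector :: "(real \<Rightarrow> 'a::complex_hilbert \<Rightarrow> 'a) \<Rightarrow> 'a \<Rightarrow> bool" where
  "flight_vector T x \<longleftrightarrow> 0 \<in> weak_topology closure_of {T t x | t. t \<ge> 0}"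

definition generator_domain :: "(real \<Rightarrow> 'a::complex_hilbert \<Rightarrow> 'a) \<Rightarrow> 'a set" where
  "generator_domain T = {x. \<exists>y. ((\<lambda>h. (T h x - x) /\<^sub>R h) \<longlongrightarrow> y) (at_right 0)}"

definition generator :: "(real \<Rightarrow> 'a::complex_hilbert \<Rightarrow> 'a) \<Rightarrow> 'a \<Rightarrow> 'a" where
  "generator T x = Lim (at_right 0) (\<lambda>h. (T h x - x) /\<^sub>R h)"

text \<open>The cogenerator \<open>(G + I) (G - I)\<^sup>-\<^sup>1\<close>, where \<open>G\<close> is the generator.\<close>

definition cogenerator :: "(real \<Rightarrow> 'a::complex_hilbert \<Rightarrow> 'a) \<Rightarrow> 'a \<Rightarrow> 'a" where
  "cogenerator T z =
     (let x = inv_into (generator_domain T) (\<lambda>x. generator T x - x) z in generator T x + x)"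

definition reduces :: "'a::complex_hilbert set \<Rightarrow> ('a \<Rightarrow> 'a) \<Rightarrow> bool" where
  "reduces M A \<longleftrightarrow> A ` M \<subseteq> M \<and> cadjoint A ` M \<subseteq> M"

definition unitary_on :: "'a::complex_hilbert set \<Rightarrow> ('a \<Rightarrow> 'a) \<Rightarrow> bool" where
  "unitary_on M A \<longleftrightarrow> A ` M = M \<and> (\<forall>x\<in>M. \<forall>y\<in>M. cinner (A x) (A y) = cinner x y)"

definition unitary_part :: "(real \<Rightarrow> 'a::complex_hilbert \<Rightarrow> 'a) \<Rightarrow> 'a set" where
  "unitary_part T =
     (GREATEST M. closed_csubspace M \<and> (\<forall>t\<ge>0. reduces M (T t) \<and> unitary_on M (T t)))"

definition unitary_group :: "(real \<Rightarrow> 'a::complex_hilbert \<Rightarrow> 'a) \<Rightarrow> real \<Rightarrow> 'a \<Rightarrow> 'a" where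
  "unitary_group T t =
     (if t \<ge> 0 then restrict_op (unitary_part T) (T t)
      else cadjoint (restrict_op (unitary_part T) (T (- t))))"

text \<open>The powers of the restricted cogenerator \<open>U\<close>; since \<open>U\<close> is unitary, its negative powers are the
  adjoints of the positive ones.\<close>

definition cogenerator_group :: "(real \<Rightarrow> 'a::complex_hilbert \<Rightarrow> 'a) \<Rightarrow> int \<Rightarrow> 'a \<Rightarrow> 'a" where
  "cogenerator_group T n =
     (if n \<ge> 0 then restrict_op (unitary_part T) (cogenerator T ^^ nat n)
      else cadjoint (restrict_op (unitary_part T) (cogenerator T ^^ nat (- n))))"

text \<open>Below, \<open>M\<close> is the subspace on which the group \<open>S\<close> acts, and the time parameter
  ranges over \<^typ>\<open>real\<close> or \<^typ>\<open>int\<close>.\<close>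

definition limit_operators ::
    "'a::complex_hilbert set \<Rightarrow> ('t::linorder \<Rightarrow> 'a \<Rightarrow> 'a) \<Rightarrow> ('a \<Rightarrow> 'a) set" where
  "limit_operators M S =
     {V. \<exists>t :: nat \<Rightarrow> 't. incseq t \<and> filterlim t at_top sequentially \<and>
           limitin (weak_operator_topology M) (\<lambda>k. S (t k)) V sequentially}"

definition limit_orbit ::
    "'a::complex_hilbert set \<Rightarrow> ('t::linorder \<Rightarrow> 'a \<Rightarrow> 'a) \<Rightarrow> 'a \<Rightarrow> 'a set" where
  "limit_orbit M S x = {V x | V. V \<in> limit_operators M S}"

definition limit_space ::
    "'a::complex_hilbert set \<Rightarrow> ('t::linorder \<Rightarrow> 'a \<Rightarrow> 'a) \<Rightarrow> 'a \<Rightarrow> 'a set" where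
  "limit_space M S x = closure (cspan (limit_orbit M S x))"

definition poisson_recurrent ::
    "'a::complex_hilbert set \<Rightarrow> ('t::linorder \<Rightarrow> 'a \<Rightarrow> 'a) \<Rightarrow> 'a set" where
  "poisson_recurrent M S = {x. x \<in> limit_space M S x}"

definition limit_algebra ::
    "'a::complex_hilbert set \<Rightarrow> ('t::linorder \<Rightarrow> 'a \<Rightarrow> 'a) \<Rightarrow> ('a \<Rightarrow> 'a) set" where
  "limit_algebra M S = generated_algebra M (limit_operators M S)"

definition entangled ::
    "'a::complex_hilbert set \<Rightarrow> ('s::linorder \<Rightarrow> 'a \<Rightarrow> 'a) \<Rightarrow> ('t::linorder \<Rightarrow> 'a \<Rightarrow> 'a) \<Rightarrow> bool" where
  "entangled M S S' \<longleftrightarrow>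
     (\<forall>x. limit_orbit M S x \<subseteq> limit_space M S' x \<and> limit_orbit M S' x \<subseteq> limit_space M S x)"

definition common_limit_algebra ::
    "'a::complex_hilbert set \<Rightarrow> ('s::linorder \<Rightarrow> 'a \<Rightarrow> 'a) \<Rightarrow> ('t::linorder \<Rightarrow> 'a \<Rightarrow> 'a) \<Rightarrow> bool" where
  "common_limit_algebra M S S' \<longleftrightarrow>
     limit_algebra M S = limit_algebra M S' \<and>
     ortho_proj (poisson_recurrent M S) = ortho_proj (poisson_recurrent M S') \<and>
     is_unit_of (limit_algebra M S) (ortho_proj (poisson_recurrent M S))"

end

theory Submission
  imports Defs
begin

text \<open>Let \<open>\<S>\<close> be a unitary group on a closed subspace \<open>M\<close> and \<open>\<Omega>\<close> its set of limit operators. Every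
  \<open>V \<in> \<Omega>\<close> is a normal contraction commuting with the group, and \<open>\<Omega>\<close> is stable under multiplication
  by the group. Let \<open>K\<close> be the closed span of the ranges of the limit operators; by normality its
  orthogonal complement is the common kernel of \<open>\<Omega>\<close>. Everything in the theorem is controlled by \<open>K\<close>:

  \<^item> The weakly Poisson recurrent vectors are exactly those of \<open>K\<close> (\<open>poisson_recurrent_eq_K\<close>). If
    \<open>x \<in> K\<close> and \<open>Q\<close> projects onto the closed span of the limit orbit of \<open>x\<close>, then \<open>Q\<close> commutes with
    the group, hence with every \<open>V \<in> \<Omega>\<close>, so that \<open>V (x - Q x) = V x - Q V x = 0\<close>. Thus
    \<open>x - Q x\<close> lies in \<open>K\<close> and is orthogonal to \<open>K\<close>, that is, \<open>x = Q x\<close>.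

  \<^item> The projection onto \<open>K\<close> is the unit of the limit algebra (\<open>proj_K_in_limit_algebra\<close>,
    \<open>proj_K_unit\<close>). It belongs to the algebra because for a positive contraction \<open>h\<close> the operators
    \<open>1 - (1 - h)\<^bsup>2n\<^esup>\<close> converge strongly to the projection onto the orthogonal complement of the kernel
    of \<open>h\<close>; averages of the \<open>V\<^sup>* V\<close> over finite subsets of \<open>\<Omega>\<close> and a limit along these subsets
    give the projection onto \<open>K\<close>.

  Suppose that two groups on \<open>M\<close> lie in the same weakly closed \<open>*\<close>-algebras
  (\<open>flows_equivalences\<close>). Then a closed subspace reduces one group iff it reduces the other, and a weakly
  closed \<open>*\<close>-algebra is stable under left multiplication by one group iff it is stable under left
  multiplication by the other. If the spaces \<open>K\<close> coincide, with projection \<open>P\<close>, then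
  the first fact puts \<open>V x = V P x\<close> into the limit space of \<open>x\<close> for the other group, which is
  entanglement; the second, applied to \<open>S\<^sub>t P\<close>, puts each limit operator \<open>V = V P\<close> into the
  other limit algebra, so that the limit algebras agree. Conversely, entanglement or a common unit
  forces the spaces \<open>K\<close> to coincide.

  It remains to see that a weakly closed \<open>*\<close>-algebra on the unitary part contains the group of the
  semigroup iff it contains that of the cogenerator (\<open>groups_generate_same_algebras\<close>). With
  \<open>R = (1 - G)\<^sup>-\<^sup>1\<close> the cogenerator is \<open>C = 1 - 2 R\<close>. In one direction \<open>R\<close> is the strong limit of
  the resolvents of the difference quotients \<open>(T\<^sub>h - 1) / h\<close>, which are Neumann series in \<open>T\<^sub>h\<close>;
  in the other, \<open>T\<^sub>t\<close> is the strong limit of \<open>(1 - (t/n) G)\<^sup>-\<^sup>n\<close>, and for \<open>0 < h \<le> 1\<close> the operator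
  \<open>(1 - h G)\<^sup>-\<^sup>1\<close> is a Neumann series in \<open>C\<close> multiplied by \<open>R\<close>.\<close>

section \<open>Complex Hilbert spaces\<close>

lemma cinner_add_right: "cinner x (y + z) = cinner x y + cinner x z"
  for x :: "'a::complex_hilbert"
  by (metis cinner_add_left cinner_commute complex_cnj_add)

lemma cinner_scaleC_right: "cinner x (c *\<^sub>C y) = cnj c * cinner x y"
  for x :: "'a::complex_hilbert"
  by (metis cinner_commute cinner_scaleC_left complex_cnj_mult)

lemma cinner_scaleR_left: "cinner (r *\<^sub>R x) y = of_real r * cinner x y"
  for x :: "'a::complex_hilbert"
  by (metis cinner_scaleC_left scaleC_of_real)

lemma cinner_scaleR_right: "cinner x (r *\<^sub>R y) = of_real r * cinner x y"
  for x :: "'a::complex_hilbert"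
  by (metis cinner_scaleC_right complex_cnj_complex_of_real scaleC_of_real)

lemma cinner_self: "cinner x x = of_real ((norm x)\<^sup>2)" for x :: "'a::complex_hilbert"
proof -
  have "Im (cinner x x) = 0"
    using cinner_commute[of x x] by (metis Reals_cnj_iff complex_is_Real_iff)
  moreover have "Re (cinner x x) = (norm x)\<^sup>2"
    using norm_eq_sqrt_cinner[of x] norm_ge_zero[of x] real_sqrt_ge_0_iff by force
  ultimately show ?thesis
    by (simp add: complex_eq_iff)
qed

lemma norm_sq_cinner: "(norm x)\<^sup>2 = Re (cinner x x)" for x :: "'a::complex_hilbert"
  by (simp add: cinner_self)

lemma norm_scaleC: "norm (c *\<^sub>C x) = norm c * norm x" for x :: "'a::complex_hilbert"
proof -
  have "(norm (c *\<^sub>C x))\<^sup>2 = Re ((c * cnj c) * cinner x x)"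
    by (simp only: norm_sq_cinner cinner_scaleC_left cinner_scaleC_right mult_ac)
  also have "\<dots> = (norm c * norm x)\<^sup>2"
    by (simp add: cinner_self power_mult_distrib complex_norm_square[symmetric]
        flip: of_real_mult of_real_power)
  finally show ?thesis
    by (simp add: power2_eq_iff_nonneg)
qed

lemma cauchy_schwarz: "norm (cinner x y) \<le> norm x * norm y" for x y :: "'a::complex_hilbert"
proof (cases "y = 0")
  case True
  have "cinner x (0 + 0) = cinner x 0 + cinner x 0"
    by (rule cinner_add_right)
  then show ?thesis
    using True by simp
next
  case False
  define a where "a = cinner x y"
  define z where "z = of_real ((norm y)\<^sup>2) *\<^sub>C x + (- a) *\<^sub>C y"
  have yx: "cinner y x = cnj a"
    unfolding a_def by (rule cinner_commute)
  have "cinner z z = of_real ((norm y)\<^sup>2) * (of_real ((norm y)\<^sup>2) * cinner x x) -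
      of_real ((norm y)\<^sup>2) * (cnj a * a) - a * (of_real ((norm y)\<^sup>2) * cnj a) + a * (cnj a * cinner y y)"
    unfolding z_def cinner_add_left cinner_add_right cinner_scaleC_left cinner_scaleC_right yx
    by (simp add: a_def[symmetric] algebra_simps)
  then have "cinner z z = of_real ((norm y)\<^sup>2) * (of_real ((norm y)\<^sup>2) * of_real ((norm x)\<^sup>2) - a * cnj a)"
    unfolding cinner_self by (simp add: algebra_simps)
  then have "of_real ((norm z)\<^sup>2) =
      complex_of_real ((norm y)\<^sup>2 * ((norm y)\<^sup>2 * (norm x)\<^sup>2 - (norm a)\<^sup>2))"
    by (simp add: cinner_self complex_norm_square del: of_real_power)
  then have "(norm z)\<^sup>2 = (norm y)\<^sup>2 * ((norm y)\<^sup>2 * (norm x)\<^sup>2 - (norm a)\<^sup>2)"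
    by (simp only: of_real_eq_iff)
  then have "0 \<le> (norm y)\<^sup>2 * ((norm y)\<^sup>2 * (norm x)\<^sup>2 - (norm a)\<^sup>2)"
    by (metis zero_le_power2)
  with False have "(norm a)\<^sup>2 \<le> (norm x * norm y)\<^sup>2"
    by (simp add: zero_le_mult_iff power_mult_distrib mult.commute)
  then show ?thesis
    unfolding a_def by (simp add: power2_le_iff_abs_le)
qed

interpretation cinner: bounded_bilinear "cinner :: 'a \<Rightarrow> 'a::complex_hilbert \<Rightarrow> complex"
proof
  show "\<exists>K. \<forall>x y::'a. norm (cinner x y) \<le> norm x * norm y * K"
    using cauchy_schwarz by (metis mult.right_neutral)
qed (simp_all add: cinner_add_left cinner_add_right cinner_scaleR_left cinner_scaleR_right
      scaleR_conv_of_real)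

interpretation scaleC: bounded_bilinear "scaleC :: complex \<Rightarrow> 'a \<Rightarrow> 'a::complex_hilbert"
proof
  show "(r *\<^sub>R c) *\<^sub>C x = r *\<^sub>R c *\<^sub>C x" for r c and x :: 'a
    by (metis scaleC_of_real scaleC_scaleC scaleR_conv_of_real)
  show "c *\<^sub>C r *\<^sub>R x = r *\<^sub>R c *\<^sub>C x" for r c and x :: 'a
    by (metis mult.commute scaleC_of_real scaleC_scaleC)
  show "\<exists>K. \<forall>c (x::'a). norm (c *\<^sub>C x) \<le> norm c * norm x * K"
    by (metis mult.right_neutral norm_scaleC order_refl)
qed (simp_all add: scaleC_add_left scaleC_add_right)

lemma cinner_eqI: "(\<And>y. cinner x y = cinner x' y) \<Longrightarrow> x = x'" for x :: "'a::complex_hilbert"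
proof -
  assume "\<And>y. cinner x y = cinner x' y"
  then have "cinner (x - x') (x - x') = 0"
    by (simp add: cinner.diff_left)
  then show ?thesis
    by (simp add: cinner_self)
qed

lemma norm_sq_add:
  "(norm (x + y))\<^sup>2 = (norm x)\<^sup>2 + (norm y)\<^sup>2 + 2 * Re (cinner x y)" for x :: "'a::complex_hilbert"
proof -
  have "Re (cinner y x) = Re (cinner x y)"
    by (metis cinner_commute cnj.simps(1))
  then show ?thesis
    by (simp add: norm_sq_cinner cinner_add_left cinner_add_right)
qed

lemma norm_sq_diff:
  "(norm (x - y))\<^sup>2 = (norm x)\<^sup>2 + (norm y)\<^sup>2 - 2 * Re (cinner x y)" for x :: "'a::complex_hilbert"
  using norm_sq_add[of x "- y"] by (simp add: cinner.minus_right)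

lemma parallelogram_law:
  "(norm (x + y))\<^sup>2 + (norm (x - y))\<^sup>2 = 2 * (norm x)\<^sup>2 + 2 * (norm y)\<^sup>2"
  for x :: "'a::complex_hilbert"
  by (simp add: norm_sq_add norm_sq_diff)

lemma closed_csubspaceD:
  assumes "closed_csubspace M"
  shows "closed M" and "0 \<in> M" and "x \<in> M \<Longrightarrow> y \<in> M \<Longrightarrow> x + y \<in> M"
    and "x \<in> M \<Longrightarrow> c *\<^sub>C x \<in> M" and "x \<in> M \<Longrightarrow> y \<in> M \<Longrightarrow> x - y \<in> M"
    and "x \<in> M \<Longrightarrow> r *\<^sub>R x \<in> M"
  using assms complex_hilbert.subspace_scale[of M x "of_real r"]
  by (auto simp: closed_csubspace_def complex_hilbert.subspace_0 complex_hilbert.subspace_add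
      complex_hilbert.subspace_scale complex_hilbert.subspace_diff scaleC_of_real)

theorem projection_exists:
  fixes x :: "'a::complex_hilbert"
  assumes M: "closed_csubspace M"
  shows "\<exists>p\<in>M. \<forall>y\<in>M. cinner (x - p) y = 0"
proof -
  define d where "d = (INF m\<in>M. norm (x - m))"
  have bdd: "bdd_below ((\<lambda>m. norm (x - m)) ` M)"
    by (rule bdd_belowI[of _ 0]) auto
  have ne: "M \<noteq> {}"
    using closed_csubspaceD(2)[OF M] by auto
  have d_le: "d \<le> norm (x - m)" if "m \<in> M" for m
    unfolding d_def by (rule cINF_lower[OF bdd that])
  have d0: "0 \<le> d"
    unfolding d_def by (rule cINF_greatest[OF ne]) auto
  have "\<exists>m\<in>M. norm (x - m) < d + 1 / real (Suc n)" for n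
    using cINF_less_iff[OF ne bdd, of "d + 1 / real (Suc n)"] unfolding d_def by simp
  then obtain m where m: "\<And>n. m n \<in> M" "\<And>n. norm (x - m n) < d + 1 / real (Suc n)"
    by metis
  have lim: "(\<lambda>n. norm (x - m n)) \<longlonglongrightarrow> d"
  proof (rule tendsto_sandwich[where f = "\<lambda>n. d" and h = "\<lambda>n. d + 1 / real (Suc n)"])
    show "(\<lambda>n. d + 1 / real (Suc n)) \<longlonglongrightarrow> d"
      using tendsto_add[OF tendsto_const[of d] LIMSEQ_inverse_real_of_nat]
      by (simp add: inverse_eq_divide)
  qed (auto intro!: always_eventually d_le m(1) less_imp_le[OF m(2)] simp del: of_nat_Suc)
  have gap: "(norm (m i - m j))\<^sup>2 \<le> 2 * (norm (x - m i))\<^sup>2 + 2 * (norm (x - m j))\<^sup>2 - 4 * d\<^sup>2" for i j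
  proof -
    have "(1/2) *\<^sub>R (m i + m j) \<in> M"
      using m(1) M by (intro closed_csubspaceD(3,6)[OF M]) auto
    then have "d \<le> norm (x - (1/2) *\<^sub>R (m i + m j))"
      by (rule d_le)
    also have "\<dots> = norm ((1/2) *\<^sub>R ((x - m i) + (x - m j)))"
      by (rule arg_cong[where f = norm]) (simp add: algebra_simps flip: scaleR_left.add)
    finally have "2 * d \<le> norm ((x - m i) + (x - m j))"
      by simp
    then have "4 * d\<^sup>2 \<le> (norm ((x - m i) + (x - m j)))\<^sup>2"
      using power_mono[of "2 * d" _ 2] d0 by (simp add: power_mult_distrib)
    then show ?thesis
      using parallelogram_law[of "x - m i" "x - m j"] by (simp add: norm_minus_commute)
  qed
  have "Cauchy m"
  proof (rule CauchyI)
    fix e :: real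
    assume e: "e > 0"
    have "(\<lambda>n. 2 * (norm (x - m n))\<^sup>2 - 2 * d\<^sup>2) \<longlonglongrightarrow> 2 * d\<^sup>2 - 2 * d\<^sup>2"
      by (intro tendsto_intros lim)
    then have "eventually (\<lambda>n. 2 * (norm (x - m n))\<^sup>2 - 2 * d\<^sup>2 < e\<^sup>2 / 2) sequentially"
      using e by (intro order_tendstoD(2)) auto
    then obtain N where N: "\<And>n. n \<ge> N \<Longrightarrow> 2 * (norm (x - m n))\<^sup>2 - 2 * d\<^sup>2 < e\<^sup>2 / 2"
      by (auto simp: eventually_sequentially)
    have "norm (m i - m j) < e" if "i \<ge> N" "j \<ge> N" for i j
    proof -
      have "(norm (m i - m j))\<^sup>2 < e\<^sup>2"
        using gap[of i j] N[OF that(1)] N[OF that(2)] by linarith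
      then show ?thesis
        using e by (simp add: power2_less_imp_less)
    qed
    then show "\<exists>N. \<forall>i\<ge>N. \<forall>j\<ge>N. norm (m i - m j) < e"
      by blast
  qed
  then obtain p where p: "m \<longlonglongrightarrow> p"
    by (auto simp: Cauchy_convergent_iff convergent_def)
  have pM: "p \<in> M"
    using closed_csubspaceD(1)[OF M] m(1) p by (rule closed_sequentially)
  have pd: "norm (x - p) = d"
    using tendsto_norm[OF tendsto_diff[OF tendsto_const p]] lim LIMSEQ_unique by blast
  have "cinner (x - p) y = 0" if y: "y \<in> M" for y
  proof (cases "y = 0")
    case False
    define a where "a = cinner (x - p) y"
    define c where "c = a / of_real ((norm y)\<^sup>2)"
    have "p + c *\<^sub>C y \<in> M"
      using pM y M closed_csubspaceD by blast
    from d_le[OF this] have "(norm (x - p))\<^sup>2 \<le> (norm ((x - p) - c *\<^sub>C y))\<^sup>2"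
      using d0 pd by (auto simp: power_mono diff_diff_eq)
    also have "\<dots> = (norm (x - p))\<^sup>2 + (norm c * norm y)\<^sup>2 - 2 * Re (cnj c * a)"
      by (simp add: norm_sq_diff norm_scaleC cinner_scaleC_right a_def)
    also have "(norm c * norm y)\<^sup>2 = (norm a)\<^sup>2 / (norm y)\<^sup>2"
      using False
      by (simp add: c_def norm_divide power_divide del: of_real_power)
        (simp add: power2_eq_square power4_eq_xxxx field_simps)
    also have "cnj c * a = of_real ((norm a)\<^sup>2 / (norm y)\<^sup>2)"
      by (simp add: c_def complex_norm_square mult.commute del: of_real_power)
    finally have "(norm a)\<^sup>2 / (norm y)\<^sup>2 \<le> 0"
      by simp
    with False show ?thesis
      by (simp add: a_def[symmetric] divide_le_0_iff)
  qed (simp add: cinner.zero_right)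
  with pM show ?thesis
    by blast
qed

lemma projection_unique:
  assumes M: "closed_csubspace M" and "p \<in> M" "\<forall>y\<in>M. cinner (x - p) y = 0"
    and "q \<in> M" "\<forall>y\<in>M. cinner (x - q) y = 0"
  shows "p = q"
proof -
  have "p - q \<in> M"
    using assms closed_csubspaceD(5) by blast
  then have "cinner (x - q) (p - q) - cinner (x - p) (p - q) = 0"
    using assms by simp
  then have "cinner (p - q) (p - q) = 0"
    by (simp add: cinner.diff_left)
  then show ?thesis
    by (simp add: cinner_self)
qed

lemma ortho_proj:
  assumes M: "closed_csubspace M"
  shows ortho_proj_in: "ortho_proj M x \<in> M"
    and ortho_proj_orthogonal: "y \<in> M \<Longrightarrow> cinner (x - ortho_proj M x) y = 0"
proof -
  have "\<exists>!p. p \<in> M \<and> (\<forall>y\<in>M. cinner (x - p) y = 0)"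
    using projection_exists[OF M, of x] projection_unique[OF M] by blast
  from theI'[OF this] show "ortho_proj M x \<in> M" "y \<in> M \<Longrightarrow> cinner (x - ortho_proj M x) y = 0"
    unfolding ortho_proj_def by blast+
qed

lemma ortho_projI:
  assumes "closed_csubspace M" "p \<in> M" "\<And>y. y \<in> M \<Longrightarrow> cinner (x - p) y = 0"
  shows "ortho_proj M x = p"
  using projection_unique[OF assms(1)] ortho_proj[OF assms(1)] assms(2,3) by blast

lemma ortho_proj_ident: "closed_csubspace M \<Longrightarrow> x \<in> M \<Longrightarrow> ortho_proj M x = x"
  by (rule ortho_projI) (auto simp: cinner.zero_left)

lemma cinner_ortho_proj:
  assumes M: "closed_csubspace M"
  shows "cinner (ortho_proj M x) y = cinner x (ortho_proj M y)"
proof -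
  have "cinner (x - ortho_proj M x) (ortho_proj M y) = 0"
    using ortho_proj[OF M] by blast
  moreover have "cinner (y - ortho_proj M y) (ortho_proj M x) = 0"
    using ortho_proj[OF M] by blast
  then have "cinner (ortho_proj M x) (y - ortho_proj M y) = 0"
    by (metis cinner_commute complex_cnj_zero)
  ultimately show ?thesis
    by (simp add: cinner.diff_left cinner.diff_right)
qed

lemma norm_ortho_proj_le:
  assumes M: "closed_csubspace M"
  shows "norm (ortho_proj M x) \<le> norm x"
proof -
  have "cinner (x - ortho_proj M x) (ortho_proj M x) = 0"
    using ortho_proj[OF M] by blast
  then have "(norm ((x - ortho_proj M x) + ortho_proj M x))\<^sup>2 =
      (norm (x - ortho_proj M x))\<^sup>2 + (norm (ortho_proj M x))\<^sup>2"
    unfolding norm_sq_add by simp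
  then have "(norm (ortho_proj M x))\<^sup>2 \<le> (norm x)\<^sup>2"
    by simp
  then show ?thesis
    by (simp add: power2_le_iff_abs_le)
qed

lemma bounded_clinearI:
  assumes "\<And>x y. A (x + y) = A x + A y" "\<And>c x. A (c *\<^sub>C x) = c *\<^sub>C A x"
    "\<And>x. norm (A x) \<le> K * norm x"
  shows "bounded_clinear A"
  unfolding bounded_clinear_def
proof (intro conjI allI)
  show "bounded_linear A"
    using assms(1) assms(2)[of "of_real _"] assms(3)
    by (intro bounded_linear_intro[where K = K]) (simp_all add: scaleC_of_real mult.commute)
qed (rule assms(2))

lemma bounded_clinearD:
  assumes "bounded_clinear A"
  shows "bounded_linear A" "A (c *\<^sub>C x) = c *\<^sub>C A x" "A (x + y) = A x + A y"
    "A (x - y) = A x - A y" "A 0 = 0" "A (r *\<^sub>R x) = r *\<^sub>R A x"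
  using assms unfolding bounded_clinear_def
  by (auto simp: linear_simps)

lemma bounded_clinear_add:
  "bounded_clinear A \<Longrightarrow> bounded_clinear B \<Longrightarrow> bounded_clinear (\<lambda>x. A x + B x)"
  by (simp add: bounded_clinear_def bounded_linear_add scaleC_add_right)

lemma bounded_clinear_scaleC:
  "bounded_clinear A \<Longrightarrow> bounded_clinear (\<lambda>x. c *\<^sub>C A x)"
  by (auto simp: bounded_clinear_def scaleC_scaleC mult.commute
      intro: bounded_linear_compose[OF scaleC.bounded_linear_right, of _ c, simplified o_def])

lemma bounded_clinear_comp:
  "bounded_clinear A \<Longrightarrow> bounded_clinear B \<Longrightarrow> bounded_clinear (A \<circ> B)"
  by (auto simp: bounded_clinear_def o_def intro: bounded_linear_compose)

lemma bounded_clinear_zero: "bounded_clinear (\<lambda>x. 0)"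
  by (simp add: bounded_clinear_def scaleC.zero_right)

lemma bounded_clinear_id: "bounded_clinear id"
  by (simp add: bounded_clinear_def id_def bounded_linear_ident)

lemma bounded_clinear_ortho_proj:
  assumes M: "closed_csubspace M"
  shows "bounded_clinear (ortho_proj M)"
proof (rule bounded_clinearI)
  show "ortho_proj M (x + y) = ortho_proj M x + ortho_proj M y" for x y
    by (rule cinner_eqI) (simp add: cinner_ortho_proj[OF M] cinner_add_left)
  show "ortho_proj M (c *\<^sub>C x) = c *\<^sub>C ortho_proj M x" for c x
    by (rule cinner_eqI) (simp add: cinner_ortho_proj[OF M] cinner_scaleC_left)
  show "norm (ortho_proj M x) \<le> 1 * norm x" for x
    using norm_ortho_proj_le[OF M] by simp
qed

theorem adjoint_exists:
  assumes A: "bounded_clinear A"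
  shows "\<exists>B. \<forall>x y. cinner (A x) y = cinner x (B y)"
proof -
  have "\<exists>z. \<forall>x. cinner (A x) y = cinner x z" for y
  proof -
    define f where "f x = cinner (A x) y" for x
    define N where "N = {x. f x = 0}"
    have f_lin: "f (x + x') = f x + f x'" "f (c *\<^sub>C x) = c * f x" "f (x - x') = f x - f x'" for x x' c
      by (simp_all add: f_def bounded_clinearD[OF A] cinner.add_left cinner.diff_left cinner_scaleC_left)
    have "continuous_on UNIV f"
      unfolding f_def using bounded_clinearD(1)[OF A]
      by (intro cinner.continuous_on continuous_on_const linear_continuous_on)
    then have "closed N"
      unfolding N_def by (intro closed_Collect_eq continuous_on_const)
    then have N: "closed_csubspace N"
      using f_lin(2)[of 0 0]
      by (simp add: closed_csubspace_def complex_hilbert.subspace_def N_def f_lin scaleC.zero_left)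
    show ?thesis
    proof (cases "N = UNIV")
      case True
      then show ?thesis
        by (intro exI[of _ 0]) (auto simp: N_def f_def cinner.zero_right)
    next
      case False
      then obtain w where w: "w \<notin> N"
        by auto
      define u where "u = w - ortho_proj N w"
      have orth: "cinner v u = 0" if "v \<in> N" for v
        using ortho_proj_orthogonal[OF N that, of w] cinner_commute[of v u] by (simp add: u_def)
      have "f u = f w"
        using ortho_proj_in[OF N, of w] by (simp add: u_def f_lin N_def)
      then have fu: "f u \<noteq> 0"
        using w by (simp add: N_def)
      then have u0: "u \<noteq> 0"
        using f_lin(2)[of 0 0] by (auto simp: scaleC.zero_left)
      have "f x = cinner x ((cnj (f u) / of_real ((norm u)\<^sup>2)) *\<^sub>C u)" for x
      proof -
        have "x - (f x / f u) *\<^sub>C u \<in> N"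
          using fu by (simp add: N_def f_lin)
        from orth[OF this] have "cinner x u = f x / f u * of_real ((norm u)\<^sup>2)"
          by (simp add: cinner.diff_left cinner_scaleC_left cinner_self)
        then show ?thesis
          using fu u0 by (simp add: cinner_scaleC_right)
      qed
      then show ?thesis
        unfolding f_def by blast
    qed
  qed
  then show ?thesis
    by metis
qed

lemma cinner_cadjoint: "bounded_clinear A \<Longrightarrow> cinner (A x) y = cinner x (cadjoint A y)"
  unfolding cadjoint_def using someI_ex[OF adjoint_exists, of A] by blast

lemma cinner_cadjoint': "bounded_clinear A \<Longrightarrow> cinner (cadjoint A x) y = cinner x (A y)"
  by (metis cinner_cadjoint cinner_commute)

lemma cadjoint_eqI:
  assumes "bounded_clinear A" "\<And>x y. cinner (A x) y = cinner x (B y)"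
  shows "cadjoint A = B"
proof
  fix y
  show "cadjoint A y = B y"
    by (rule cinner_eqI) (metis assms cinner_cadjoint' cinner_commute)
qed

lemma norm_le_cinnerI:
  fixes x :: "'a::complex_hilbert"
  assumes "\<And>y. norm (cinner x y) \<le> K * norm y" "0 \<le> K"
  shows "norm x \<le> K"
proof -
  have "norm x * norm x \<le> K * norm x"
    using assms(1)[of x] by (simp add: cinner_self power2_eq_square norm_mult)
  then show ?thesis
    using assms(1)[of x] \<open>0 \<le> K\<close> by (cases "x = 0") auto
qed

text \<open>Closed subspaces are weakly closed: they contain every vector that is orthogonal to their
  orthogonal complement.\<close>

lemma in_closed_csubspaceI:
  assumes M: "closed_csubspace M"
    and "\<And>y. (\<And>m. m \<in> M \<Longrightarrow> cinner m y = 0) \<Longrightarrow> cinner x y = 0"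
  shows "x \<in> M"
proof -
  define z where "z = x - ortho_proj M x"
  have z: "cinner m z = 0" if "m \<in> M" for m
    using ortho_proj_orthogonal[OF M that, of x] cinner_commute[of m z] by (simp add: z_def)
  have "cinner x z = 0"
    using z by (rule assms(2))
  then have "cinner z z = 0"
    using z[OF ortho_proj_in[OF M, of x]] by (simp add: z_def cinner.diff_left)
  then have "x = ortho_proj M x"
    by (simp add: cinner_self z_def)
  then show ?thesis
    using ortho_proj_in[OF M, of x] by simp
qed

lemma closed_csubspace_closure_cspan: "closed_csubspace (closure (cspan X))"
proof -
  have "\<exists>l. l \<in> cspan X" "\<And>x y. x \<in> cspan X \<Longrightarrow> y \<in> cspan X \<Longrightarrow> x + y \<in> cspan X"
    "\<And>c x. x \<in> cspan X \<Longrightarrow> c *\<^sub>C x \<in> cspan X" "0 \<in> cspan X"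
    by (auto intro: complex_hilbert.span_add complex_hilbert.span_scale complex_hilbert.span_zero)
  note S = this
  have "x + y \<in> closure (cspan X)" if xy: "x \<in> closure (cspan X)" "y \<in> closure (cspan X)" for x y
  proof -
    from xy obtain f g where "\<forall>n. f n \<in> cspan X" "f \<longlonglongrightarrow> x" "\<forall>n. g n \<in> cspan X" "g \<longlonglongrightarrow> y"
      by (auto simp: closure_sequential)
    then show ?thesis
      unfolding closure_sequential
      by (intro exI[of _ "\<lambda>n. f n + g n"]) (auto intro: S tendsto_add)
  qed
  moreover have "c *\<^sub>C x \<in> closure (cspan X)" if x: "x \<in> closure (cspan X)" for c x
  proof -
    from x obtain f where "\<forall>n. f n \<in> cspan X" "f \<longlonglongrightarrow> x"
      by (auto simp: closure_sequential)
    then show ?thesis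
      unfolding closure_sequential
      by (intro exI[of _ "\<lambda>n. c *\<^sub>C f n"]) (auto intro: S scaleC.tendsto)
  qed
  ultimately show ?thesis
    using S(4) closure_subset[of "cspan X"]
    by (auto simp: closed_csubspace_def complex_hilbert.subspace_def)
qed

lemma subset_closure_cspan: "X \<subseteq> closure (cspan X)"
  using closure_subset complex_hilbert.span_superset by blast

lemma closure_cspan_minimal: "X \<subseteq> M \<Longrightarrow> closed_csubspace M \<Longrightarrow> closure (cspan X) \<subseteq> M"
  by (simp add: closed_csubspace_def closure_minimal complex_hilbert.span_minimal)

lemma closed_csubspace_ker:
  assumes A: "bounded_clinear A"
  shows "closed_csubspace {x. A x = 0}"
proof -
  have "closed {x. A x = 0}"
    using bounded_clinearD(1)[OF A]
    by (intro closed_Collect_eq continuous_on_const linear_continuous_on)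
  then show ?thesis
    by (auto simp: closed_csubspace_def complex_hilbert.subspace_def bounded_clinearD[OF A]
        scaleC.zero_right)
qed

lemma closed_csubspace_vimage:
  assumes A: "bounded_clinear A" and M: "closed_csubspace M"
  shows "closed_csubspace {x. A x \<in> M}"
proof -
  have "closed (A -` M)"
    using bounded_clinearD(1)[OF A] closed_csubspaceD(1)[OF M]
    by (intro closed_vimage linear_continuous_on)
  then show ?thesis
    by (auto simp: closed_csubspace_def complex_hilbert.subspace_def bounded_clinearD[OF A]
        closed_csubspaceD[OF M] vimage_def)
qed

lemma closed_csubspace_Inter:
  "(\<And>M. M \<in> \<M> \<Longrightarrow> closed_csubspace M) \<Longrightarrow> closed_csubspace (\<Inter>\<M>)"
  by (simp add: closed_csubspace_def complex_hilbert.subspace_def closed_Inter)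

text \<open>The orthogonal complement of a set.\<close>

definition ocompl :: "'a::complex_hilbert set \<Rightarrow> 'a set" where
  "ocompl M = {x. \<forall>y\<in>M. cinner x y = 0}"

lemma closed_csubspace_ocompl: "closed_csubspace (ocompl M)"
proof -
  have "closed (\<Inter>y\<in>M. {x. cinner x y = 0})"
    by (intro closed_INT ballI closed_Collect_eq continuous_on_const cinner.continuous_on
        continuous_on_id)
  moreover have "(\<Inter>y\<in>M. {x. cinner x y = 0}) = ocompl M"
    by (auto simp: ocompl_def)
  ultimately show ?thesis
    by (auto simp: closed_csubspace_def complex_hilbert.subspace_def ocompl_def
        cinner.zero_left cinner.add_left cinner_scaleC_left)
qed

lemma orthogonal_closure_cspan:
  assumes "\<And>y. y \<in> X \<Longrightarrow> cinner x y = 0" "y \<in> closure (cspan X)"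
  shows "cinner x y = 0"
proof -
  have sym: "cinner y x = 0 \<longleftrightarrow> cinner x y = 0" for y
    using cinner_commute[of y x] by simp
  have "X \<subseteq> ocompl {x}"
    using assms(1) by (auto simp: ocompl_def sym)
  then have "y \<in> ocompl {x}"
    using closure_cspan_minimal[OF _ closed_csubspace_ocompl] assms(2) by blast
  then show ?thesis
    by (simp add: ocompl_def sym)
qed

lemma bounded_clinear_cadjoint:
  assumes A: "bounded_clinear A"
  shows "bounded_clinear (cadjoint A)"
proof -
  obtain K where K: "\<And>x. norm (A x) \<le> norm x * K" "0 \<le> K"
    using bounded_linear.nonneg_bounded[OF bounded_clinearD(1)[OF A]] by blast
  show ?thesis
  proof (rule bounded_clinearI)
    show "cadjoint A (x + y) = cadjoint A x + cadjoint A y" for x y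
      by (rule cinner_eqI) (simp add: cinner_cadjoint'[OF A] cinner.add_left)
    show "cadjoint A (c *\<^sub>C x) = c *\<^sub>C cadjoint A x" for c x
      by (rule cinner_eqI) (simp add: cinner_cadjoint'[OF A] cinner_scaleC_left)
    show "norm (cadjoint A x) \<le> K * norm x" for x
    proof (rule norm_le_cinnerI)
      show "norm (cinner (cadjoint A x) y) \<le> K * norm x * norm y" for y
        using cauchy_schwarz[of x "A y"] mult_left_mono[OF K(1)[of y] norm_ge_zero[of x]]
        by (simp add: cinner_cadjoint'[OF A] algebra_simps)
    qed (use K in simp)
  qed
qed

lemma cadjoint_cadjoint: "bounded_clinear A \<Longrightarrow> cadjoint (cadjoint A) = A"
  by (rule cadjoint_eqI) (auto simp: bounded_clinear_cadjoint cinner_cadjoint')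

lemma cadjoint_comp:
  "bounded_clinear A \<Longrightarrow> bounded_clinear B \<Longrightarrow> cadjoint (A \<circ> B) = cadjoint B \<circ> cadjoint A"
  by (rule cadjoint_eqI) (auto simp: bounded_clinear_comp cinner_cadjoint)

lemma cadjoint_add:
  "bounded_clinear A \<Longrightarrow> bounded_clinear B \<Longrightarrow>
    cadjoint (\<lambda>x. A x + B x) = (\<lambda>x. cadjoint A x + cadjoint B x)"
  by (rule cadjoint_eqI) (auto simp: bounded_clinear_add cinner_cadjoint cinner.add_left cinner.add_right)

lemma cadjoint_scaleC:
  "bounded_clinear A \<Longrightarrow> cadjoint (\<lambda>x. c *\<^sub>C A x) = (\<lambda>x. cnj c *\<^sub>C cadjoint A x)"
  by (rule cadjoint_eqI)
    (auto simp: bounded_clinear_scaleC cinner_cadjoint cinner_scaleC_left cinner_scaleC_right)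

lemma cadjoint_zero: "cadjoint (\<lambda>x. 0) = (\<lambda>x. 0)"
  by (rule cadjoint_eqI) (auto simp: bounded_clinear_zero cinner.zero_left cinner.zero_right)

lemma cadjoint_ortho_proj: "closed_csubspace M \<Longrightarrow> cadjoint (ortho_proj M) = ortho_proj M"
  by (rule cadjoint_eqI) (auto simp: bounded_clinear_ortho_proj cinner_ortho_proj)

lemma cinner_eq_0_sym: "cinner x y = 0 \<longleftrightarrow> cinner y x = 0" for x :: "'a::complex_hilbert"
  using cinner_commute[of x y] by simp

lemma ortho_proj_commute:
  assumes N: "closed_csubspace N" and A: "bounded_clinear A"
    and inv: "A ` N \<subseteq> N" "cadjoint A ` N \<subseteq> N"
  shows "ortho_proj N (A x) = A (ortho_proj N x)"
proof (rule ortho_projI[OF N])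
  show "A (ortho_proj N x) \<in> N"
    using inv(1) ortho_proj_in[OF N] by blast
  show "cinner (A x - A (ortho_proj N x)) y = 0" if "y \<in> N" for y
    using inv(2) that ortho_proj_orthogonal[OF N, of "cadjoint A y" x]
    by (auto simp: cinner_cadjoint[OF A] simp flip: bounded_clinearD(4)[OF A])
qed

text \<open>Uniform boundedness makes strong convergence of contractions a property of a closed subspace, so
  that it only needs to be checked on a set with dense span.\<close>

lemma closed_csubspace_convergence:
  fixes f :: "'k \<Rightarrow> 'a \<Rightarrow> 'a::complex_hilbert"
  assumes f: "\<And>k. bounded_clinear (f k)" "\<And>k x. norm (f k x) \<le> norm x"
    and g: "bounded_clinear g" "\<And>x. norm (g x) \<le> norm x"
  shows "closed_csubspace {x. ((\<lambda>k. f k x) \<longlongrightarrow> g x) F}" (is "closed_csubspace ?W")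
proof -
  have "closed ?W"
    unfolding closed_sequential_limits
  proof safe
    fix z x
    assume z: "\<forall>n. z n \<in> ?W" and lim: "z \<longlonglongrightarrow> x"
    show "((\<lambda>k. f k x) \<longlongrightarrow> g x) F"
    proof (rule tendstoI)
      fix e :: real
      assume e: "e > 0"
      have "eventually (\<lambda>n. dist (z n) x < e / 3) sequentially"
        using lim e by (intro tendstoD) auto
      then obtain n where n: "norm (x - z n) < e / 3"
        by (auto simp: dist_norm norm_minus_commute dest!: eventually_happens'[OF sequentially_bot])
      have "eventually (\<lambda>k. dist (f k (z n)) (g (z n)) < e / 3) F"
        using z e by (intro tendstoD) auto
      then show "eventually (\<lambda>k. dist (f k x) (g x) < e) F"
      proof eventually_elim
        case (elim k)
        have "f k x - g x = f k (x - z n) + ((f k (z n) - g (z n)) - g (x - z n))"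
          by (simp add: bounded_clinearD(4)[OF f(1)] bounded_clinearD(4)[OF g(1)])
        also have "norm \<dots> \<le> norm (f k (x - z n)) + (norm (f k (z n) - g (z n)) + norm (g (x - z n)))"
          by (rule order_trans[OF norm_triangle_ineq add_left_mono[OF norm_triangle_ineq4]])
        finally show ?case
          using elim n f(2)[of k "x - z n"] g(2)[of "x - z n"] by (simp add: dist_norm)
      qed
    qed
  qed
  then show ?thesis
    by (auto simp: closed_csubspace_def complex_hilbert.subspace_def bounded_clinearD[OF f(1)]
        bounded_clinearD[OF g(1)] intro: tendsto_add scaleC.tendsto)
qed

lemma bounded_clinear_diff:
  "bounded_clinear A \<Longrightarrow> bounded_clinear B \<Longrightarrow> bounded_clinear (\<lambda>x. A x - B x)"
  by (simp add: bounded_clinear_def bounded_linear_sub scaleC.diff_right)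

section \<open>Weakly closed algebras of operators on a closed subspace\<close>

lemma operators_onD:
  assumes "A \<in> operators_on M"
  shows "bounded_clinear A" "A x \<in> M" "A (ortho_proj M x) = A x"
  using assms by (auto simp: operators_on_def fun_eq_iff)

lemma operators_onI:
  "bounded_clinear A \<Longrightarrow> (\<And>x. A x \<in> M) \<Longrightarrow> (\<And>x. A (ortho_proj M x) = A x) \<Longrightarrow> A \<in> operators_on M"
  by (auto simp: operators_on_def fun_eq_iff)

context
  fixes M :: "'a::complex_hilbert set"
  assumes M: "closed_csubspace M"
begin

lemma zero_operator: "(\<lambda>x. 0) \<in> operators_on M"
  by (intro operators_onI) (simp_all add: closed_csubspaceD(2)[OF M] bounded_clinear_zero)

lemma add_operator:
  "A \<in> operators_on M \<Longrightarrow> B \<in> operators_on M \<Longrightarrow> (\<lambda>x. A x + B x) \<in> operators_on M"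
  by (intro operators_onI) (auto simp: bounded_clinear_add closed_csubspaceD(3)[OF M] operators_onD)

lemma scaleC_operator: "A \<in> operators_on M \<Longrightarrow> (\<lambda>x. c *\<^sub>C A x) \<in> operators_on M"
  by (intro operators_onI) (auto simp: bounded_clinear_scaleC closed_csubspaceD(4)[OF M] operators_onD)

lemma comp_operator: "A \<in> operators_on M \<Longrightarrow> B \<in> operators_on M \<Longrightarrow> A \<circ> B \<in> operators_on M"
  by (intro operators_onI) (auto simp: bounded_clinear_comp operators_onD)

lemma ortho_proj_operator_left: "A \<in> operators_on M \<Longrightarrow> ortho_proj M (A x) = A x"
  by (simp add: ortho_proj_ident[OF M] operators_onD)

lemma cadjoint_operator:
  assumes A: "A \<in> operators_on M"
  shows "cadjoint A \<in> operators_on M"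
proof (rule operators_onI)
  note b = operators_onD(1)[OF A]
  show "bounded_clinear (cadjoint A)"
    by (rule bounded_clinear_cadjoint[OF b])
  show "cadjoint A (ortho_proj M x) = cadjoint A x" for x
    by (rule cinner_eqI)
      (simp add: cinner_cadjoint'[OF b] cinner_ortho_proj[OF M] ortho_proj_operator_left[OF A])
  have "ortho_proj M (cadjoint A x) = cadjoint A x" for x
    by (rule cinner_eqI)
      (simp add: cinner_cadjoint'[OF b] cinner_ortho_proj[OF M] operators_onD[OF A])
  then show "cadjoint A x \<in> M" for x
    using ortho_proj_in[OF M, of "cadjoint A x"] by simp
qed

end

lemma tendsto_fun_iff:
  fixes f :: "'b \<Rightarrow> 'i \<Rightarrow> 'c::topological_space"
  shows "(f \<longlongrightarrow> l) F \<longleftrightarrow> (\<forall>i. ((\<lambda>k. f k i) \<longlongrightarrow> l i) F)"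
proof -
  have "(f \<longlongrightarrow> l) F \<longleftrightarrow> limitin (product_topology (\<lambda>i. euclidean) UNIV) f l F"
    by (simp add: euclidean_product_topology)
  also have "\<dots> \<longleftrightarrow> (\<forall>i. ((\<lambda>k. f k i) \<longlongrightarrow> l i) F)"
    unfolding limitin_componentwise by simp
  finally show ?thesis .
qed

lemma topspace_wot: "topspace (weak_operator_topology M) = operators_on M"
  by (simp add: weak_operator_topology_def topspace_pullback_topology)

text \<open>The weak operator topology is that of convergence of all matrix coefficients, along arbitrary
  filters.\<close>

lemma limitin_wot:
  "limitin (weak_operator_topology M) f V F \<longleftrightarrow>
     V \<in> operators_on M \<and> eventually (\<lambda>k. f k \<in> operators_on M) F \<and>
     (\<forall>x y. ((\<lambda>k. cinner (f k x) y) \<longlongrightarrow> cinner (V x) y) F)"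
proof -
  define \<phi> :: "('a \<Rightarrow> 'a) \<Rightarrow> 'a \<times> 'a \<Rightarrow> complex" where "\<phi> = (\<lambda>A (x, y). cinner (A x) y)"
  have "((\<lambda>k. \<phi> (f k)) \<longlongrightarrow> \<phi> V) F \<longleftrightarrow> (\<forall>x y. ((\<lambda>k. cinner (f k x) y) \<longlongrightarrow> cinner (V x) y) F)"
    unfolding tendsto_fun_iff by (simp add: \<phi>_def)
  moreover have "limitin (pullback_topology (operators_on M) \<phi> euclidean) f V F \<longleftrightarrow>
      V \<in> operators_on M \<and> eventually (\<lambda>k. f k \<in> operators_on M) F \<and> ((\<lambda>k. \<phi> (f k)) \<longlongrightarrow> \<phi> V) F"
    (is "?L \<longleftrightarrow> ?R")
  proof
    assume L: ?L
    then have V: "V \<in> operators_on M"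
      by (simp add: limitin_def topspace_pullback_topology)
    have ev: "eventually (\<lambda>k. \<phi> (f k) \<in> U \<and> f k \<in> operators_on M) F" if "open U" "\<phi> V \<in> U" for U
      using limitinD[OF L, of "\<phi> -` U \<inter> operators_on M"] that V
      by (auto simp: openin_pullback_topology)
    have "eventually (\<lambda>k. f k \<in> operators_on M) F"
      using ev[of UNIV] by simp
    moreover have "((\<lambda>k. \<phi> (f k)) \<longlongrightarrow> \<phi> V) F"
      by (rule topological_tendstoI) (rule eventually_mono[OF ev], auto)
    ultimately show ?R
      using V by blast
  next
    assume R: ?R
    show ?L
      unfolding limitin_def topspace_pullback_topology openin_pullback_topology
      using R by (auto simp: tendsto_def eventually_conj_iff)
  qed
  ultimately show ?thesis
    by (simp add: weak_operator_topology_def \<phi>_def)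
qed

text \<open>Sequences do not suffice to describe closed sets in the weak operator topology, so closedness is
  tested on filters of operators.\<close>

lemma closedin_wotI:
  assumes B: "B \<subseteq> operators_on M"
    and lim: "\<And>(F :: ('a \<Rightarrow> 'a::complex_hilbert) filter) V. F \<noteq> bot \<Longrightarrow> V \<in> operators_on M \<Longrightarrow>
      eventually (\<lambda>A. A \<in> B) F \<Longrightarrow>
      (\<And>x y. ((\<lambda>A. cinner (A x) y) \<longlongrightarrow> cinner (V x) y) F) \<Longrightarrow> V \<in> B"
  shows "closedin (weak_operator_topology M) B"
proof -
  have "V \<in> B" if V: "V \<in> weak_operator_topology M closure_of B" for V
  proof -
    define F where "F = inf (nhdsin (weak_operator_topology M) V) (principal B)"
    have VM: "V \<in> operators_on M"
      using V by (auto simp: in_closure_of topspace_wot)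
    have ev: "eventually P F \<longleftrightarrow>
        (\<exists>U. openin (weak_operator_topology M) U \<and> V \<in> U \<and> (\<forall>A\<in>U. A \<in> B \<longrightarrow> P A))" for P
      using VM by (simp add: F_def eventually_inf_principal eventually_nhdsin topspace_wot)
    have "F \<noteq> bot"
      unfolding trivial_limit_def ev using V by (auto simp: in_closure_of)
    moreover have "eventually (\<lambda>A. A \<in> B) F"
      by (simp add: F_def eventually_inf_principal)
    moreover have "limitin (weak_operator_topology M) (\<lambda>A. A) V F"
      unfolding limitin_def topspace_wot using VM ev by auto
    ultimately show ?thesis
      using lim VM unfolding limitin_wot by blast
  qed
  then show ?thesis
    using B closure_of_subset_eq[of B "weak_operator_topology M"] by (auto simp: topspace_wot)
qed

text \<open>In fact names, \<open>wcsa\<close> stands for \<^const>\<open>weakly_closed_star_subalgebra\<close>.\<close>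

lemma wcsaI:
  assumes M: "closed_csubspace M" and "B \<subseteq> operators_on M" "(\<lambda>x. 0) \<in> B"
    "\<And>V W. V \<in> B \<Longrightarrow> W \<in> B \<Longrightarrow> (\<lambda>x. V x + W x) \<in> B"
    "\<And>c V. V \<in> B \<Longrightarrow> (\<lambda>x. c *\<^sub>C V x) \<in> B"
    "\<And>V W. V \<in> B \<Longrightarrow> W \<in> B \<Longrightarrow> V \<circ> W \<in> B"
    "\<And>V. V \<in> B \<Longrightarrow> cadjoint V \<in> B"
    "\<And>(F :: ('a \<Rightarrow> 'a::complex_hilbert) filter) V. F \<noteq> bot \<Longrightarrow> V \<in> operators_on M \<Longrightarrow>
      eventually (\<lambda>A. A \<in> B) F \<Longrightarrow>
      (\<And>x y. ((\<lambda>A. cinner (A x) y) \<longlongrightarrow> cinner (V x) y) F) \<Longrightarrow> V \<in> B"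
  shows "weakly_closed_star_subalgebra M B"
  unfolding weakly_closed_star_subalgebra_def star_subalgebra_def
  using assms(2-7) closedin_wotI[OF assms(2,8)] by auto

lemma wcsaD:
  assumes "weakly_closed_star_subalgebra M B"
  shows "B \<subseteq> operators_on M" "(\<lambda>x. 0) \<in> B"
    "V \<in> B \<Longrightarrow> W \<in> B \<Longrightarrow> (\<lambda>x. V x + W x) \<in> B"
    "V \<in> B \<Longrightarrow> (\<lambda>x. c *\<^sub>C V x) \<in> B"
    "V \<in> B \<Longrightarrow> W \<in> B \<Longrightarrow> V \<circ> W \<in> B"
    "V \<in> B \<Longrightarrow> cadjoint V \<in> B"
  using assms by (auto simp: weakly_closed_star_subalgebra_def star_subalgebra_def)

lemma wcsa_limit:
  assumes B: "weakly_closed_star_subalgebra M B" and "F \<noteq> bot" "V \<in> operators_on M"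
    "eventually (\<lambda>k. f k \<in> B) F"
    "\<And>x y. ((\<lambda>k. cinner (f k x) y) \<longlongrightarrow> cinner (V x) y) F"
  shows "V \<in> B"
proof (rule limitin_closedin)
  show "closedin (weak_operator_topology M) B"
    using B by (simp add: weakly_closed_star_subalgebra_def)
  show "limitin (weak_operator_topology M) f V F"
    unfolding limitin_wot using assms wcsaD(1)[OF B] by (auto elim!: eventually_mono)
qed (use assms in auto)

lemma wcsa_operators_on:
  assumes M: "closed_csubspace M"
  shows "weakly_closed_star_subalgebra M (operators_on M)"
  by (rule wcsaI) (use M in \<open>auto intro: zero_operator add_operator scaleC_operator comp_operator
      cadjoint_operator\<close>)

lemma generated_algebra_superset: "X \<subseteq> generated_algebra M X"
  by (simp add: generated_algebra_def hull_subset)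

lemma generated_algebra_minimal:
  "X \<subseteq> B \<Longrightarrow> weakly_closed_star_subalgebra M B \<Longrightarrow> generated_algebra M X \<subseteq> B"
  unfolding generated_algebra_def by (rule hull_minimal)

lemma wcsa_generated_algebra:
  assumes M: "closed_csubspace M" and X: "X \<subseteq> operators_on M"
  shows "weakly_closed_star_subalgebra M (generated_algebra M X)"
proof -
  define \<B> where "\<B> = {B. weakly_closed_star_subalgebra M B \<and> X \<subseteq> B}"
  have eq: "generated_algebra M X = \<Inter>\<B>"
    by (simp add: generated_algebra_def hull_def \<B>_def)
  have mem: "weakly_closed_star_subalgebra M B" if "B \<in> \<B>" for B
    using that by (simp add: \<B>_def)
  have ops: "operators_on M \<in> \<B>"
    using wcsa_operators_on[OF M] X by (simp add: \<B>_def)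
  show ?thesis
    unfolding eq
  proof (rule wcsaI[OF M])
    show "V \<in> \<Inter>\<B>" if "F \<noteq> bot" "V \<in> operators_on M" "eventually (\<lambda>A. A \<in> \<Inter>\<B>) F"
      "\<And>x y. ((\<lambda>A. cinner (A x) y) \<longlongrightarrow> cinner (V x) y) F" for F :: "('a \<Rightarrow> 'a) filter" and V
      using that by (auto intro!: wcsa_limit[OF mem, of _ F V "\<lambda>A. A"] elim: eventually_mono)
  qed (use ops wcsaD[OF mem] in auto)
qed

section \<open>Units of weakly closed algebras\<close>

text \<open>The hypothesis \<open>firm\<close> says \<open>0 \<le> h\<^sup>2 \<le> h\<close>, that is, \<open>0 \<le> h \<le> 1\<close>. Then \<open>c = 1 - h\<close> is a self-adjoint
  contraction, the norms of \<open>c\<^sup>n x\<close> decrease, and therefore the even powers \<open>c\<^bsup>2n\<^esup> x\<close> form a Cauchy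
  sequence; its limit is the projection of \<open>x\<close> onto the kernel of \<open>h\<close>.\<close>

lemma support_projection_in_wcsa:
  assumes M: "closed_csubspace M" and B: "weakly_closed_star_subalgebra M B" and h: "h \<in> B"
    and sym: "\<And>x y. cinner (h x) y = cinner x (h y)"
    and firm: "\<And>x. (norm (h x))\<^sup>2 \<le> Re (cinner (h x) x)"
  shows "(\<lambda>x. x - ortho_proj {x. h x = 0} x) \<in> B"
proof -
  define N where "N = {x. h x = 0}"
  have h_op: "h \<in> operators_on M"
    using h wcsaD(1)[OF B] by blast
  have h_lin: "bounded_clinear h"
    using operators_onD(1)[OF h_op] .
  note hD = bounded_clinearD[OF h_lin]
  have N: "closed_csubspace N"
    unfolding N_def by (rule closed_csubspace_ker[OF h_lin])
  define c where "c x = x - h x" for x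
  have c_sym: "cinner (c x) y = cinner x (c y)" for x y
    by (simp add: c_def cinner.diff_left cinner.diff_right sym)
  have c_contr: "norm (c x) \<le> norm x" for x
  proof -
    have "Re (cinner x (h x)) = Re (cinner (h x) x)"
      using sym[of x x] by simp
    then have "(norm (c x))\<^sup>2 \<le> (norm x)\<^sup>2 - Re (cinner (h x) x)"
      unfolding c_def norm_sq_diff using firm[of x] by simp
    also have "\<dots> \<le> (norm x)\<^sup>2"
      using firm[of x] zero_le_power2[of "norm (h x)"] by linarith
    finally show ?thesis
      by (simp add: power2_le_iff_abs_le)
  qed
  have pow_sym: "cinner ((c ^^ n) x) y = cinner x ((c ^^ n) y)" for n x y
    by (induction n arbitrary: y) (simp_all add: c_sym funpow_swap1[symmetric])
  define b where "b x n = (norm ((c ^^ n) x))\<^sup>2" for x n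
  have cinner_pow: "cinner ((c ^^ i) x) ((c ^^ j) x) = cinner x ((c ^^ (i + j)) x)" for i j x
    by (simp add: funpow_add pow_sym)
  have gap: "(norm ((c ^^ (2*n)) x - (c ^^ (2*m)) x))\<^sup>2 = b x (2*n) + b x (2*m) - 2 * b x (n+m)" for n m x
  proof -
    have "cinner ((c ^^ (2*n)) x) ((c ^^ (2*m)) x) = cinner ((c ^^ (n+m)) x) ((c ^^ (n+m)) x)"
      unfolding cinner_pow by (rule arg_cong[where f = "\<lambda>k. cinner x ((c ^^ k) x)"]) simp
    then show ?thesis
      unfolding b_def norm_sq_diff by (simp add: cinner_self)
  qed
  have "convergent (\<lambda>n. (c ^^ (2*n)) x)" for x
  proof -
    have "decseq (b x)"
      unfolding b_def by (rule decseq_SucI) (auto intro!: power_mono c_contr)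
    then obtain L where L: "b x \<longlonglongrightarrow> L"
      using decseq_convergent[of "b x" 0] by (auto simp: b_def)
    have "Cauchy (\<lambda>n. (c ^^ (2*n)) x)"
    proof (rule CauchyI)
      fix e :: real
      assume e: "e > 0"
      then have "eventually (\<lambda>n. dist (b x n) L < e\<^sup>2 / 4) sequentially"
        using L by (intro tendstoD) auto
      then obtain k where k: "\<And>n. n \<ge> k \<Longrightarrow> \<bar>b x n - L\<bar> < e\<^sup>2 / 4"
        by (auto simp: eventually_sequentially dist_real_def)
      have "norm ((c ^^ (2*n)) x - (c ^^ (2*m)) x) < e" if "n \<ge> k" "m \<ge> k" for n m
      proof -
        have "(norm ((c ^^ (2*n)) x - (c ^^ (2*m)) x))\<^sup>2 < e\<^sup>2"
          using k[of "2*n"] k[of "2*m"] k[of "n+m"] that unfolding gap abs_less_iff by linarith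
        then show ?thesis
          using e by (simp add: power2_less_imp_less)
      qed
      then show "\<exists>k. \<forall>m\<ge>k. \<forall>n\<ge>k. norm ((c ^^ (2*m)) x - (c ^^ (2*n)) x) < e"
        by blast
    qed
    then show ?thesis
      by (simp add: Cauchy_convergent_iff)
  qed
  then obtain p where p: "\<And>x. (\<lambda>n. (c ^^ (2*n)) x) \<longlonglongrightarrow> p x"
    unfolding convergent_def by metis
  have p_proj: "ortho_proj N x = p x" for x
  proof (rule ortho_projI[OF N])
    have "(\<lambda>n. (c ^^ (2 * Suc n)) x) \<longlonglongrightarrow> p x"
      using LIMSEQ_Suc[OF p[of x]] .
    moreover have "(\<lambda>n. (c ^^ (2 * Suc n)) x) \<longlonglongrightarrow> c (c (p x))"
    proof -
      have "(\<lambda>n. c (c ((c ^^ (2*n)) x))) \<longlonglongrightarrow> c (c (p x))"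
        unfolding c_def[of "c _"] unfolding c_def[of "(c ^^ _) _"] c_def[of "p _"]
        by (intro tendsto_diff bounded_linear.tendsto[OF hD(1)] p)
      then show ?thesis
        by simp
    qed
    ultimately have "c (c (p x)) = p x"
      by (rule LIMSEQ_unique[symmetric])
    then have hh: "h (h (p x)) = 2 *\<^sub>R h (p x)"
      by (simp add: c_def hD scaleR_2 algebra_simps)
    then have "4 * (norm (h (p x)))\<^sup>2 \<le> 2 * (norm (h (p x)))\<^sup>2"
      using firm[of "h (p x)"]
      by (simp add: hh power_mult_distrib cinner.scaleR_left cinner_self)
    then have "(norm (h (p x)))\<^sup>2 \<le> 0"
      by simp
    then show "p x \<in> N"
      by (simp add: N_def)
    show "cinner (x - p x) y = 0" if y: "y \<in> N" for y
    proof -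
      have "(c ^^ n) y = y" for n
        using y by (induction n) (simp_all add: c_def N_def)
      then have "cinner ((c ^^ (2*n)) x) y = cinner x y" for n
        by (simp add: pow_sym)
      then have "(\<lambda>n. cinner x y) \<longlonglongrightarrow> cinner (p x) y"
        using cinner.tendsto[OF p[of x] tendsto_const[of y]] by simp
      then have "cinner x y = cinner (p x) y"
        by (simp add: LIMSEQ_const_iff)
      then show ?thesis
        by (simp add: cinner.diff_left)
    qed
  qed
  have g: "(\<lambda>x. x - (c ^^ n) x) \<in> B" for n
  proof (induction n)
    case 0
    then show ?case
      using wcsaD(2)[OF B] by simp
  next
    case (Suc n)
    have "(\<lambda>x. (x - (c ^^ n) x) + (h x + (-1) *\<^sub>C (h \<circ> (\<lambda>x. x - (c ^^ n) x)) x)) \<in> B"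
      by (intro wcsaD[OF B] Suc h)
    also have "(\<lambda>x. (x - (c ^^ n) x) + (h x + (-1) *\<^sub>C (h \<circ> (\<lambda>x. x - (c ^^ n) x)) x)) =
        (\<lambda>x. x - (c ^^ Suc n) x)"
      using scaleC_of_real[of "-1"] by (auto simp: c_def hD)
    finally show ?case .
  qed
  have lim: "(\<lambda>n. x - (c ^^ (2*n)) x) \<longlonglongrightarrow> x - ortho_proj N x" for x
    unfolding p_proj by (intro tendsto_intros p)
  have g_op: "(\<lambda>x. x - (c ^^ n) x) \<in> operators_on M" for n
    using g wcsaD(1)[OF B] by blast
  have "(\<lambda>x. x - ortho_proj N x) \<in> B"
  proof (rule wcsa_limit[OF B])
    show "eventually (\<lambda>n. (\<lambda>x. x - (c ^^ (2*n)) x) \<in> B) sequentially"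
      using g by simp
    show "(\<lambda>n. cinner (x - (c ^^ (2*n)) x) y) \<longlonglongrightarrow> cinner (x - ortho_proj N x) y" for x y
      by (intro cinner.tendsto lim tendsto_const)
    show "(\<lambda>x. x - ortho_proj N x) \<in> operators_on M"
    proof (rule operators_onI)
      show "bounded_clinear (\<lambda>x. x - ortho_proj N x)"
        by (rule bounded_clinear_diff[OF bounded_clinear_id bounded_clinear_ortho_proj[OF N], unfolded id_apply])
      show "x - ortho_proj N x \<in> M" for x
        using closed_sequentially[OF closed_csubspaceD(1)[OF M] _ lim] operators_onD(2)[OF g_op] by blast
      show "ortho_proj M x - ortho_proj N (ortho_proj M x) = x - ortho_proj N x" for x
        using lim[of x] lim[of "ortho_proj M x"] unfolding operators_onD(3)[OF g_op]
        by (rule LIMSEQ_unique[rotated])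
    qed
  qed auto
  then show ?thesis
    by (simp add: N_def)
qed

text \<open>The operator \<open>h\<close> is obtained by repeatedly averaging with \<open>V\<^sup>* V\<close>; the inequality \<open>firm\<close> survives
  averaging by convexity of the squared norm.\<close>

lemma joint_kernel_of_finite_family:
  assumes M: "closed_csubspace M" and B: "weakly_closed_star_subalgebra M B"
    and "finite F" "F \<subseteq> B" and contr: "\<And>V x. V \<in> F \<Longrightarrow> norm (V x) \<le> norm x"
  shows "\<exists>h\<in>B. (\<forall>x y. cinner (h x) y = cinner x (h y)) \<and>
    (\<forall>x. (norm (h x))\<^sup>2 \<le> Re (cinner (h x) x)) \<and> {x. h x = 0} = {x. \<forall>V\<in>F. V x = 0}"
  using assms(3-)
proof (induction F)
  case empty
  then show ?case
    by (intro bexI[of _ "\<lambda>x. 0"] wcsaD(2)[OF B]) (simp_all add: cinner.zero_left cinner.zero_right)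
next
  case (insert V F)
  then obtain h where h: "h \<in> B" "\<And>x y. cinner (h x) y = cinner x (h y)"
    "\<And>x. (norm (h x))\<^sup>2 \<le> Re (cinner (h x) x)" "{x. h x = 0} = {x. \<forall>V\<in>F. V x = 0}"
    by auto
  have V: "V \<in> B" "\<And>x. norm (V x) \<le> norm x"
    using insert.prems by auto
  then have V_lin: "bounded_clinear V"
    using wcsaD(1)[OF B] operators_onD(1) by blast
  define u where "u x = cadjoint V (V x)" for x
  have u: "cinner (u x) y = cinner (V x) (V y)" "cinner x (u y) = cinner (V x) (V y)" for x y
    by (simp_all add: u_def cinner_cadjoint[OF V_lin] cinner_cadjoint'[OF V_lin])
  have u_firm: "(norm (u x))\<^sup>2 \<le> Re (cinner (u x) x)" for x
  proof -
    have "norm (u x) \<le> norm (V x)"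
      unfolding u_def
    proof (rule norm_le_cinnerI)
      show "norm (cinner (cadjoint V (V x)) y) \<le> norm (V x) * norm y" for y
        using cauchy_schwarz[of "V x" "V y"] mult_left_mono[OF V(2)[of y] norm_ge_zero[of "V x"]]
        by (simp add: cinner_cadjoint'[OF V_lin])
    qed simp
    then show ?thesis
      unfolding u by (simp add: cinner_self power_mono del: of_real_power)
  qed
  define k where "k x = (1/2) *\<^sub>C (h x + u x)" for x
  have k: "k x = (1/2) *\<^sub>R (h x + u x)" for x
    using scaleC_of_real[of "1/2" "h x + u x"] by (simp add: k_def)
  have re: "Re (cinner (k x) x) = (Re (cinner (h x) x) + Re (cinner (u x) x)) / 2" for x
    by (simp add: k cinner.scaleR_left cinner.add_left)
  show ?case
  proof (intro bexI[of _ k] conjI allI)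
    have "(\<lambda>x. (1/2) *\<^sub>C (h x + (cadjoint V \<circ> V) x)) \<in> B"
      by (intro wcsaD[OF B] h V)
    then show "k \<in> B"
      by (simp add: k_def[abs_def] u_def)
    show "cinner (k x) y = cinner x (k y)" for x y
      by (simp add: k cinner.scaleR_left cinner.scaleR_right cinner.add_left cinner.add_right h(2) u)
    show "(norm (k x))\<^sup>2 \<le> Re (cinner (k x) x)" for x
    proof -
      have "(norm (k x))\<^sup>2 = (norm (h x + u x))\<^sup>2 / 4"
        by (simp add: k power_mult_distrib power_divide)
      also have "\<dots> \<le> ((norm (h x))\<^sup>2 + (norm (u x))\<^sup>2) / 2"
      proof -
        have "a / 4 \<le> (b + c) / 2" if "a + d = 2 * b + 2 * c" "0 \<le> d" for a b c d :: real
          using that by simp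
        from this[OF parallelogram_law zero_le_power2] show ?thesis .
      qed
      also have "\<dots> \<le> Re (cinner (k x) x)"
        unfolding re using h(3)[of x] u_firm[of x] by simp
      finally show ?thesis .
    qed
    have "k x = 0 \<longleftrightarrow> h x = 0 \<and> V x = 0" for x
    proof
      assume "k x = 0"
      then have "Re (cinner (h x) x) + Re (cinner (u x) x) = 0"
        using re[of x] by (simp add: cinner.zero_left)
      moreover have "Re (cinner (h x) x) \<ge> 0"
        using h(3)[of x] by (meson order_trans zero_le_power2)
      moreover have "Re (cinner (u x) x) = (norm (V x))\<^sup>2"
        unfolding u by (simp add: cinner_self del: of_real_power)
      ultimately have "(norm (V x))\<^sup>2 \<le> 0" "Re (cinner (h x) x) \<le> 0"
        by (auto simp: add_nonneg_eq_0_iff)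
      then show "h x = 0 \<and> V x = 0"
        using order_trans[OF h(3)[of x], of 0] by simp
    next
      assume "h x = 0 \<and> V x = 0"
      then show "k x = 0"
        by (simp add: k u_def bounded_clinearD(5)[OF bounded_clinear_cadjoint[OF V_lin]])
    qed
    then show "{x. k x = 0} = {x. \<forall>V\<in>insert V F. V x = 0}"
      using h(4) by auto
  qed
qed

text \<open>The projection onto the orthogonal complement of the common kernel of a possibly infinite family of
  contractions is the limit of the corresponding projections \<open>e F\<close> for finite subfamilies \<open>F\<close>.
  Convergence holds trivially on the ranges of the adjoints, which span that complement.\<close>

theorem joint_support_projection_in_wcsa:
  assumes M: "closed_csubspace M" and B: "weakly_closed_star_subalgebra M B" and X: "X \<subseteq> B"
    and contr: "\<And>V x. V \<in> X \<Longrightarrow> norm (V x) \<le> norm x"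
  shows "(\<lambda>x. x - ortho_proj {x. \<forall>V\<in>X. V x = 0} x) \<in> B"
proof -
  define N where "N F = {x. \<forall>V\<in>F. V x = 0}" for F :: "('a \<Rightarrow> 'a) set"
  have lin: "bounded_clinear V" if "V \<in> X" for V
    using that X wcsaD(1)[OF B] operators_onD(1) by blast
  have N: "closed_csubspace (N F)" if "F \<subseteq> X" for F
  proof -
    have "N F = \<Inter>((\<lambda>V. {x. V x = 0}) ` F)"
      by (auto simp: N_def)
    then show ?thesis
      using that lin by (auto intro!: closed_csubspace_Inter closed_csubspace_ker)
  qed
  define e where "e F x = x - ortho_proj (N (F \<inter> X)) x" for F x
  have e_lin: "bounded_clinear (e F)" for F
  proof -
    have "closed_csubspace (N (F \<inter> X))"
      by (rule N) simp
    then show ?thesis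
      using bounded_clinear_diff[OF bounded_clinear_id bounded_clinear_ortho_proj, of "N (F \<inter> X)"]
      by (simp add: e_def[abs_def])
  qed
  have e_contr: "norm (e F x) \<le> norm x" for F x
  proof -
    let ?p = "ortho_proj (N (F \<inter> X)) x"
    have "cinner (x - ?p) ?p = 0"
      by (intro ortho_proj N) auto
    then have "(norm ((x - ?p) + ?p))\<^sup>2 = (norm (x - ?p))\<^sup>2 + (norm ?p)\<^sup>2"
      unfolding norm_sq_add by simp
    then have "(norm (x - ?p))\<^sup>2 \<le> (norm x)\<^sup>2"
      by simp
    then show ?thesis
      by (simp add: power2_le_iff_abs_le e_def)
  qed
  have e_fin: "e F \<in> B" if F: "finite F" "F \<subseteq> X" for F
  proof -
    have "\<exists>h\<in>B. (\<forall>x y. cinner (h x) y = cinner x (h y)) \<and>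
        (\<forall>x. (norm (h x))\<^sup>2 \<le> Re (cinner (h x) x)) \<and> {x. h x = 0} = {x. \<forall>V\<in>F. V x = 0}"
      by (rule joint_kernel_of_finite_family[OF M B F(1) subset_trans[OF F(2) X]])
        (use contr F(2) in blast)
    then obtain h where "h \<in> B" "\<And>x y. cinner (h x) y = cinner x (h y)"
        "\<And>x. (norm (h x))\<^sup>2 \<le> Re (cinner (h x) x)" "{x. h x = 0} = N F"
      unfolding N_def by (elim bexE conjE) simp
    then show ?thesis
      using support_projection_in_wcsa[OF M B, of h] F by (simp add: e_def[abs_def] Int_absorb2)
  qed
  define W where "W = {x. ((\<lambda>F. e F x) \<longlongrightarrow> id x) (finite_subsets_at_top X)}"
  have W: "closed_csubspace W"
    unfolding W_def by (rule closed_csubspace_convergence[OF e_lin e_contr bounded_clinear_id]) simp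
  \<comment> \<open>As soon as \<open>V \<in> F\<close>, the vector \<open>V\<^sup>* y\<close> is orthogonal to the common kernel of \<open>F\<close>, so \<open>e F\<close> fixes it.\<close>
  have adj_W: "cadjoint V y \<in> W" if V: "V \<in> X" for V y
  proof -
    have "e F (cadjoint V y) = cadjoint V y" if F: "F \<subseteq> X" "V \<in> F" for F
    proof -
      have "ortho_proj (N (F \<inter> X)) (cadjoint V y) = 0"
      proof (rule ortho_projI)
        show "cinner (cadjoint V y - 0) z = 0" if "z \<in> N (F \<inter> X)" for z
        proof -
          have "V z = 0"
            using that F V by (auto simp: N_def)
          then show ?thesis
            by (simp add: cinner_cadjoint'[OF lin[OF V]] cinner.zero_right)
        qed
      qed (use N[of "F \<inter> X"] closed_csubspaceD(2) in auto)
      then show ?thesis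
        by (simp add: e_def)
    qed
    moreover have "eventually (\<lambda>F. F \<subseteq> X \<and> V \<in> F) (finite_subsets_at_top X)"
      unfolding eventually_finite_subsets_at_top using V by (intro exI[of _ "{V}"]) auto
    ultimately have "eventually (\<lambda>F. e F (cadjoint V y) = id (cadjoint V y)) (finite_subsets_at_top X)"
      by (auto elim!: eventually_mono)
    then show ?thesis
      unfolding W_def by (simp add: tendsto_eventually)
  qed
  have e_W: "e X x \<in> W" for x
  proof (rule in_closed_csubspaceI[OF W])
    fix y
    assume y: "\<And>m. m \<in> W \<Longrightarrow> cinner m y = 0"
    have "V y = 0" if "V \<in> X" for V
    proof -
      have "cinner (cadjoint V (V y)) y = 0"
        using y adj_W[OF that] by blast
      then show ?thesis
        by (simp add: cinner_cadjoint'[OF lin[OF that]] cinner_self)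
    qed
    then have "y \<in> N X"
      by (simp add: N_def)
    then show "cinner (e X x) y = 0"
      using ortho_proj_orthogonal[OF N] by (simp add: e_def)
  qed
  have e_e: "e F (e X x) = e F x" for F x
  proof -
    have "ortho_proj (N X) x \<in> N (F \<inter> X)"
      using ortho_proj_in[OF N[of X], of x] by (auto simp: N_def)
    then have "e F (ortho_proj (N X) x) = 0"
      using ortho_proj_ident[OF N[of "F \<inter> X"]] by (simp add: e_def)
    then show ?thesis
      using bounded_clinearD(4)[OF e_lin[of F], of x "ortho_proj (N X) x"] by (simp add: e_def[of X])
  qed
  have lim: "((\<lambda>F. e F x) \<longlongrightarrow> e X x) (finite_subsets_at_top X)" for x
    using e_W[of x] by (simp add: W_def e_e)
  have "e X \<in> B"
  proof (rule wcsa_limit[OF B])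
    show "eventually (\<lambda>F. e F \<in> B) (finite_subsets_at_top X)"
      by (rule eventually_finite_subsets_at_top_weakI) (rule e_fin)
    show "((\<lambda>F. cinner (e F x) y) \<longlongrightarrow> cinner (e X x) y) (finite_subsets_at_top X)" for x y
      by (intro cinner.tendsto lim tendsto_const)
    show "e X \<in> operators_on M"
    proof (rule operators_onI[OF e_lin])
      have fin: "e F x \<in> M \<and> e F (ortho_proj M x) = e F x" if "finite F" "F \<subseteq> X" for F x
        using e_fin[OF that] wcsaD(1)[OF B] operators_onD by blast
      have "eventually (\<lambda>F. e F x \<in> M) (finite_subsets_at_top X)" for x
        by (rule eventually_finite_subsets_at_top_weakI) (simp add: fin)
      then show "e X x \<in> M" for x
        using Lim_in_closed_set[OF closed_csubspaceD(1)[OF M] _ _ lim] by simp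
      have "eventually (\<lambda>F. e F x = e F (ortho_proj M x)) (finite_subsets_at_top X)" for x
        by (rule eventually_finite_subsets_at_top_weakI) (simp add: fin)
      then have "((\<lambda>F. e F (ortho_proj M x)) \<longlongrightarrow> e X x) (finite_subsets_at_top X)" for x
        using lim by (rule tendsto_cong[THEN iffD1])
      then show "e X (ortho_proj M x) = e X x" for x
        using lim tendsto_unique[OF finite_subsets_at_top_neq_bot] by blast
    qed
  qed simp
  then show ?thesis
    by (simp add: e_def[abs_def] N_def)
qed

section \<open>Limit operators of a unitary group\<close>

text \<open>A unitary group on the closed subspace \<open>M\<close>, with real or integer time. As in \<^const>\<open>operators_on\<close>,
  the operators live on the whole space and vanish on the orthogonal complement of \<open>M\<close>; in
  particular the identity of \<open>M\<close> is the projection onto \<open>M\<close>. Unitarity on \<open>M\<close> follows from the group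
  law and from \<open>cadjoint_S\<close>. No continuity is required.\<close>

locale unitary_flow =
  fixes M :: "'a::complex_hilbert set" and S :: "'t::linordered_ab_group_add \<Rightarrow> 'a \<Rightarrow> 'a"
  assumes closed_M: "closed_csubspace M"
    and S_operator: "S t \<in> operators_on M"
    and S_0: "S 0 = ortho_proj M"
    and S_add: "S (s + t) = S s \<circ> S t"
    and cadjoint_S: "cadjoint (S t) = S (- t)"
begin

abbreviation \<Omega> :: "('a \<Rightarrow> 'a) set" where
  "\<Omega> \<equiv> limit_operators M S"

lemma S_lin: "bounded_clinear (S t)"
  using operators_onD(1)[OF S_operator] .

lemma cinner_S: "cinner (S t x) y = cinner x (S (- t) y)"
  by (simp add: cinner_cadjoint[OF S_lin] cadjoint_S)

lemma S_commute: "S s (S t x) = S t (S s x)"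
  using S_add[of s t] S_add[of t s] by (simp add: add.commute fun_eq_iff)

lemma norm_S_le: "norm (S t x) \<le> norm x"
proof -
  have "S (- t) (S t x) = ortho_proj M x"
    using S_add[of "- t" t] by (simp add: S_0 fun_eq_iff)
  then have "(norm (S t x))\<^sup>2 = Re (cinner x (ortho_proj M x))"
    by (simp add: norm_sq_cinner cinner_S)
  also have "\<dots> \<le> norm (cinner x (ortho_proj M x))"
    by (rule complex_Re_le_cmod)
  also have "\<dots> \<le> norm x * norm (ortho_proj M x)"
    by (rule cauchy_schwarz)
  also have "\<dots> \<le> (norm x)\<^sup>2"
    using norm_ortho_proj_le[OF closed_M, of x] by (simp add: power2_eq_square mult_left_mono)
  finally show ?thesis
    by (simp add: power2_le_iff_abs_le)
qed

lemma limit_operatorE: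
  assumes "V \<in> \<Omega>"
  obtains t :: "nat \<Rightarrow> 't" where "incseq t" "filterlim t at_top sequentially"
    "\<And>x y. (\<lambda>k. cinner (S (t k) x) y) \<longlonglongrightarrow> cinner (V x) y"
  using assms that unfolding limit_operators_def limitin_wot by blast

lemma limit_operator_operator: "V \<in> \<Omega> \<Longrightarrow> V \<in> operators_on M"
  unfolding limit_operators_def limitin_wot by blast

lemma limit_operators_subset: "\<Omega> \<subseteq> operators_on M"
  using limit_operator_operator by blast

lemma limit_operator_lin: "V \<in> \<Omega> \<Longrightarrow> bounded_clinear V"
  using limit_operator_operator operators_onD(1) by blast

text \<open>Shifting the times \<open>t\<^sub>k\<close> by a constant, which may be negative, keeps them increasing to infinity.\<close>

lemma S_comp_limit_operator:
  assumes V: "V \<in> \<Omega>"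
  shows "S s \<circ> V \<in> \<Omega>"
proof -
  obtain t where t: "incseq t" "filterlim t at_top sequentially"
    "\<And>x y. (\<lambda>k. cinner (S (t k) x) y) \<longlonglongrightarrow> cinner (V x) y"
    using V by (rule limit_operatorE) blast
  have "incseq (\<lambda>k. s + t k)"
    using t(1) by (simp add: incseq_def)
  moreover have "filterlim (\<lambda>k. s + t k) at_top sequentially"
    unfolding filterlim_at_top
  proof
    fix z
    have "eventually (\<lambda>k. z - s \<le> t k) sequentially"
      using t(2) by (simp add: filterlim_at_top)
    then show "eventually (\<lambda>k. z \<le> s + t k) sequentially"
      by eventually_elim (simp add: diff_le_eq add.commute)
  qed
  moreover have "(\<lambda>k. cinner (S (s + t k) x) y) \<longlonglongrightarrow> cinner (S s (V x)) y" for x y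
    using t(3)[of x "S (- s) y"] by (simp add: S_add cinner_S[of s])
  ultimately show ?thesis
    unfolding limit_operators_def limitin_wot
    using comp_operator[OF closed_M S_operator limit_operator_operator[OF V]] S_operator
    by (auto intro!: exI[of _ "\<lambda>k. s + t k"])
qed

text \<open>Limits of operators commuting with a fixed bounded operator commute with it.\<close>

lemma limit_operator_commute:
  assumes V: "V \<in> \<Omega>" and A: "bounded_clinear A" and comm: "\<And>t x. S t (A x) = A (S t x)"
  shows "V (A x) = A (V x)"
proof (rule cinner_eqI)
  fix y
  obtain t where t: "\<And>x y. (\<lambda>k. cinner (S (t k) x) y) \<longlonglongrightarrow> cinner (V x) y"
    using V by (rule limit_operatorE) blast
  have "(\<lambda>k. cinner (S (t k) (A x)) y) \<longlonglongrightarrow> cinner (V x) (cadjoint A y)"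
    using t[of x "cadjoint A y"] by (simp add: comm cinner_cadjoint[OF A])
  then show "cinner (V (A x)) y = cinner (A (V x)) y"
    using t[of "A x" y] by (simp add: cinner_cadjoint[OF A] LIMSEQ_unique)
qed

lemma limit_operator_S: "V \<in> \<Omega> \<Longrightarrow> V (S s x) = S s (V x)"
  by (rule limit_operator_commute[OF _ S_lin S_commute])

text \<open>A limit operator commutes with the group, hence so does its adjoint, and therefore the limit
  operator commutes with its adjoint.\<close>

lemma limit_operator_normal:
  assumes V: "V \<in> \<Omega>"
  shows "V (cadjoint V x) = cadjoint V (V x)"
proof (rule limit_operator_commute[OF V])
  note b = limit_operator_lin[OF V]
  show "bounded_clinear (cadjoint V)"
    by (rule bounded_clinear_cadjoint[OF b])
  show "S t (cadjoint V x) = cadjoint V (S t x)" for t x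
    by (rule cinner_eqI) (simp add: cinner_S cinner_cadjoint'[OF b] limit_operator_S[OF V])
qed

lemma norm_limit_operator_cadjoint:
  assumes V: "V \<in> \<Omega>"
  shows "norm (cadjoint V x) = norm (V x)"
proof -
  note b = limit_operator_lin[OF V]
  have "cinner (cadjoint V x) (cadjoint V x) = cinner (V x) (V x)"
    by (simp add: cinner_cadjoint'[OF b] cinner_cadjoint[OF b] limit_operator_normal[OF V])
  then have "(norm (cadjoint V x))\<^sup>2 = (norm (V x))\<^sup>2"
    by (simp only: norm_sq_cinner)
  then show ?thesis
    by (simp add: power2_eq_iff_nonneg)
qed

lemma norm_limit_operator_le:
  assumes V: "V \<in> \<Omega>"
  shows "norm (V x) \<le> norm x"
proof (rule norm_le_cinnerI)
  fix y
  obtain t where t: "\<And>x y. (\<lambda>k. cinner (S (t k) x) y) \<longlonglongrightarrow> cinner (V x) y"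
    using V by (rule limit_operatorE) blast
  have "norm (cinner (S (t k) x) y) \<le> norm x * norm y" for k
    using cauchy_schwarz[of "S (t k) x" y] norm_S_le[of "t k" x]
    by (meson mult_right_mono norm_ge_zero order_trans)
  then show "norm (cinner (V x) y) \<le> norm x * norm y"
    by (intro LIMSEQ_le_const2[OF tendsto_norm[OF t]]) auto
qed simp

lemma closed_csubspace_limit_space: "closed_csubspace (limit_space M S x)"
  unfolding limit_space_def by (rule closed_csubspace_closure_cspan)

lemma limit_operator_in_limit_space: "V \<in> \<Omega> \<Longrightarrow> V x \<in> limit_space M S x"
  unfolding limit_space_def limit_orbit_def by (intro subsetD[OF subset_closure_cspan]) auto

lemma limit_space_minimal:
  "closed_csubspace N \<Longrightarrow> (\<And>V. V \<in> \<Omega> \<Longrightarrow> V x \<in> N) \<Longrightarrow> limit_space M S x \<subseteq> N"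
  unfolding limit_space_def limit_orbit_def by (intro closure_cspan_minimal) auto

lemma S_limit_space: "S s ` limit_space M S x \<subseteq> limit_space M S x"
proof -
  have "limit_space M S x \<subseteq> {y. S s y \<in> limit_space M S x}"
  proof (rule limit_space_minimal)
    show "closed_csubspace {y. S s y \<in> limit_space M S x}"
      by (rule closed_csubspace_vimage[OF S_lin closed_csubspace_limit_space])
    show "V x \<in> {y. S s y \<in> limit_space M S x}" if "V \<in> \<Omega>" for V
      using limit_operator_in_limit_space[OF S_comp_limit_operator[OF that]] by simp
  qed
  then show ?thesis
    by blast
qed

text \<open>The closed span of the ranges of all limit operators. It turns out to be the space of weakly
  Poisson recurrent vectors, and its projection the unit of the limit algebra.\<close>

definition K :: "'a set" where
  "K = closure (cspan (\<Union>V\<in>\<Omega>. range V))"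

lemma closed_csubspace_K: "closed_csubspace K"
  unfolding K_def by (rule closed_csubspace_closure_cspan)

lemma limit_operator_in_K: "V \<in> \<Omega> \<Longrightarrow> V x \<in> K"
  unfolding K_def by (intro subsetD[OF subset_closure_cspan]) auto

text \<open>Normality enters here: the orthogonal complement of the range of \<open>V\<close> is the kernel of \<open>V\<^sup>*\<close>, which
  is the kernel of \<open>V\<close>.\<close>

lemma orthogonal_K_iff: "(\<forall>k\<in>K. cinner x k = 0) \<longleftrightarrow> (\<forall>V\<in>\<Omega>. V x = 0)"
proof
  assume x: "\<forall>k\<in>K. cinner x k = 0"
  have "norm (V x) = 0" if V: "V \<in> \<Omega>" for V
  proof -
    have "cinner (cadjoint V x) (cadjoint V x) = 0"
      using x limit_operator_in_K[OF V] by (simp add: cinner_cadjoint'[OF limit_operator_lin[OF V]])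
    then have "norm (cadjoint V x) = 0"
      by (simp add: cinner_self)
    then show ?thesis
      by (simp only: norm_limit_operator_cadjoint[OF V])
  qed
  then show "\<forall>V\<in>\<Omega>. V x = 0"
    by simp
next
  assume x: "\<forall>V\<in>\<Omega>. V x = 0"
  have "cinner x (V z) = 0" if V: "V \<in> \<Omega>" for V z
  proof -
    have "norm (cadjoint V x) = 0"
      unfolding norm_limit_operator_cadjoint[OF V] using x V by simp
    then show ?thesis
      using cinner_cadjoint'[OF limit_operator_lin[OF V], of x z] by (simp add: cinner.zero_left)
  qed
  then show "\<forall>k\<in>K. cinner x k = 0"
    unfolding K_def by (auto intro: orthogonal_closure_cspan[rotated])
qed

lemma limit_operator_proj_K:
  assumes V: "V \<in> \<Omega>"
  shows "V (ortho_proj K x) = V x"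
proof -
  have "\<forall>k\<in>K. cinner (x - ortho_proj K x) k = 0"
    using ortho_proj_orthogonal[OF closed_csubspace_K] by blast
  then have "V (x - ortho_proj K x) = 0"
    using V unfolding orthogonal_K_iff by blast
  then show ?thesis
    by (simp add: bounded_clinearD[OF limit_operator_lin[OF V]])
qed

lemma proj_K_eq: "ortho_proj K x = x - ortho_proj {x. \<forall>V\<in>\<Omega>. V x = 0} x"
proof (rule ortho_projI[OF closed_csubspace_K])
  define N where "N = {x. \<forall>V\<in>\<Omega>. V x = 0}"
  have "N = \<Inter>((\<lambda>V. {x. V x = 0}) ` \<Omega>)"
    by (auto simp: N_def)
  then have N: "closed_csubspace N"
    using limit_operator_lin by (auto intro!: closed_csubspace_Inter closed_csubspace_ker)
  show "x - ortho_proj N x \<in> K"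
  proof (rule in_closed_csubspaceI[OF closed_csubspace_K])
    fix y
    assume "\<And>m. m \<in> K \<Longrightarrow> cinner m y = 0"
    then have "\<forall>k\<in>K. cinner y k = 0"
      using cinner_eq_0_sym by blast
    then have "y \<in> N"
      by (simp add: N_def orthogonal_K_iff)
    then show "cinner (x - ortho_proj N x) y = 0"
      by (rule ortho_proj_orthogonal[OF N])
  qed
  show "cinner (x - (x - ortho_proj N x)) k = 0" if "k \<in> K" for k
    using that ortho_proj_in[OF N, of x] orthogonal_K_iff[of "ortho_proj N x"] by (simp add: N_def)
qed

theorem poisson_recurrent_eq_K: "poisson_recurrent M S = K"
proof (intro subset_antisym subsetI)
  fix x
  assume "x \<in> poisson_recurrent M S"
  then show "x \<in> K"
    unfolding poisson_recurrent_def
    using limit_space_minimal[of K x, OF closed_csubspace_K] limit_operator_in_K by blast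
next
  fix x
  assume x: "x \<in> K"
  define N where "N = limit_space M S x"
  have N: "closed_csubspace N"
    unfolding N_def by (rule closed_csubspace_limit_space)
  have "N \<subseteq> K"
    unfolding N_def using closed_csubspace_K limit_operator_in_K by (rule limit_space_minimal)
  define z where "z = x - ortho_proj N x"
  have "z \<in> K"
    using x \<open>N \<subseteq> K\<close> ortho_proj_in[OF N, of x] closed_csubspaceD(5)[OF closed_csubspace_K]
    by (auto simp: z_def)
  moreover have "V z = 0" if V: "V \<in> \<Omega>" for V
  proof -
    have comm: "S t (ortho_proj N y) = ortho_proj N (S t y)" for t y
      using S_limit_space unfolding N_def[symmetric]
      by (intro ortho_proj_commute[OF N S_lin, symmetric]) (simp_all add: cadjoint_S N_def)
    have "V (ortho_proj N x) = ortho_proj N (V x)"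
      by (rule limit_operator_commute[OF V bounded_clinear_ortho_proj[OF N] comm])
    also have "\<dots> = V x"
      using limit_operator_in_limit_space[OF V, of x] by (intro ortho_proj_ident[OF N]) (simp add: N_def)
    finally show ?thesis
      by (simp add: z_def bounded_clinearD[OF limit_operator_lin[OF V]])
  qed
  then have "\<forall>k\<in>K. cinner z k = 0"
    unfolding orthogonal_K_iff by blast
  ultimately have "cinner z z = 0"
    by blast
  then have "x = ortho_proj N x"
    by (simp add: cinner_self z_def)
  then have "x \<in> N"
    using ortho_proj_in[OF N, of x] by simp
  then show "x \<in> poisson_recurrent M S"
    by (simp add: poisson_recurrent_def N_def)
qed

lemma limit_space_proj_K: "limit_space M S (ortho_proj K x) = limit_space M S x"
proof -
  have "limit_orbit M S (ortho_proj K x) = limit_orbit M S x"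
    unfolding limit_orbit_def by (intro Collect_cong ex_cong1) (simp add: limit_operator_proj_K cong: rev_conj_cong)
  then show ?thesis
    by (simp add: limit_space_def)
qed

lemma proj_K_in_limit_space: "ortho_proj K x \<in> limit_space M S x"
  using ortho_proj_in[OF closed_csubspace_K, of x] limit_space_proj_K[of x]
  unfolding poisson_recurrent_eq_K[symmetric] by (simp add: poisson_recurrent_def)

lemma wcsa_limit_algebra: "weakly_closed_star_subalgebra M (limit_algebra M S)"
  unfolding limit_algebra_def by (rule wcsa_generated_algebra[OF closed_M limit_operators_subset])

lemma limit_operators_in_algebra: "\<Omega> \<subseteq> limit_algebra M S"
  unfolding limit_algebra_def by (rule generated_algebra_superset)

lemma limit_algebra_minimal:
  "weakly_closed_star_subalgebra M B \<Longrightarrow> \<Omega> \<subseteq> B \<Longrightarrow> limit_algebra M S \<subseteq> B"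
  unfolding limit_algebra_def by (rule generated_algebra_minimal)

lemma proj_K_in_limit_algebra: "ortho_proj K \<in> limit_algebra M S"
  unfolding proj_K_eq[abs_def]
  by (rule joint_support_projection_in_wcsa[OF closed_M wcsa_limit_algebra limit_operators_in_algebra])
    (rule norm_limit_operator_le)

text \<open>The operators on \<open>K\<close> form a weakly closed \<open>*\<close>-algebra containing all limit operators.\<close>

lemma proj_K_unit:
  assumes V: "V \<in> limit_algebra M S"
  shows "ortho_proj K \<circ> V = V \<and> V \<circ> ortho_proj K = V"
proof -
  have K: "closed_csubspace K"
    by (rule closed_csubspace_K)
  have KM: "K \<subseteq> M"
    unfolding K_def using limit_operator_operator operators_onD(2)
    by (intro closure_cspan_minimal[OF _ closed_M]) blast
  have eq: "ortho_proj K (ortho_proj M x) = ortho_proj K x" for x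
  proof (rule cinner_eqI)
    fix y
    have "ortho_proj M (ortho_proj K y) = ortho_proj K y"
      using ortho_proj_ident[OF closed_M] ortho_proj_in[OF K] KM by blast
    then show "cinner (ortho_proj K (ortho_proj M x)) y = cinner (ortho_proj K x) y"
      by (simp add: cinner_ortho_proj[OF K] cinner_ortho_proj[OF closed_M])
  qed
  have "operators_on K \<subseteq> operators_on M"
  proof
    fix A
    assume A: "A \<in> operators_on K"
    have "A (ortho_proj M x) = A x" for x
      by (metis A eq operators_onD(3))
    with A KM show "A \<in> operators_on M"
      by (intro operators_onI) (auto dest: operators_onD)
  qed
  have "weakly_closed_star_subalgebra M (operators_on K)"
  proof (rule wcsaI[OF closed_M])
    fix F :: "('a \<Rightarrow> 'a) filter" and V
    assume F: "F \<noteq> bot" "V \<in> operators_on M" "eventually (\<lambda>A. A \<in> operators_on K) F"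
      and lim: "\<And>x y. ((\<lambda>A. cinner (A x) y) \<longlongrightarrow> cinner (V x) y) F"
    show "V \<in> operators_on K"
    proof (rule operators_onI)
      show "bounded_clinear V"
        using F(2) by (rule operators_onD(1))
      show "V x \<in> K" for x
      proof (rule in_closed_csubspaceI[OF K])
        fix y
        assume "\<And>m. m \<in> K \<Longrightarrow> cinner m y = 0"
        then have "eventually (\<lambda>A. cinner (A x) y = 0) F"
          using F(3) by (auto elim!: eventually_mono dest: operators_onD(2))
        then have "((\<lambda>A. cinner (A x) y) \<longlongrightarrow> 0) F"
          by (rule tendsto_eventually)
        then show "cinner (V x) y = 0"
          using lim tendsto_unique[OF F(1)] by blast
      qed
      show "V (ortho_proj K x) = V x" for x
      proof (rule cinner_eqI)
        fix y
        have "eventually (\<lambda>A. cinner (A x) y = cinner (A (ortho_proj K x)) y) F"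
          using F(3) by (auto elim!: eventually_mono simp: operators_onD(3)[of _ K])
        then have "((\<lambda>A. cinner (A (ortho_proj K x)) y) \<longlongrightarrow> cinner (V x) y) F"
          using lim[of x y] by (rule tendsto_cong[THEN iffD1])
        then show "cinner (V (ortho_proj K x)) y = cinner (V x) y"
          using lim tendsto_unique[OF F(1)] by blast
      qed
    qed
  qed (use K \<open>operators_on K \<subseteq> operators_on M\<close> in \<open>auto intro: zero_operator add_operator
      scaleC_operator comp_operator cadjoint_operator\<close>)
  moreover have "\<Omega> \<subseteq> operators_on K"
    using limit_operator_lin limit_operator_in_K limit_operator_proj_K by (auto intro!: operators_onI)
  ultimately have "V \<in> operators_on K"
    using limit_algebra_minimal V by blast
  then show ?thesis
    by (simp add: fun_eq_iff ortho_proj_operator_left[OF K] operators_onD(3)[of V K])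
qed

text \<open>The limit algebra is an ideal with respect to the group. Commutation with the group is carried
  along in the proof because \<open>S\<^sub>t V\<^sup>* = (S\<^bsub>-t\<^esub> V)\<^sup>*\<close> needs it.\<close>

lemma S_comp_limit_algebra:
  assumes "V \<in> limit_algebra M S"
  shows "S s \<circ> V \<in> limit_algebra M S"
proof -
  let ?A = "limit_algebra M S"
  note A = wcsa_limit_algebra
  define B where "B = {V \<in> ?A. (\<forall>t. S t \<circ> V \<in> ?A) \<and> (\<forall>t x. S t (V x) = V (S t x))}"
  have ops: "V \<in> operators_on M" if "V \<in> B" for V
    using that wcsaD(1)[OF A] by (auto simp: B_def)
  have B_D: "S t \<circ> V \<in> ?A" if "V \<in> B" for t V
    using that by (simp add: B_def)
  have "weakly_closed_star_subalgebra M B"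
  proof (rule wcsaI[OF closed_M])
    show "B \<subseteq> operators_on M"
      using ops by blast
    show "(\<lambda>x. 0) \<in> B"
      using wcsaD(2)[OF A] by (auto simp: B_def o_def bounded_clinearD[OF S_lin])
    show "(\<lambda>x. V x + W x) \<in> B" if "V \<in> B" "W \<in> B" for V W
    proof -
      have eq: "S t \<circ> (\<lambda>x. V x + W x) = (\<lambda>x. (S t \<circ> V) x + (S t \<circ> W) x)" for t
        by (simp add: fun_eq_iff bounded_clinearD[OF S_lin])
      have "S t \<circ> (\<lambda>x. V x + W x) \<in> ?A" for t
        unfolding eq by (rule wcsaD(3)[OF A B_D[OF that(1)] B_D[OF that(2)]])
      then show ?thesis
        using that by (simp add: B_def bounded_clinearD[OF S_lin] wcsaD(3)[OF A])
    qed
    show "(\<lambda>x. c *\<^sub>C V x) \<in> B" if "V \<in> B" for c V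
    proof -
      have eq: "S t \<circ> (\<lambda>x. c *\<^sub>C V x) = (\<lambda>x. c *\<^sub>C (S t \<circ> V) x)" for t
        by (simp add: fun_eq_iff bounded_clinearD[OF S_lin])
      have "S t \<circ> (\<lambda>x. c *\<^sub>C V x) \<in> ?A" for t
        unfolding eq by (rule wcsaD(4)[OF A B_D[OF that]])
      then show ?thesis
        using that by (simp add: B_def bounded_clinearD[OF S_lin] wcsaD(4)[OF A])
    qed
    show "V \<circ> W \<in> B" if "V \<in> B" "W \<in> B" for V W
    proof -
      have "(S t \<circ> V) \<circ> W \<in> ?A" for t
        using that by (intro wcsaD(5)[OF A B_D]) (simp_all add: B_def)
      then show ?thesis
        using that wcsaD(5)[OF A, of V W] by (simp add: B_def o_assoc)
    qed
    show "cadjoint V \<in> B" if V: "V \<in> B" for V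
    proof -
      have b: "bounded_clinear V"
        using ops[OF V] by (rule operators_onD(1))
      have comm: "S t (cadjoint V x) = cadjoint V (S t x)" for t x
      proof (rule cinner_eqI)
        fix y
        have "S (- t) (V y) = V (S (- t) y)"
          using V by (simp add: B_def)
        then show "cinner (S t (cadjoint V x)) y = cinner (cadjoint V (S t x)) y"
          by (simp only: cinner_S cinner_cadjoint'[OF b])
      qed
      have eq: "S t \<circ> cadjoint V = cadjoint (S (- t) \<circ> V)" for t
        by (simp add: cadjoint_comp[OF S_lin b] cadjoint_S fun_eq_iff comm)
      have "S t \<circ> cadjoint V \<in> ?A" for t
        unfolding eq using V by (intro wcsaD(6)[OF A]) (simp add: B_def)
      then show ?thesis
        using V comm wcsaD(6)[OF A, of V] by (simp add: B_def)
    qed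
    fix F :: "('a \<Rightarrow> 'a) filter" and V
    assume F: "F \<noteq> bot" "V \<in> operators_on M" "eventually (\<lambda>A. A \<in> B) F"
      and lim: "\<And>x y. ((\<lambda>A. cinner (A x) y) \<longlongrightarrow> cinner (V x) y) F"
    have "V \<in> ?A"
      using F(3) by (intro wcsa_limit[OF A F(1,2) _ lim]) (auto simp: B_def elim: eventually_mono)
    moreover have "S t \<circ> V \<in> ?A" for t
    proof (rule wcsa_limit[OF A F(1)])
      show "S t \<circ> V \<in> operators_on M"
        by (rule comp_operator[OF closed_M S_operator F(2)])
      show "eventually (\<lambda>A. S t \<circ> A \<in> ?A) F"
        using F(3) by (auto simp: B_def elim: eventually_mono)
      show "((\<lambda>A. cinner ((S t \<circ> A) x) y) \<longlongrightarrow> cinner ((S t \<circ> V) x) y) F" for x y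
        using lim[of x "S (- t) y"] by (simp add: cinner_S)
    qed
    moreover have "S t (V x) = V (S t x)" for t x
    proof (rule cinner_eqI)
      fix y
      have "eventually (\<lambda>A. cinner (A (S t x)) y = cinner (A x) (S (- t) y)) F"
        using F(3) by (auto simp: B_def cinner_S[symmetric] elim!: eventually_mono)
      then have "((\<lambda>A. cinner (A x) (S (- t) y)) \<longlongrightarrow> cinner (V (S t x)) y) F"
        using lim[of "S t x" y] by (rule tendsto_cong[THEN iffD1])
      then show "cinner (S t (V x)) y = cinner (V (S t x)) y"
        unfolding cinner_S[of t "V x" y] by (rule tendsto_unique[OF F(1) lim])
    qed
    ultimately show "V \<in> B"
      by (simp add: B_def)
  qed
  moreover have "\<Omega> \<subseteq> B"
    using limit_operators_in_algebra S_comp_limit_operator limit_operator_S by (auto simp: B_def)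
  ultimately have "?A \<subseteq> B"
    by (rule limit_algebra_minimal)
  then show ?thesis
    using assms by (auto simp: B_def)
qed

end

section \<open>Groups lying in the same weakly closed algebras\<close>

lemma wcsa_reduces:
  assumes M: "closed_csubspace M" and N: "closed_csubspace N"
  shows "weakly_closed_star_subalgebra M {W \<in> operators_on M. reduces N W}" (is "weakly_closed_star_subalgebra M ?B")
proof (rule wcsaI[OF M])
  show "(\<lambda>x. 0) \<in> ?B"
    using closed_csubspaceD(2)[OF N] by (auto simp: zero_operator[OF M] reduces_def cadjoint_zero)
  show "(\<lambda>x. V x + W x) \<in> ?B" if "V \<in> ?B" "W \<in> ?B" for V W
    using that closed_csubspaceD(3)[OF N]
    by (auto simp: add_operator[OF M] reduces_def cadjoint_add operators_onD(1) image_subset_iff)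
  show "(\<lambda>x. c *\<^sub>C V x) \<in> ?B" if "V \<in> ?B" for c V
    using that closed_csubspaceD(4)[OF N]
    by (auto simp: scaleC_operator[OF M] reduces_def cadjoint_scaleC operators_onD(1) image_subset_iff)
  show "V \<circ> W \<in> ?B" if "V \<in> ?B" "W \<in> ?B" for V W
    using that
    by (auto simp: comp_operator[OF M] reduces_def cadjoint_comp operators_onD(1) image_subset_iff)
  show "cadjoint V \<in> ?B" if "V \<in> ?B" for V
    using that by (auto simp: cadjoint_operator[OF M] reduces_def cadjoint_cadjoint operators_onD(1))
  fix F :: "('a \<Rightarrow> 'a) filter" and V
  assume F: "F \<noteq> bot" "V \<in> operators_on M" "eventually (\<lambda>A. A \<in> ?B) F"
    and lim: "\<And>x y. ((\<lambda>A. cinner (A x) y) \<longlongrightarrow> cinner (V x) y) F"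
  have "V x \<in> N" if x: "x \<in> N" for x
  proof (rule in_closed_csubspaceI[OF N])
    fix y
    assume "\<And>m. m \<in> N \<Longrightarrow> cinner m y = 0"
    then have "eventually (\<lambda>A. cinner (A x) y = 0) F"
      using F(3) x by (auto simp: reduces_def elim!: eventually_mono)
    then have "((\<lambda>A. cinner (A x) y) \<longlongrightarrow> 0) F"
      by (rule tendsto_eventually)
    then show "cinner (V x) y = 0"
      using lim tendsto_unique[OF F(1)] by blast
  qed
  moreover have "cadjoint V x \<in> N" if x: "x \<in> N" for x
  proof (rule in_closed_csubspaceI[OF N])
    fix y
    assume y: "\<And>m. m \<in> N \<Longrightarrow> cinner m y = 0"
    have "cinner (A y) x = 0" if "A \<in> ?B" for A
      using that x y cinner_eq_0_sym[of y "cadjoint A x"]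
      by (auto simp: reduces_def cinner_cadjoint operators_onD(1))
    then have "eventually (\<lambda>A. cinner (A y) x = 0) F"
      using F(3) by (auto elim!: eventually_mono)
    then have "((\<lambda>A. cinner (A y) x) \<longlongrightarrow> 0) F"
      by (rule tendsto_eventually)
    then have "cinner (V y) x = 0"
      using lim tendsto_unique[OF F(1)] by blast
    then show "cinner (cadjoint V x) y = 0"
      using cinner_eq_0_sym[of x "V y"] by (simp add: cinner_cadjoint'[OF operators_onD(1)[OF F(2)]])
  qed
  ultimately show "V \<in> ?B"
    using F(2) by (auto simp: reduces_def)
qed auto

lemma wcsa_left_multipliers:
  assumes M: "closed_csubspace M" and A: "weakly_closed_star_subalgebra M A"
  shows "weakly_closed_star_subalgebra M
    {W \<in> operators_on M. \<forall>X\<in>A. W \<circ> X \<in> A \<and> cadjoint W \<circ> X \<in> A}"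
    (is "weakly_closed_star_subalgebra M ?B")
proof (rule wcsaI[OF M])
  have z: "(\<lambda>x. 0) \<circ> X = (\<lambda>x. 0)" for X :: "'a \<Rightarrow> 'a"
    by auto
  have p: "(\<lambda>x. V x + W x) \<circ> X = (\<lambda>x. (V \<circ> X) x + (W \<circ> X) x)" for V W X :: "'a \<Rightarrow> 'a"
    by auto
  have s: "(\<lambda>x. c *\<^sub>C V x) \<circ> X = (\<lambda>x. c *\<^sub>C (V \<circ> X) x)" for c and V X :: "'a \<Rightarrow> 'a"
    by auto
  have p: "(\<lambda>x. V x + W x) \<circ> X \<in> A" if "V \<circ> X \<in> A" "W \<circ> X \<in> A" for V W X :: "'a \<Rightarrow> 'a"
    using wcsaD(3)[OF A that] by (simp only: p)
  have s: "(\<lambda>x. c *\<^sub>C V x) \<circ> X \<in> A" if "V \<circ> X \<in> A" for c and V X :: "'a \<Rightarrow> 'a"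
    using wcsaD(4)[OF A that] by (simp only: s)
  show "(\<lambda>x. 0) \<in> ?B"
    by (auto simp: zero_operator[OF M] cadjoint_zero z intro: wcsaD[OF A])
  show "(\<lambda>x. V x + W x) \<in> ?B" if "V \<in> ?B" "W \<in> ?B" for V W
    using that by (auto simp: add_operator[OF M] cadjoint_add operators_onD(1) p)
  show "(\<lambda>x. c *\<^sub>C V x) \<in> ?B" if "V \<in> ?B" for c V
    using that by (auto simp: scaleC_operator[OF M] cadjoint_scaleC operators_onD(1) s)
  show "V \<circ> W \<in> ?B" if "V \<in> ?B" "W \<in> ?B" for V W
    using that by (auto simp: comp_operator[OF M] cadjoint_comp operators_onD(1) o_assoc[symmetric])
  show "cadjoint V \<in> ?B" if "V \<in> ?B" for V
    using that by (auto simp: cadjoint_operator[OF M] cadjoint_cadjoint operators_onD(1))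
  fix F :: "('a \<Rightarrow> 'a) filter" and V
  assume F: "F \<noteq> bot" "V \<in> operators_on M" "eventually (\<lambda>A. A \<in> ?B) F"
    and lim: "\<And>x y. ((\<lambda>A. cinner (A x) y) \<longlongrightarrow> cinner (V x) y) F"
  have "V \<circ> X \<in> A" if X: "X \<in> A" for X
  proof (rule wcsa_limit[OF A F(1)])
    show "V \<circ> X \<in> operators_on M"
      using X wcsaD(1)[OF A] by (intro comp_operator[OF M F(2)]) auto
    show "eventually (\<lambda>W. W \<circ> X \<in> A) F"
      using F(3) X by (auto elim!: eventually_mono)
    show "((\<lambda>W. cinner ((W \<circ> X) x) y) \<longlongrightarrow> cinner ((V \<circ> X) x) y) F" for x y
      using lim by simp
  qed
  moreover have "cadjoint V \<circ> X \<in> A" if X: "X \<in> A" for X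
  proof (rule wcsa_limit[OF A F(1)])
    show "cadjoint V \<circ> X \<in> operators_on M"
      using X wcsaD(1)[OF A] by (intro comp_operator[OF M cadjoint_operator[OF M F(2)]]) auto
    show "eventually (\<lambda>W. cadjoint W \<circ> X \<in> A) F"
      using F(3) X by (auto elim!: eventually_mono)
    show "((\<lambda>W. cinner ((cadjoint W \<circ> X) x) y) \<longlongrightarrow> cinner ((cadjoint V \<circ> X) x) y) F" for x y
    proof -
      have "((\<lambda>W. cnj (cinner (W y) (X x))) \<longlongrightarrow> cnj (cinner (V y) (X x))) F"
        by (intro tendsto_cnj lim)
      moreover have adj: "cnj (cinner (W y) (X x)) = cinner (cadjoint W (X x)) y" if "W \<in> operators_on M" for W
        using cinner_cadjoint'[OF operators_onD(1)[OF that], of "X x" y] cinner_commute[of "X x" "W y"] by simp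
      moreover have "eventually (\<lambda>W. cnj (cinner (W y) (X x)) = cinner (cadjoint W (X x)) y) F"
        using F(3) adj by (auto elim!: eventually_mono)
      ultimately show ?thesis
        using F(2) by (simp add: tendsto_cong)
    qed
  qed
  ultimately show "V \<in> ?B"
    using F(2) by auto
qed auto

text \<open>The limit space of \<open>x\<close> for \<open>S'\<close> reduces \<open>S'\<close>, hence also \<open>S\<close>, and it contains the projection of \<open>x\<close>
  onto the common space \<open>K\<close>; so it contains \<open>V x\<close> for every limit operator \<open>V\<close> of \<open>S\<close>.\<close>

lemma limit_orbit_subset_limit_space:
  assumes "unitary_flow M S" "unitary_flow M S'"
    and gen: "\<And>B. weakly_closed_star_subalgebra M B \<Longrightarrow> range S' \<subseteq> B \<Longrightarrow> range S \<subseteq> B"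
    and eq: "poisson_recurrent M S = poisson_recurrent M S'"
  shows "limit_orbit M S x \<subseteq> limit_space M S' x"
proof
  interpret S: unitary_flow M S by fact
  interpret S': unitary_flow M S' by fact
  define N where "N = limit_space M S' x"
  have N: "closed_csubspace N"
    unfolding N_def by (rule S'.closed_csubspace_limit_space)
  have "reduces N (S' t)" for t
    using S'.S_limit_space[of t x] S'.S_limit_space[of "- t" x]
    by (simp add: reduces_def S'.cadjoint_S N_def)
  then have "range S' \<subseteq> {W \<in> operators_on M. reduces N W}"
    using S'.S_operator by auto
  from gen[OF wcsa_reduces[OF S.closed_M N] this] have inv: "S t y \<in> N" if "y \<in> N" for t y
    using that by (auto simp: reduces_def)
  have KK: "S.K = S'.K"
    using eq by (simp add: S.poisson_recurrent_eq_K S'.poisson_recurrent_eq_K)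
  fix z
  assume "z \<in> limit_orbit M S x"
  then obtain V where V: "V \<in> limit_operators M S" and z: "z = V x"
    by (auto simp: limit_orbit_def)
  have Px: "ortho_proj S.K x \<in> N"
    unfolding KK N_def by (rule S'.proj_K_in_limit_space)
  obtain t where lim: "\<And>x y. (\<lambda>k. cinner (S (t k) x) y) \<longlonglongrightarrow> cinner (V x) y"
    using V by (rule S.limit_operatorE) blast
  have "V (ortho_proj S.K x) \<in> N"
  proof (rule in_closed_csubspaceI[OF N])
    fix y
    assume "\<And>m. m \<in> N \<Longrightarrow> cinner m y = 0"
    then have "(\<lambda>k. cinner (S (t k) (ortho_proj S.K x)) y) = (\<lambda>k. 0)"
      using inv[OF Px] by auto
    then show "cinner (V (ortho_proj S.K x)) y = 0"
      using lim[of "ortho_proj S.K x" y] by (simp add: LIMSEQ_const_iff)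
  qed
  then show "z \<in> limit_space M S' x"
    by (simp add: z N_def S.limit_operator_proj_K[OF V])
qed

text \<open>Left multiplication by \<open>S'\<close>, hence also by \<open>S\<close>, preserves the limit algebra of \<open>S'\<close>. Applied to the
  unit \<open>P\<close> this yields \<open>S\<^sub>t P\<close>, and in the limit \<open>V P = V\<close>.\<close>

lemma limit_algebra_subset:
  assumes "unitary_flow M S" "unitary_flow M S'"
    and gen: "\<And>B. weakly_closed_star_subalgebra M B \<Longrightarrow> range S' \<subseteq> B \<Longrightarrow> range S \<subseteq> B"
    and eq: "poisson_recurrent M S = poisson_recurrent M S'"
  shows "limit_algebra M S \<subseteq> limit_algebra M S'"
proof -
  interpret S: unitary_flow M S by fact
  interpret S': unitary_flow M S' by fact
  let ?A = "limit_algebra M S'"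
  note A = S'.wcsa_limit_algebra
  have KK: "S.K = S'.K"
    using eq by (simp add: S.poisson_recurrent_eq_K S'.poisson_recurrent_eq_K)
  have "range S' \<subseteq> {W \<in> operators_on M. \<forall>X\<in>?A. W \<circ> X \<in> ?A \<and> cadjoint W \<circ> X \<in> ?A}"
    using S'.S_operator S'.S_comp_limit_algebra by (auto simp: S'.cadjoint_S)
  from gen[OF wcsa_left_multipliers[OF S.closed_M A] this]
  have mult: "S t \<circ> ortho_proj S.K \<in> ?A" for t
    using S'.proj_K_in_limit_algebra by (auto simp: KK)
  show ?thesis
  proof (rule S.limit_algebra_minimal[OF A], rule subsetI)
    fix V
    assume V: "V \<in> limit_operators M S"
    obtain t where lim: "\<And>x y. (\<lambda>k. cinner (S (t k) x) y) \<longlonglongrightarrow> cinner (V x) y"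
      using V by (rule S.limit_operatorE) blast
    show "V \<in> ?A"
    proof (rule wcsa_limit[OF A])
      show "eventually (\<lambda>k. S (t k) \<circ> ortho_proj S.K \<in> ?A) sequentially"
        using mult by simp
      show "(\<lambda>k. cinner ((S (t k) \<circ> ortho_proj S.K) x) y) \<longlonglongrightarrow> cinner (V x) y" for x y
        using lim[of "ortho_proj S.K x" y] by (simp add: S.limit_operator_proj_K[OF V])
    qed (use S.limit_operator_operator[OF V] in auto)
  qed
qed

theorem flows_equivalences:
  assumes S: "unitary_flow M S" and S': "unitary_flow M S'"
    and gen: "\<And>B. weakly_closed_star_subalgebra M B \<Longrightarrow> range S \<subseteq> B \<longleftrightarrow> range S' \<subseteq> B"
  shows "(entangled M S S' \<longleftrightarrow> common_limit_algebra M S S') \<and>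
    (common_limit_algebra M S S' \<longleftrightarrow> poisson_recurrent M S' = poisson_recurrent M S)"
proof -
  interpret S: unitary_flow M S by fact
  interpret S': unitary_flow M S' by fact
  note K = S.poisson_recurrent_eq_K S'.poisson_recurrent_eq_K
  have "poisson_recurrent M S = poisson_recurrent M S'" if ent: "entangled M S S'"
  proof -
    have "limit_space M S x = limit_space M S' x" for x
    proof (rule subset_antisym)
      show "limit_space M S x \<subseteq> limit_space M S' x"
        unfolding limit_space_def[of M S] using ent
        by (intro closure_cspan_minimal S'.closed_csubspace_limit_space) (simp add: entangled_def)
      show "limit_space M S' x \<subseteq> limit_space M S x"
        unfolding limit_space_def[of M S'] using ent
        by (intro closure_cspan_minimal S.closed_csubspace_limit_space) (simp add: entangled_def)
    qed
    then show ?thesis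
      by (simp add: poisson_recurrent_def)
  qed
  moreover have "poisson_recurrent M S = poisson_recurrent M S'" if com: "common_limit_algebra M S S'"
  proof -
    have "ortho_proj S.K = ortho_proj S'.K"
      using com by (simp add: common_limit_algebra_def K)
    then have "range (ortho_proj S.K) = range (ortho_proj S'.K)"
      by simp
    moreover have "range (ortho_proj N) = N" if "closed_csubspace N" for N :: "'a set"
      using ortho_proj_in[OF that] ortho_proj_ident[OF that] by (metis image_subset_iff rangeI subsetI subset_antisym)
    ultimately show ?thesis
      by (simp add: K S.closed_csubspace_K S'.closed_csubspace_K)
  qed
  moreover have "entangled M S S'" if eq: "poisson_recurrent M S = poisson_recurrent M S'"
    using limit_orbit_subset_limit_space[OF S S' _ eq] limit_orbit_subset_limit_space[OF S' S _ eq[symmetric]] gen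
    by (simp add: entangled_def)
  moreover have "common_limit_algebra M S S'" if eq: "poisson_recurrent M S = poisson_recurrent M S'"
  proof -
    have "limit_algebra M S = limit_algebra M S'"
      using limit_algebra_subset[OF S S' _ eq] limit_algebra_subset[OF S' S _ eq[symmetric]] gen by blast
    moreover have "is_unit_of (limit_algebra M S) (ortho_proj (poisson_recurrent M S))"
      unfolding is_unit_of_def K using S.proj_K_in_limit_algebra S.proj_K_unit by blast
    ultimately show ?thesis
      using eq by (simp add: common_limit_algebra_def)
  qed
  ultimately show ?thesis
    by metis
qed

section \<open>Strongly closed operator algebras and Neumann series\<close>

text \<open>A unital algebra of bounded operators on the whole space, closed under pointwise norm limits of
  sequences. Nothing is required about adjoints, so that the operators preserving a given closed
  subspace form such an algebra.\<close>

definition strong_operator_algebra :: "('a::complex_hilbert \<Rightarrow> 'a) set \<Rightarrow> bool" where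
  "strong_operator_algebra B \<longleftrightarrow>
     (\<forall>V\<in>B. bounded_clinear V) \<and> id \<in> B \<and>
     (\<forall>V\<in>B. \<forall>W\<in>B. (\<lambda>x. V x + W x) \<in> B) \<and>
     (\<forall>c. \<forall>V\<in>B. (\<lambda>x. c *\<^sub>C V x) \<in> B) \<and>
     (\<forall>V\<in>B. \<forall>W\<in>B. V \<circ> W \<in> B) \<and>
     (\<forall>X V. (\<forall>n::nat. X n \<in> B) \<longrightarrow> bounded_clinear V \<longrightarrow> (\<forall>x. (\<lambda>n. X n x) \<longlonglongrightarrow> V x) \<longrightarrow> V \<in> B)"

lemma strong_operator_algebraD:
  assumes "strong_operator_algebra B"
  shows "V \<in> B \<Longrightarrow> bounded_clinear V" "id \<in> B"
    "V \<in> B \<Longrightarrow> W \<in> B \<Longrightarrow> (\<lambda>x. V x + W x) \<in> B"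
    "V \<in> B \<Longrightarrow> (\<lambda>x. c *\<^sub>C V x) \<in> B"
    "V \<in> B \<Longrightarrow> W \<in> B \<Longrightarrow> V \<circ> W \<in> B"
    "(\<And>n::nat. X n \<in> B) \<Longrightarrow> bounded_clinear V \<Longrightarrow> (\<And>x. (\<lambda>n. X n x) \<longlonglongrightarrow> V x) \<Longrightarrow> V \<in> B"
    "V \<in> B \<Longrightarrow> (\<lambda>x. r *\<^sub>R V x) \<in> B"
proof -
  note A = assms[unfolded strong_operator_algebra_def]
  show "V \<in> B \<Longrightarrow> bounded_clinear V" "id \<in> B"
    "V \<in> B \<Longrightarrow> W \<in> B \<Longrightarrow> (\<lambda>x. V x + W x) \<in> B"
    "V \<in> B \<Longrightarrow> W \<in> B \<Longrightarrow> V \<circ> W \<in> B"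
    using A by auto
  show *: "V \<in> B \<Longrightarrow> (\<lambda>x. c *\<^sub>C V x) \<in> B" for c
    using A by auto
  show "V \<in> B \<Longrightarrow> (\<lambda>x. r *\<^sub>R V x) \<in> B"
    using *[of "of_real r"] by (simp add: scaleC_of_real)
  show "(\<And>n::nat. X n \<in> B) \<Longrightarrow> bounded_clinear V \<Longrightarrow> (\<And>x. (\<lambda>n. X n x) \<longlonglongrightarrow> V x) \<Longrightarrow> V \<in> B"
    using A by blast
qed

lemma strong_operator_algebra_funpow:
  assumes "strong_operator_algebra B" "V \<in> B"
  shows "V ^^ n \<in> B"
proof (induction n)
  case 0
  then show ?case
    using strong_operator_algebraD(2)[OF assms(1)] by (simp add: id_def)
next
  case (Suc n)
  then show ?case
    using strong_operator_algebraD(5)[OF assms Suc] by (simp only: funpow.simps)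
qed

lemma bounded_clinear_scaleR: "bounded_clinear A \<Longrightarrow> bounded_clinear (\<lambda>x. r *\<^sub>R A x)"
  using bounded_clinear_scaleC[of A "of_real r"] by (simp add: scaleC_of_real)

lemma bounded_clinear_funpow: "bounded_clinear A \<Longrightarrow> bounded_clinear (A ^^ n)"
  by (induction n) (simp_all add: bounded_clinear_id bounded_clinear_comp)

lemma norm_funpow_le:
  fixes A :: "'b::real_normed_vector \<Rightarrow> 'b"
  assumes "\<And>x. norm (A x) \<le> norm x"
  shows "norm ((A ^^ n) x) \<le> norm x"
proof (induction n)
  case (Suc n)
  then show ?case
    using order_trans[OF assms Suc] by simp
qed simp

text \<open>The operator \<open>N\<close> is \<open>(1 - q X)\<^sup>-\<^sup>1\<close>; it lies in every algebra that contains \<open>X\<close>.\<close>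

theorem neumann_series:
  fixes X :: "'a::complex_hilbert \<Rightarrow> 'a"
  assumes X: "bounded_clinear X" and contr: "\<And>x. norm (X x) \<le> norm x" and q: "0 \<le> q" "q < 1"
  shows "\<exists>N. bounded_clinear N \<and> (\<forall>x. N x - q *\<^sub>R X (N x) = x) \<and>
    (\<forall>B. strong_operator_algebra B \<longrightarrow> X \<in> B \<longrightarrow> N \<in> B)"
proof -
  define P where "P n x = (\<Sum>k<n. q ^ k *\<^sub>R (X ^^ k) x)" for n x
  define N where "N x = (\<Sum>k. q ^ k *\<^sub>R (X ^^ k) x)" for x
  have le: "norm (q ^ k *\<^sub>R (X ^^ k) x) \<le> q ^ k * norm x" for k x
    using q norm_funpow_le[of X k x, OF contr] by (simp add: mult_left_mono)
  have geo: "summable (\<lambda>k. q ^ k * norm x)" for x :: 'a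
    using q by (intro summable_mult2 summable_geometric) simp
  have summ: "summable (\<lambda>k. q ^ k *\<^sub>R (X ^^ k) x)" for x
    by (rule summable_comparison_test'[OF geo le])
  have lim: "(\<lambda>n. P n x) \<longlonglongrightarrow> N x" for x
    unfolding P_def N_def by (rule summable_LIMSEQ[OF summ])
  have P_lin: "bounded_clinear (P n)" for n
  proof (induction n)
    case 0
    then show ?case
      by (simp add: P_def[abs_def] bounded_clinear_zero)
  next
    case (Suc n)
    have "P (Suc n) = (\<lambda>x. P n x + q ^ n *\<^sub>R (X ^^ n) x)"
      by (simp add: P_def[abs_def])
    then show ?case
      using Suc by (simp add: bounded_clinear_add bounded_clinear_scaleR bounded_clinear_funpow X)
  qed
  have N_lin: "bounded_clinear N"
  proof (rule bounded_clinearI)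
    show "N (x + y) = N x + N y" for x y
    proof (rule LIMSEQ_unique[OF lim])
      show "(\<lambda>n. P n (x + y)) \<longlonglongrightarrow> N x + N y"
        unfolding bounded_clinearD(3)[OF P_lin] by (intro tendsto_add lim)
    qed
    show "N (c *\<^sub>C x) = c *\<^sub>C N x" for c x
    proof (rule LIMSEQ_unique[OF lim])
      show "(\<lambda>n. P n (c *\<^sub>C x)) \<longlonglongrightarrow> c *\<^sub>C N x"
        unfolding bounded_clinearD(2)[OF P_lin] by (intro scaleC.tendsto tendsto_const lim)
    qed
    show "norm (N x) \<le> (1 / (1 - q)) * norm x" for x
    proof -
      have "norm (N x) \<le> (\<Sum>k. q ^ k * norm x)"
        unfolding N_def
        by (rule order_trans[OF summable_norm suminf_le[OF le]])
          (use summable_comparison_test'[OF geo, of 0 "\<lambda>k. norm (q ^ k *\<^sub>R (X ^^ k) x)"] le geo in auto)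
      also have "\<dots> = (1 / (1 - q)) * norm x"
        using q by (simp add: suminf_mult2[symmetric] summable_geometric suminf_geometric)
      finally show ?thesis .
    qed
  qed
  have "N x - q *\<^sub>R X (N x) = x" for x
  proof -
    have 1: "(\<lambda>n. P (Suc n) x) \<longlonglongrightarrow> N x"
      using LIMSEQ_Suc[OF lim] .
    have 2: "P (Suc n) x = x + q *\<^sub>R X (P n x)" for n
      unfolding P_def sum.lessThan_Suc_shift
      by (simp add: linear_sum[OF bounded_linear.linear[OF bounded_clinearD(1)[OF X]]]
          bounded_clinearD(6)[OF X] scaleR_sum_right)
    have 3: "(\<lambda>n. x + q *\<^sub>R X (P n x)) \<longlonglongrightarrow> x + q *\<^sub>R X (N x)"
      by (intro tendsto_intros bounded_linear.tendsto[OF bounded_clinearD(1)[OF X]] lim)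
    have "N x = x + q *\<^sub>R X (N x)"
      by (rule LIMSEQ_unique[OF 1[unfolded 2] 3])
    then show ?thesis
      by (simp add: algebra_simps)
  qed
  moreover have "N \<in> B" if B: "strong_operator_algebra B" "X \<in> B" for B
  proof (rule strong_operator_algebraD(6)[OF B(1) _ N_lin lim])
    show "P n \<in> B" for n
    proof (induction n)
      case 0
      then show ?case
        using strong_operator_algebraD(4)[OF B(1) B(2), of 0]
        by (simp add: P_def[abs_def] scaleC.zero_left)
    next
      case (Suc n)
      have "P (Suc n) = (\<lambda>x. P n x + q ^ n *\<^sub>R (X ^^ n) x)"
        by (simp add: P_def[abs_def])
      then show ?case
        using Suc by (simp only:) (intro strong_operator_algebraD(3,7)[OF B(1)] strong_operator_algebra_funpow[OF B])
    qed
  qed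
  ultimately show ?thesis
    using N_lin by blast
qed

section \<open>Generator and cogenerator of a contraction semigroup\<close>

lemma integral_average_tendsto:
  fixes f :: "real \<Rightarrow> 'b::banach"
  assumes f: "continuous_on {a..} f"
  shows "((\<lambda>h. integral {a..a+h} f /\<^sub>R h) \<longlongrightarrow> f a) (at_right 0)"
proof (rule tendstoI)
  fix e :: real
  assume e: "e > 0"
  then obtain d where d: "d > 0" "\<And>t. t \<ge> a \<Longrightarrow> dist t a < d \<Longrightarrow> dist (f t) (f a) < e / 2"
    using f unfolding continuous_on_iff by (metis atLeast_iff half_gt_zero order_refl)
  have "dist (integral {a..a+h} f /\<^sub>R h) (f a) < e" if h: "0 < h" "h < d" for h
  proof -
    have cont: "continuous_on {a..a+h} f"
      by (rule continuous_on_subset[OF f]) auto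
    have "integral {a..a+h} (\<lambda>t. f t - f a) = integral {a..a+h} f - h *\<^sub>R f a"
      using h integral_diff[OF integrable_continuous_real[OF cont] integrable_const_ivl]
      by simp
    then have "integral {a..a+h} f /\<^sub>R h - f a = integral {a..a+h} (\<lambda>t. f t - f a) /\<^sub>R h"
      using h by (simp add: scaleR_diff_right)
    moreover have "norm (integral {a..a+h} (\<lambda>t. f t - f a)) \<le> e / 2 * (a + h - a)"
    proof (rule integral_bound)
      show "norm (f t - f a) \<le> e / 2" if "t \<in> {a..a+h}" for t
        using d(2)[of t] that h by (auto simp: dist_norm intro: less_imp_le)
    qed (use h in \<open>auto intro!: continuous_intros cont\<close>)
    ultimately have "norm (integral {a..a+h} f /\<^sub>R h - f a) \<le> e / 2"
      using h by (simp add: field_simps)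
    then show ?thesis
      using e by (simp add: dist_norm)
  qed
  then show "eventually (\<lambda>h. dist (integral {a..a+h} f /\<^sub>R h) (f a) < e) (at_right 0)"
    unfolding eventually_at_right_field using d(1) by (intro exI[of _ d]) auto
qed

lemma norm_funpow_diff_le:
  assumes A: "bounded_clinear A" "\<And>x. norm (A x) \<le> norm x" and C: "bounded_clinear C" "\<And>x. norm (C x) \<le> norm x"
    and comm: "\<And>x. A (C x) = C (A x)"
  shows "norm ((A ^^ n) x - (C ^^ n) x) \<le> real n * norm (A x - C x)"
proof (induction n)
  case (Suc n)
  have comm_n: "A ((C ^^ n) x) = (C ^^ n) (A x)"
    by (induction n) (simp_all add: comm)
  have "(A ^^ Suc n) x - (C ^^ Suc n) x = A ((A ^^ n) x - (C ^^ n) x) + (C ^^ n) (A x - C x)"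
    by (simp add: bounded_clinearD[OF A(1)] bounded_clinearD[OF bounded_clinear_funpow[OF C(1)]] comm_n
        funpow_swap1)
  then have "norm ((A ^^ Suc n) x - (C ^^ Suc n) x) \<le>
      norm (A ((A ^^ n) x - (C ^^ n) x)) + norm ((C ^^ n) (A x - C x))"
    by (simp add: norm_triangle_ineq)
  also have "\<dots> \<le> real n * norm (A x - C x) + norm (A x - C x)"
    using order_trans[OF A(2) Suc] norm_funpow_le[of C n, OF C(2)] by (rule add_mono)
  finally show ?case
    by (simp add: algebra_simps)
qed simp

locale contraction_semigroup =
  fixes T :: "real \<Rightarrow> 'a::complex_hilbert \<Rightarrow> 'a"
  assumes T: "c0_contraction_semigroup T"
begin

lemma T_lin: "t \<ge> 0 \<Longrightarrow> bounded_clinear (T t)"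
  and norm_T: "t \<ge> 0 \<Longrightarrow> norm (T t x) \<le> norm x"
  and T_0: "T 0 = id"
  and T_add: "s \<ge> 0 \<Longrightarrow> t \<ge> 0 \<Longrightarrow> T (s + t) = T s \<circ> T t"
  and T_right: "((\<lambda>t. T t x) \<longlongrightarrow> x) (at_right 0)"
  using T by (simp_all add: c0_contraction_semigroup_def)

lemma T_add': "s \<ge> 0 \<Longrightarrow> t \<ge> 0 \<Longrightarrow> T s (T t x) = T (s + t) x"
  by (simp add: T_add)

lemma T_commute: "s \<ge> 0 \<Longrightarrow> t \<ge> 0 \<Longrightarrow> T s (T t x) = T t (T s x)"
  by (simp add: T_add' add.commute)

lemma norm_T_diff:
  assumes "0 \<le> s" "s \<le> t"
  shows "norm (T t x - T s x) \<le> norm (T (t - s) x - x)"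
proof -
  have "T t x = T s (T (t - s) x)"
    using assms by (simp add: T_add')
  then have "T t x - T s x = T s (T (t - s) x - x)"
    using assms bounded_clinearD(4)[OF T_lin] by simp
  then show ?thesis
    using assms norm_T by simp
qed

lemma T_continuous: "continuous_on {0..} (\<lambda>t. T t x)"
  unfolding continuous_on_iff
proof (intro ballI allI impI)
  fix s e :: real
  assume s: "s \<in> {0..}" and e: "e > 0"
  have "eventually (\<lambda>h. dist (T h x) x < e) (at_right 0)"
    using e by (rule tendstoD[OF T_right])
  then obtain d where d: "d > 0" "\<And>h. 0 < h \<Longrightarrow> h < d \<Longrightarrow> norm (T h x - x) < e"
    unfolding eventually_at_right_field by (auto simp: dist_norm)
  have "dist (T t x) (T s x) < e" if "t \<in> {0..}" "dist t s < d" for t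
  proof (cases t s rule: linorder_cases)
    case less
    then show ?thesis
      using norm_T_diff[of t s x] d(2)[of "s - t"] that s by (simp add: dist_norm norm_minus_commute)
  next
    case greater
    then show ?thesis
      using norm_T_diff[of s t x] d(2)[of "t - s"] that s by (simp add: dist_norm)
  qed (use e in simp)
  then show "\<exists>d>0. \<forall>t\<in>{0..}. dist t s < d \<longrightarrow> dist (T t x) (T s x) < e"
    using d(1) by blast
qed

text \<open>The graph of the generator: \<open>gen x y\<close> says that \<open>x\<close> lies in the domain and \<open>G x = y\<close>.\<close>

definition gen :: "'a \<Rightarrow> 'a \<Rightarrow> bool" where
  "gen x y \<longleftrightarrow> ((\<lambda>h. (T h x - x) /\<^sub>R h) \<longlongrightarrow> y) (at_right 0)"

lemma gen_unique: "gen x y \<Longrightarrow> gen x y' \<Longrightarrow> y = y'"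
  unfolding gen_def by (rule tendsto_unique[OF trivial_limit_at_right_real])

lemma gen_generator: "gen x y \<longleftrightarrow> x \<in> generator_domain T \<and> generator T x = y"
proof -
  have "generator T x = y" if "gen x y" for y
    using that unfolding generator_def gen_def
    by (rule tendsto_Lim[OF trivial_limit_at_right_real])
  then show ?thesis
    unfolding generator_domain_def gen_def[symmetric] by blast
qed

lemma eventually_at_right_pos: "(\<And>h. h > 0 \<Longrightarrow> P h) \<Longrightarrow> eventually P (at_right (0::real))"
  by (rule eventually_at_rightI[of 0 1]) auto

lemma gen_diff:
  assumes "gen x y" "gen x' y'"
  shows "gen (x - x') (y - y')"
  unfolding gen_def
proof (rule Lim_transform_eventually)
  show "((\<lambda>h. (T h x - x) /\<^sub>R h - (T h x' - x') /\<^sub>R h) \<longlongrightarrow> y - y') (at_right 0)"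
    using assms unfolding gen_def by (rule tendsto_diff)
  show "eventually (\<lambda>h. (T h x - x) /\<^sub>R h - (T h x' - x') /\<^sub>R h =
      (T h (x - x') - (x - x')) /\<^sub>R h) (at_right 0)"
    by (rule eventually_at_right_pos) (simp add: bounded_clinearD(4)[OF T_lin] algebra_simps)
qed

lemma gen_scaleC:
  assumes "gen x y"
  shows "gen (c *\<^sub>C x) (c *\<^sub>C y)"
  unfolding gen_def
proof (rule Lim_transform_eventually)
  show "((\<lambda>h. c *\<^sub>C ((T h x - x) /\<^sub>R h)) \<longlongrightarrow> c *\<^sub>C y) (at_right 0)"
    using assms unfolding gen_def by (intro scaleC.tendsto tendsto_const)
  show "eventually (\<lambda>h. c *\<^sub>C ((T h x - x) /\<^sub>R h) = (T h (c *\<^sub>C x) - c *\<^sub>C x) /\<^sub>R h) (at_right 0)"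
    by (rule eventually_at_right_pos)
      (simp add: bounded_clinearD(2)[OF T_lin] scaleC.scaleR_right scaleC.diff_right)
qed

lemma gen_scaleR: "gen x y \<Longrightarrow> gen (r *\<^sub>R x) (r *\<^sub>R y)"
  using gen_scaleC[of x y "of_real r"] by (simp add: scaleC_of_real)

lemma gen_add: "gen x y \<Longrightarrow> gen x' y' \<Longrightarrow> gen (x + x') (y + y')"
  using gen_diff[of x y "(-1) *\<^sub>R x'" "(-1) *\<^sub>R y'"] gen_scaleR[of x' y' "-1"] by simp

lemma gen_T:
  assumes "gen x y" and t: "t \<ge> 0"
  shows "gen (T t x) (T t y)"
  unfolding gen_def
proof (rule Lim_transform_eventually)
  note lin = T_lin[OF t]
  show "((\<lambda>h. T t ((T h x - x) /\<^sub>R h)) \<longlongrightarrow> T t y) (at_right 0)"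
    using assms(1) unfolding gen_def by (rule bounded_linear.tendsto[OF bounded_clinearD(1)[OF lin]])
  show "eventually (\<lambda>h. T t ((T h x - x) /\<^sub>R h) = (T h (T t x) - T t x) /\<^sub>R h) (at_right 0)"
    by (rule eventually_at_right_pos)
      (simp add: bounded_clinearD(4,6)[OF lin] T_commute[OF t])
qed

lemma difference_quotient_dissipative:
  assumes h: "h \<ge> 0"
  shows "Re (cinner ((T h x - x) /\<^sub>R h) x) \<le> 0"
proof -
  have "Re (cinner (T h x) x) \<le> norm (T h x) * norm x"
    by (rule order_trans[OF complex_Re_le_cmod cauchy_schwarz])
  also have "\<dots> \<le> (norm x)\<^sup>2"
    using norm_T[OF h, of x] by (simp add: power2_eq_square mult_right_mono)
  finally have "Re (cinner (T h x - x) x) \<le> 0"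
    by (simp add: cinner.diff_left norm_sq_cinner)
  then show ?thesis
    using h by (simp add: cinner.scaleR_left mult_nonneg_nonpos)
qed

lemma gen_dissipative:
  assumes "gen x y"
  shows "Re (cinner y x) \<le> 0"
proof (rule tendsto_upperbound)
  show "((\<lambda>h. Re (cinner ((T h x - x) /\<^sub>R h) x)) \<longlongrightarrow> Re (cinner y x)) (at_right 0)"
    using assms unfolding gen_def by (intro tendsto_Re cinner.tendsto tendsto_const)
  show "eventually (\<lambda>h. Re (cinner ((T h x - x) /\<^sub>R h) x) \<le> 0) (at_right 0)"
    by (rule eventually_at_right_pos) (intro difference_quotient_dissipative less_imp_le)
qed (rule trivial_limit_at_right_real)

text \<open>Dissipativity bounds \<open>1 - h G\<close> from below by 1, which gives injectivity and the contraction property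
  of its inverse.\<close>

lemma norm_le_of_dissipative:
  assumes "Re (cinner y x) \<le> 0" "h \<ge> 0"
  shows "norm x \<le> norm (x - h *\<^sub>R y)"
proof -
  have "Re (cinner x y) \<le> 0"
    using assms(1) cinner_commute[of x y] by simp
  then have "h * Re (cinner x y) \<le> 0"
    using assms(2) by (simp add: mult_nonneg_nonpos)
  moreover have "(norm (x - h *\<^sub>R y))\<^sup>2 = (norm x)\<^sup>2 + (norm (h *\<^sub>R y))\<^sup>2 - 2 * (h * Re (cinner x y))"
    unfolding norm_sq_diff by (simp add: cinner.scaleR_right del: norm_scaleR)
  ultimately have "(norm x)\<^sup>2 \<le> (norm (x - h *\<^sub>R y))\<^sup>2"
    using zero_le_power2[of "norm (h *\<^sub>R y)"] by linarith
  then show ?thesis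
    by (simp add: power2_le_iff_abs_le)
qed

text \<open>The resolvent equation \<open>x - G x = z\<close> is solved without an improper integral. With
  \<open>f t = e\<^bsup>-t\<^esup> T\<^sub>t w\<close> the integral \<open>y\<close> of \<open>f\<close> over the unit interval satisfies
  \<open>y - G y = f 0 - f 1 = (1 - e\<^sup>-\<^sup>1 T\<^sub>1) w\<close>, and a Neumann series provides \<open>w\<close> such that this is \<open>z\<close>.\<close>

lemma resolvent_exists: "\<exists>x y. gen x y \<and> x - y = z"
proof -
  define q where "q = exp (- 1 :: real)"
  have q: "0 \<le> q" "q < 1"
    by (simp_all add: q_def)
  obtain N where "\<And>x. N x - q *\<^sub>R T 1 (N x) = x"
    using neumann_series[OF T_lin norm_T q, of 1] by auto
  then obtain w where w: "w - q *\<^sub>R T 1 w = z"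
    by blast
  define f where "f t = exp (- t) *\<^sub>R T t w" for t
  have f: "continuous_on {0..} f"
    unfolding f_def by (intro continuous_intros T_continuous)
  have int: "f integrable_on {a..b}" if "a \<ge> 0" for a b
    using that by (intro integrable_continuous_real continuous_on_subset[OF f]) auto
  define y where "y = integral {0..1} f"
  define D where "D h = integral {1..1+h} f - integral {0..h} f" for h
  have quot: "((\<lambda>h. D h /\<^sub>R h) \<longlongrightarrow> f 1 - f 0) (at_right 0)"
    using tendsto_diff[OF integral_average_tendsto[of 1 f] integral_average_tendsto[OF f]]
    by (simp add: D_def scaleR_diff_right continuous_on_subset[OF f])
  have Th: "T h y = exp h *\<^sub>R (y + D h)" if h: "h > 0" for h
  proof -
    have "T h y = integral {0..1} (T h \<circ> f)"
      unfolding y_def using int h bounded_clinearD(1)[OF T_lin] by (intro integral_linear[symmetric]) auto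
    also have "\<dots> = integral {0..1} (\<lambda>t. exp h *\<^sub>R (f \<circ> (+) h) t)"
    proof (rule integral_cong)
      show "(T h \<circ> f) t = exp h *\<^sub>R (f \<circ> (+) h) t" if "t \<in> {0..1}" for t
        using that h by (simp add: f_def bounded_clinearD(6)[OF T_lin] T_add' flip: exp_add)
    qed
    also have "\<dots> = exp h *\<^sub>R integral {0..1} (f \<circ> (+) h)"
      by (rule integral_cmul)
    also have "integral {0..1} (f \<circ> (+) h) = integral {h..1+h} f"
      by (simp add: integral_shift_Icc_real)
    also have "\<dots> = y + D h"
    proof -
      have "integral {0..h} f + integral {h..1+h} f = integral {0..1+h} f"
        using h int by (intro Henstock_Kurzweil_Integration.integral_combine) auto
      moreover have "integral {0..1} f + integral {1..1+h} f = integral {0..1+h} f"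
        using h int by (intro Henstock_Kurzweil_Integration.integral_combine) auto
      ultimately show ?thesis
        by (simp add: y_def D_def algebra_simps)
    qed
    finally show ?thesis .
  qed
  have "gen y (y + (f 1 - f 0))"
    unfolding gen_def
  proof (rule Lim_transform_eventually)
    have e1: "((\<lambda>h::real. (exp h - 1) / h) \<longlongrightarrow> 1) (at_right 0)"
      using lim_exp_minus_1 by (rule filterlim_mono) (simp_all add: at_within_le_nhds at_le)
    have e2: "((\<lambda>h. h *\<^sub>R (D h /\<^sub>R h)) \<longlongrightarrow> 0 *\<^sub>R (f 1 - f 0)) (at_right 0)"
      by (intro tendsto_scaleR quot tendsto_ident_at)
    have "((\<lambda>h. ((exp h - 1) / h) *\<^sub>R (y + h *\<^sub>R (D h /\<^sub>R h)) + D h /\<^sub>R h) \<longlongrightarrow>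
        1 *\<^sub>R (y + 0 *\<^sub>R (f 1 - f 0)) + (f 1 - f 0)) (at_right 0)"
      by (intro tendsto_add tendsto_scaleR[OF e1] quot tendsto_const e2)
    then show "((\<lambda>h. ((exp h - 1) / h) *\<^sub>R (y + h *\<^sub>R (D h /\<^sub>R h)) + D h /\<^sub>R h) \<longlongrightarrow>
        y + (f 1 - f 0)) (at_right 0)"
      by simp
    show "eventually (\<lambda>h. ((exp h - 1) / h) *\<^sub>R (y + h *\<^sub>R (D h /\<^sub>R h)) + D h /\<^sub>R h =
        (T h y - y) /\<^sub>R h) (at_right 0)"
    proof (rule eventually_at_right_pos)
      fix h :: real
      assume h: "h > 0"
      have "T h y - y = (exp h - 1) *\<^sub>R (y + D h) + D h"
        by (simp add: Th[OF h] algebra_simps)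
      then show "((exp h - 1) / h) *\<^sub>R (y + h *\<^sub>R (D h /\<^sub>R h)) + D h /\<^sub>R h = (T h y - y) /\<^sub>R h"
        using h by (simp add: scaleR_add_right divide_inverse mult.commute)
    qed
  qed
  moreover have "y - (y + (f 1 - f 0)) = z"
    using w by (simp add: f_def T_0 q_def)
  ultimately show ?thesis
    by blast
qed

lemma gen_injective:
  assumes "gen x y" "gen x' y'" "x - y = x' - y'"
  shows "x = x'"
proof -
  have "norm (x - x') \<le> norm ((x - x') - 1 *\<^sub>R (y - y'))"
    by (rule norm_le_of_dissipative[OF gen_dissipative[OF gen_diff[OF assms(1,2)]]]) simp
  also have "(x - x') - 1 *\<^sub>R (y - y') = 0"
    using assms(3) by (simp add: algebra_simps)
  finally show ?thesis
    by simp
qed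

abbreviation C :: "'a \<Rightarrow> 'a" where
  "C \<equiv> cogenerator T"

text \<open>The resolvent \<open>(1 - G)\<^sup>-\<^sup>1\<close>, expressed through the cogenerator \<open>C = 1 - 2 R\<close>.\<close>

definition R :: "'a \<Rightarrow> 'a" where
  "R z = (1/2) *\<^sub>R (z - C z)"

lemma C_eq: "C z = z - 2 *\<^sub>R R z"
  by (simp add: R_def)

lemma gen_R: "gen (R z) (R z - z)"
proof -
  let ?g = "\<lambda>x. generator T x - x"
  define x where "x = inv_into (generator_domain T) ?g z"
  obtain x' y' where "gen x' y'" "x' - y' = - z"
    using resolvent_exists by blast
  then have "x' \<in> generator_domain T" "?g x' = z"
    by (auto simp: gen_generator algebra_simps)
  then have "z \<in> ?g ` generator_domain T"
    by blast
  then have "x \<in> generator_domain T" "?g x = z"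
    unfolding x_def by (rule inv_into_into, rule f_inv_into_f)
  then have x: "gen x (z + x)"
    by (auto simp: gen_generator)
  then have "C z = z + x + x"
    unfolding cogenerator_def Let_def x_def[symmetric] by (simp add: gen_generator)
  then have "R z = (-1) *\<^sub>R x"
    by (simp add: R_def algebra_simps flip: scaleR_2)
  then show ?thesis
    using gen_scaleR[OF x, of "-1"] by (simp add: algebra_simps)
qed

lemma R_eqI: "gen x y \<Longrightarrow> R (x - y) = x"
  by (rule gen_injective[OF gen_R]) auto

lemma R_lin: "bounded_clinear R" and norm_R: "norm (R x) \<le> norm x"
proof -
  show *: "norm (R x) \<le> norm x" for x
    using norm_le_of_dissipative[OF gen_dissipative[OF gen_R[of x]], of 1] by simp
  show "bounded_clinear R"
  proof (rule bounded_clinearI)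
    show "R (x + y) = R x + R y" for x y
      using R_eqI[OF gen_add[OF gen_R[of x] gen_R[of y]]] by (simp add: algebra_simps)
    show "R (c *\<^sub>C x) = c *\<^sub>C R x" for c x
      using R_eqI[OF gen_scaleC[OF gen_R[of x], of c]] by (simp add: scaleC.diff_right[symmetric])
    show "norm (R x) \<le> 1 * norm x" for x
      using *[of x] by simp
  qed
qed

lemma C_lin: "bounded_clinear C"
  using bounded_clinear_diff[OF bounded_clinear_id bounded_clinear_scaleR[OF R_lin, of 2]]
  by (simp add: C_eq[abs_def])

lemma norm_C: "norm (C x) \<le> norm x"
proof -
  have "Re (cinner (R x - x) (R x)) \<le> 0"
    by (rule gen_dissipative[OF gen_R])
  then have "(norm (R x))\<^sup>2 \<le> Re (cinner x (R x))"
    by (simp add: cinner.diff_left norm_sq_cinner)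
  then have "(norm (C x))\<^sup>2 \<le> (norm x)\<^sup>2"
    unfolding C_eq norm_sq_diff by (simp add: cinner.scaleR_right power_mult_distrib)
  then show ?thesis
    by (simp add: power2_le_iff_abs_le)
qed

text \<open>\<open>R\<close> is the strong limit of the resolvents \<open>N n = (1 - A)\<^sup>-\<^sup>1\<close> of the difference quotients
  \<open>A = (T\<^sub>h - 1) / h\<close> with \<open>h = 1 / (n + 1)\<close>. By dissipativity of \<open>A\<close> the error \<open>N n z - R z\<close> is
  bounded by its image under \<open>1 - A\<close>, which is \<open>A R z - G R z\<close>.\<close>

lemma cogenerator_in_strong_operator_algebra:
  assumes B: "strong_operator_algebra B" and TB: "\<And>t. t \<ge> 0 \<Longrightarrow> T t \<in> B"
  shows "C \<in> B"
proof -
  define h where "h n = inverse (real (Suc n))" for n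
  have h: "h n > 0" for n
    by (simp add: h_def)
  have h_lim: "filterlim h (at_right 0) sequentially"
    using LIMSEQ_inverse_real_of_nat unfolding h_def[abs_def]
    by (auto simp: filterlim_at)
  have "\<exists>N\<in>B. \<forall>z. N z - (T (h n) (N z) - N z) /\<^sub>R h n = z" for n
  proof -
    define q where "q = 1 / (1 + h n)"
    have q: "0 \<le> q" "q < 1"
      using h[of n] by (simp_all add: q_def)
    obtain N where N: "N \<in> B" "\<And>x. N x - q *\<^sub>R T (h n) (N x) = x"
      using neumann_series[OF T_lin[OF less_imp_le[OF h]] norm_T[OF less_imp_le[OF h]] q, of n]
          B TB[OF less_imp_le[OF h]] by auto
    show ?thesis
    proof (intro bexI allI)
      let ?N = "\<lambda>z. (h n / (1 + h n)) *\<^sub>R N z"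
      show "?N \<in> B"
        by (rule strong_operator_algebraD(7)[OF B N(1)])
      fix z
      have lin: "T (h n) (r *\<^sub>R x) = r *\<^sub>R T (h n) x" for r x
        using h[of n] bounded_clinearD(6)[OF T_lin] by simp
      have expand: "a *\<^sub>R u - (a *\<^sub>R v - a *\<^sub>R u) /\<^sub>R k = (a + a / k) *\<^sub>R u - (a / k) *\<^sub>R v"
        for a k :: real and u v :: 'a
        by (simp add: algebra_simps divide_inverse)
      have c: "(h n / (1 + h n)) / h n = q" "h n / (1 + h n) + q = 1"
        using h[of n] by (simp_all add: q_def add_divide_distrib[symmetric])
      have "?N z - (T (h n) (?N z) - ?N z) /\<^sub>R h n =
          (h n / (1 + h n) + q) *\<^sub>R N z - q *\<^sub>R T (h n) (N z)"
        unfolding lin expand c(1) ..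
      also have "\<dots> = z"
        using N(2)[of z] by (simp only: c(2) scaleR_one)
      finally show "?N z - (T (h n) (?N z) - ?N z) /\<^sub>R h n = z" .
    qed
  qed
  then obtain N where N: "\<And>n. N n \<in> B" "\<And>n z. N n z - (T (h n) (N n z) - N n z) /\<^sub>R h n = z"
    by metis
  have "R \<in> B"
  proof (rule strong_operator_algebraD(6)[OF B N(1) R_lin])
    fix z
    have quot: "(\<lambda>n. (T (h n) (R z) - R z) /\<^sub>R h n) \<longlonglongrightarrow> R z - z"
      using gen_R[of z] unfolding gen_def by (rule filterlim_compose[OF _ h_lim])
    have le: "norm (N n z - R z) \<le> norm ((T (h n) (R z) - R z) /\<^sub>R h n - (R z - z))" for n
    proof -
      let ?v = "N n z - R z"
      have "norm ?v \<le> norm (?v - 1 *\<^sub>R ((T (h n) ?v - ?v) /\<^sub>R h n))"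
        by (intro norm_le_of_dissipative difference_quotient_dissipative less_imp_le h) simp
      also have "?v - 1 *\<^sub>R ((T (h n) ?v - ?v) /\<^sub>R h n) =
          (N n z - (T (h n) (N n z) - N n z) /\<^sub>R h n) - (R z - (T (h n) (R z) - R z) /\<^sub>R h n)"
        unfolding bounded_clinearD(4)[OF T_lin[OF less_imp_le[OF h]]] by (simp add: algebra_simps)
      also have "\<dots> = (T (h n) (R z) - R z) /\<^sub>R h n - (R z - z)"
        unfolding N(2) by simp
      finally show ?thesis .
    qed
    show "(\<lambda>n. N n z) \<longlonglongrightarrow> R z"
    proof (rule LIM_zero_cancel, rule Lim_null_comparison)
      show "eventually (\<lambda>n. norm (N n z - R z) \<le> norm ((T (h n) (R z) - R z) /\<^sub>R h n - (R z - z)))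
          sequentially"
        using le by (rule always_eventually[OF allI])
      show "(\<lambda>n. norm ((T (h n) (R z) - R z) /\<^sub>R h n - (R z - z))) \<longlonglongrightarrow> 0"
        by (rule tendsto_norm_zero[OF LIM_zero[OF quot]])
    qed
  qed
  then have "(\<lambda>x. id x + (- 2) *\<^sub>R R x) \<in> B"
    by (intro strong_operator_algebraD(2,3,7)[OF B])
  then show ?thesis
    by (simp add: C_eq[abs_def])
qed

text \<open>The domain of the generator is dense.\<close>

lemma range_R_dense:
  assumes "\<And>z. cinner (R z) w = 0"
  shows "w = 0"
proof -
  have "Re (cinner (R w - w) (R w)) \<le> 0"
    by (rule gen_dissipative[OF gen_R])
  moreover have "cinner w (R w) = 0"
    using assms[of w] cinner_eq_0_sym by blast
  ultimately have "(norm (R w))\<^sup>2 \<le> 0"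
    by (simp add: cinner.diff_left norm_sq_cinner)
  then have "R w = 0"
    by simp
  then have "gen 0 (- w)"
    using gen_R[of w] by simp
  then show ?thesis
    using gen_unique[OF _ gen_scaleR[OF gen_R[of w], of 0], of "- w"] by simp
qed

text \<open>\<open>T\<^sub>t\<close> is the strong limit of \<open>F\<^sub>h\<^sup>n\<close> with \<open>h = t / n\<close> and \<open>F\<^sub>h = (1 - h G)\<^sup>-\<^sup>1\<close>, and
  \<open>F\<^sub>h = (2 / (1 + h)) R (1 - q C)\<^sup>-\<^sup>1\<close> with \<open>q = (1 - h) / (1 + h)\<close>. Since \<open>T\<^sub>h\<close> and \<open>F\<^sub>h\<close> are
  commuting contractions, \<open>T\<^sub>h\<^sup>n x\<close> and \<open>F\<^sub>h\<^sup>n x\<close> differ by at most \<open>n\<close> times the distance of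
  \<open>T\<^sub>h x\<close> and \<open>F\<^sub>h x\<close>, which is \<open>o(h)\<close> for \<open>x\<close> in the dense range of \<open>R\<^sup>2\<close>.\<close>

lemma semigroup_in_strong_operator_algebra:
  assumes B: "strong_operator_algebra B" and CB: "C \<in> B" and t: "t \<ge> 0"
  shows "T t \<in> B"
proof (cases "t = 0")
  case True
  then show ?thesis
    using strong_operator_algebraD(2)[OF B] by (simp add: T_0)
next
  case False
  with t have t: "t > 0"
    by simp
  have "(\<lambda>x. (1/2) *\<^sub>R (id x + (- 1) *\<^sub>R C x)) \<in> B"
    by (intro strong_operator_algebraD(2,3,7)[OF B] CB)
  then have RB: "R \<in> B"
    by (simp add: R_def[abs_def])
  have "\<exists>F\<in>B. \<forall>z. gen (F z) ((F z - z) /\<^sub>R h)" if h: "0 < h" "h \<le> 1" for h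
  proof -
    define q where "q = (1 - h) / (1 + h)"
    have q: "0 \<le> q" "q < 1"
      using h by (simp_all add: q_def)
    obtain N where N: "N \<in> B" "\<And>x. N x - q *\<^sub>R C (N x) = x"
      using neumann_series[OF C_lin norm_C q] B CB by auto
    show ?thesis
    proof (intro bexI allI)
      define r where "r = inverse (1 + h)"
      have r: "r * (1 + h) = 1"
        using h by (simp add: r_def)
      define c where "c = 2 * r"
      let ?F = "\<lambda>z. c *\<^sub>R (R \<circ> N) z"
      show "?F \<in> B"
        by (intro strong_operator_algebraD(5,7)[OF B] RB N)
      fix z
      let ?v = "N z"
      have g: "gen (?F z) (c *\<^sub>R (R ?v - ?v))"
        using gen_scaleR[OF gen_R] by simp
      have c: "c * (1 + h) = 2" "c * (1 - h) / 2 = q"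
      proof -
        have "c * (1 + h) = 2 * (r * (1 + h))"
          by (simp only: c_def mult.assoc)
        then show "c * (1 + h) = 2"
          by (simp only: r mult_1_right)
        have "c * (1 - h) / 2 = (1 - h) * r"
          by (simp only: c_def) simp
        then show "c * (1 - h) / 2 = q"
          by (simp only: q_def r_def divide_inverse)
      qed
      have c': "q + c * h = 1"
        unfolding c(2)[symmetric] using c(1) by (simp add: field_simps)
      have expand: "a *\<^sub>R ((1/2) *\<^sub>R (v - w)) + b *\<^sub>R v = (a / 2 + b) *\<^sub>R v - (a / 2) *\<^sub>R w"
        for a b and v w :: 'a
        by (simp add: algebra_simps)
      have "?F z - h *\<^sub>R (c *\<^sub>R (R ?v - ?v)) = (c * (1 - h)) *\<^sub>R R ?v + (c * h) *\<^sub>R ?v"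
        by (simp add: algebra_simps)
      also have "\<dots> = (c * (1 - h) / 2 + c * h) *\<^sub>R ?v - (c * (1 - h) / 2) *\<^sub>R C ?v"
        unfolding R_def by (rule expand)
      also have "\<dots> = z"
        using N(2)[of z] by (simp only: c(2) c' scaleR_one)
      finally have *: "?F z - h *\<^sub>R (c *\<^sub>R (R ?v - ?v)) = z" .
      have solve: "b = (a - w) /\<^sub>R h" if "a - h *\<^sub>R b = w" for a b w :: 'a
        using h that by auto
      have "c *\<^sub>R (R ?v - ?v) = (?F z - z) /\<^sub>R h"
        by (rule solve[OF *])
      with g show "gen (?F z) ((?F z - z) /\<^sub>R h)"
        by simp
    qed
  qed
  then obtain F where F: "\<And>h. 0 < h \<Longrightarrow> h \<le> 1 \<Longrightarrow> F h \<in> B"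
    "\<And>h z. 0 < h \<Longrightarrow> h \<le> 1 \<Longrightarrow> gen (F h z) ((F h z - z) /\<^sub>R h)"
    by metis
  have F_lin: "bounded_clinear (F h)" if "0 < h" "h \<le> 1" for h
    using strong_operator_algebraD(1)[OF B F(1)[OF that]] .
  have F_unique: "F h (x - h *\<^sub>R y) = x" if h: "0 < h" "h \<le> 1" and g: "gen x y" for h x y
  proof -
    let ?z = "x - h *\<^sub>R y"
    have "norm (F h ?z - x) \<le> norm ((F h ?z - x) - h *\<^sub>R ((F h ?z - ?z) /\<^sub>R h - y))"
      using h by (intro norm_le_of_dissipative gen_dissipative gen_diff[OF F(2) g]) auto
    also have "(F h ?z - x) - h *\<^sub>R ((F h ?z - ?z) /\<^sub>R h - y) = 0"
      using h by (simp add: algebra_simps)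
    finally show ?thesis
      by simp
  qed
  have norm_F: "norm (F h z) \<le> norm z" if h: "0 < h" "h \<le> 1" for h z
    using norm_le_of_dissipative[OF gen_dissipative[OF F(2)[OF h]], of h] h by simp
  have F_T: "T s (F h z) = F h (T s z)" if h: "0 < h" "h \<le> 1" and s: "s \<ge> 0" for h s z
  proof -
    have "gen (T s (F h z)) (T s ((F h z - z) /\<^sub>R h))"
      by (rule gen_T[OF F(2)[OF h] s])
    from F_unique[OF h this] show ?thesis
      using h by (simp add: bounded_clinearD(4,6)[OF T_lin[OF s]])
  qed
  obtain m :: nat where m: "real m \<ge> t" "m > 0"
    using real_arch_simple[of t] t by (metis le_zero_eq not_gr_zero not_le of_nat_0)
  \<comment> \<open>The index starts at \<open>m \<ge> t\<close>, so that all step sizes \<open>h\<close> are at most 1.\<close>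
  define n where "n k = k + m" for k
  define h where "h k = t / real (n k)" for k
  have n: "n k > 0" "real (n k) \<ge> t" for k
    using m by (auto simp: n_def)
  have h: "0 < h k" "h k \<le> 1" for k
    using n[of k] t by (auto simp: h_def)
  have hn: "h k * real (n k) = t" for k
    using n[of k] by (simp add: h_def)
  have h_0: "h \<longlonglongrightarrow> 0"
  proof -
    have "(\<lambda>k. t / real (k + m)) \<longlonglongrightarrow> 0"
      by (rule LIMSEQ_ignore_initial_segment) (rule lim_const_over_n)
    then show ?thesis
      by (simp add: h_def[abs_def] n_def)
  qed
  have h_lim: "filterlim h (at_right 0) sequentially"
    using h_0 h(1) by (auto simp: filterlim_at intro!: always_eventually less_imp_neq[THEN not_sym])
  define W where "W = {x. (\<lambda>k. (F (h k) ^^ n k) x) \<longlonglongrightarrow> T t x}"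
  have Fn_lin: "bounded_clinear (F (h k) ^^ n k)" for k
    by (rule bounded_clinear_funpow[OF F_lin[OF h]])
  have W: "closed_csubspace W"
    unfolding W_def
    by (rule closed_csubspace_convergence[OF Fn_lin norm_funpow_le[OF norm_F[OF h]] T_lin norm_T])
      (use t in auto)
  have RR: "R (R z) \<in> W" for z
  proof -
    define x where "x = R (R z)"
    define y where "y = x - R z"
    have x: "gen x y"
      using gen_R[of "R z"] by (simp add: x_def y_def)
    define y2 where "y2 = y - (R z - z)"
    have y: "gen y y2"
      unfolding y2_def
      using gen_diff[OF x gen_R[of z]] by (simp add: y_def)
    have Fx: "F (h k) x = x + h k *\<^sub>R F (h k) y" for k
      using F_unique[OF h x, of k] bounded_clinearD(4,6)[OF F_lin[OF h], of k]
      by (simp add: algebra_simps)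
    have Fy: "F (h k) y = y + h k *\<^sub>R F (h k) y2" for k
      using F_unique[OF h y, of k] bounded_clinearD(4,6)[OF F_lin[OF h], of k]
      by (simp add: algebra_simps)
    define A where "A k = (T (h k) x - x) /\<^sub>R h k" for k
    have A: "A \<longlonglongrightarrow> y"
      using x unfolding gen_def A_def[abs_def] by (rule filterlim_compose[OF _ h_lim])
    have bound: "norm (T t x - (F (h k) ^^ n k) x) \<le> t * (norm (A k - y) + h k * norm y2)" for k
    proof -
      have h_nonneg: "h k \<ge> 0"
        using h[of k] by simp
      have "(T (h k) ^^ j) x = T (h k * real j) x" for j
      proof (induction j)
        case (Suc j)
        then show ?case
          using h_nonneg by (simp add: T_add' algebra_simps)
      qed (simp add: T_0)
      then have "norm (T t x - (F (h k) ^^ n k) x) = norm ((T (h k) ^^ n k) x - (F (h k) ^^ n k) x)"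
        by (simp add: hn)
      also have "\<dots> \<le> real (n k) * norm (T (h k) x - F (h k) x)"
      proof (rule norm_funpow_diff_le)
        show "bounded_clinear (T (h k))"
          by (rule T_lin[OF h_nonneg])
        show "norm (T (h k) x) \<le> norm x" for x
          by (rule norm_T[OF h_nonneg])
        show "bounded_clinear (F (h k))"
          by (rule F_lin[OF h])
        show "norm (F (h k) x) \<le> norm x" for x
          by (rule norm_F[OF h])
        show "T (h k) (F (h k) x) = F (h k) (T (h k) x)" for x
          by (rule F_T[OF h h_nonneg])
      qed
      also have "T (h k) x - F (h k) x = h k *\<^sub>R (A k - y - h k *\<^sub>R F (h k) y2)"
        using h[of k] by (simp add: A_def Fx Fy algebra_simps)
      also have "real (n k) * norm \<dots> = t * norm (A k - y - h k *\<^sub>R F (h k) y2)"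
      proof -
        have "real (n k) * norm (h k *\<^sub>R u) = (h k * real (n k)) * norm u" for u :: 'a
          using h_nonneg by simp
        then show ?thesis
          by (simp only: hn)
      qed
      also have "\<dots> \<le> t * (norm (A k - y) + h k * norm y2)"
      proof (rule mult_left_mono)
        have "norm (A k - y - h k *\<^sub>R F (h k) y2) \<le> norm (A k - y) + norm (h k *\<^sub>R F (h k) y2)"
          by (rule norm_triangle_ineq4)
        also have "norm (h k *\<^sub>R F (h k) y2) \<le> h k * norm y2"
          using h_nonneg norm_F[OF h] by (simp add: mult_left_mono)
        finally show "norm (A k - y - h k *\<^sub>R F (h k) y2) \<le> norm (A k - y) + h k * norm y2"
          by simp
      qed (use t in simp)
      finally show ?thesis .
    qed
    have "(\<lambda>k. t * (norm (A k - y) + h k * norm y2)) \<longlonglongrightarrow> t * (0 + 0 * norm y2)"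
      by (intro tendsto_intros h_0 tendsto_norm_zero Lim_null[THEN iffD1, OF A])
    then have lim: "(\<lambda>k. t * (norm (A k - y) + h k * norm y2)) \<longlonglongrightarrow> 0"
      by simp
    have "(\<lambda>k. T t x - (F (h k) ^^ n k) x) \<longlonglongrightarrow> 0"
      by (rule Lim_null_comparison[OF always_eventually lim]) (use bound in blast)
    then have "(\<lambda>k. T t x - (T t x - (F (h k) ^^ n k) x)) \<longlonglongrightarrow> T t x - 0"
      by (intro tendsto_diff tendsto_const)
    then show ?thesis
      by (simp add: W_def x_def)
  qed
  have "x \<in> W" for x
  proof (rule in_closed_csubspaceI[OF W])
    fix y
    assume y: "\<And>m. m \<in> W \<Longrightarrow> cinner m y = 0"
    have "cinner (R z) (cadjoint R y) = 0" for z
      using y[OF RR[of z]] by (simp add: cinner_cadjoint[OF R_lin])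
    then have "cadjoint R y = 0"
      by (rule range_R_dense)
    then have "cinner (R z) y = 0" for z
      by (simp add: cinner_cadjoint[OF R_lin] cinner.zero_right)
    then have "y = 0"
      by (rule range_R_dense)
    then show "cinner x y = 0"
      by (simp add: cinner.zero_right)
  qed
  then have lim: "(\<lambda>k. (F (h k) ^^ n k) x) \<longlonglongrightarrow> T t x" for x
    by (simp add: W_def)
  show ?thesis
  proof (rule strong_operator_algebraD(6)[OF B _ _ lim])
    show "F (h k) ^^ n k \<in> B" for k
      by (rule strong_operator_algebra_funpow[OF B F(1)[OF h]])
    show "bounded_clinear (T t)"
      using t by (intro T_lin) simp
  qed
qed

end

section \<open>The unitary part\<close>

lemma eq_on_closed_csubspaceI:
  assumes M: "closed_csubspace M" and "u \<in> M" "v \<in> M"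
    and "\<And>y. y \<in> M \<Longrightarrow> cinner u y = cinner v y"
  shows "u = v"
proof -
  have "cinner (u - v) (u - v) = 0"
    using assms(4)[OF closed_csubspaceD(5)[OF M assms(2,3)]] by (simp add: cinner.diff_left)
  then show ?thesis
    by (simp add: cinner_self)
qed

text \<open>The subspace \<open>M\<close> reduces \<open>A\<close>, and on \<open>M\<close> the adjoint of \<open>A\<close> is its two-sided inverse. Unlike
  \<^const>\<open>unitary_on\<close>, this passes pointwise to closed spans of subspaces.\<close>

definition reducing_unitary :: "'a::complex_hilbert set \<Rightarrow> ('a \<Rightarrow> 'a) \<Rightarrow> bool" where
  "reducing_unitary M A \<longleftrightarrow> (\<forall>x\<in>M. A x \<in> M \<and> cadjoint A x \<in> M \<and>
     cadjoint A (A x) = x \<and> A (cadjoint A x) = x)"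

lemma reducing_unitary_iff:
  assumes M: "closed_csubspace M" and A: "bounded_clinear A"
  shows "reduces M A \<and> unitary_on M A \<longleftrightarrow> reducing_unitary M A"
proof
  assume *: "reduces M A \<and> unitary_on M A"
  have inv: "A x \<in> M" "cadjoint A x \<in> M" if "x \<in> M" for x
    using * that by (auto simp: reduces_def)
  have left: "cadjoint A (A x) = x" if x: "x \<in> M" for x
  proof (rule eq_on_closed_csubspaceI[OF M])
    show "cinner (cadjoint A (A x)) y = cinner x y" if "y \<in> M" for y
      using * x that by (simp add: cinner_cadjoint'[OF A] unitary_on_def)
  qed (simp_all add: inv x)
  have "A (cadjoint A x) = x" if x: "x \<in> M" for x
  proof -
    have "x \<in> A ` M"
      using * x by (simp add: unitary_on_def)
    then show ?thesis
      using left by auto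
  qed
  then show "reducing_unitary M A"
    by (simp add: reducing_unitary_def inv left)
next
  assume *: "reducing_unitary M A"
  have "x \<in> A ` M" if "x \<in> M" for x
    using * that unfolding reducing_unitary_def by (metis image_eqI)
  moreover have "cinner (A x) (A y) = cinner x y" if "x \<in> M" for x y
    using * that unfolding reducing_unitary_def by (metis cinner_cadjoint'[OF A])
  ultimately show "reduces M A \<and> unitary_on M A"
    using * unfolding reduces_def unitary_on_def reducing_unitary_def by blast
qed

lemma reducing_unitary_commute:
  assumes A: "reducing_unitary M A" and B: "reducing_unitary M B"
    and comm: "\<And>x. x \<in> M \<Longrightarrow> A (B x) = B (A x)" and x: "x \<in> M"
  shows "cadjoint A (B x) = B (cadjoint A x)"
proof -
  define u where "u = cadjoint A x"
  have u: "u \<in> M" "A u = x"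
    using A x by (auto simp: u_def reducing_unitary_def)
  then have "B u \<in> M"
    using B by (simp add: reducing_unitary_def)
  then have "cadjoint A (A (B u)) = B u"
    using A by (simp add: reducing_unitary_def)
  then show ?thesis
    using comm[OF u(1)] u(2) by (simp add: u_def[symmetric])
qed

text \<open>A unitary one-sided semigroup on \<open>M\<close> extends to a group by taking adjoints at negative times.\<close>

lemma unitary_flow_of_semigroup:
  fixes W :: "'t::linordered_ab_group_add \<Rightarrow> 'a \<Rightarrow> 'a::complex_hilbert"
  assumes M: "closed_csubspace M"
    and lin: "\<And>t. t \<ge> 0 \<Longrightarrow> bounded_clinear (W t)"
    and unit: "\<And>t. t \<ge> 0 \<Longrightarrow> reducing_unitary M (W t)"
    and W_0: "W 0 = id"
    and W_add: "\<And>s t. s \<ge> 0 \<Longrightarrow> t \<ge> 0 \<Longrightarrow> W (s + t) = W s \<circ> W t"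
  shows "unitary_flow M (\<lambda>t. if t \<ge> 0 then restrict_op M (W t) else cadjoint (restrict_op M (W (- t))))"
proof -
  define S where "S = (\<lambda>t. if t \<ge> 0 then restrict_op M (W t) else cadjoint (restrict_op M (W (- t))))"
  let ?P = "ortho_proj M"
  have P: "?P x \<in> M" "x \<in> M \<Longrightarrow> ?P x = x" for x
    by (rule ortho_proj_in[OF M], rule ortho_proj_ident[OF M])
  have W: "W t x \<in> M" "cadjoint (W t) x \<in> M" "cadjoint (W t) (W t x) = x" "W t (cadjoint (W t) x) = x"
    if "t \<ge> 0" "x \<in> M" for t x
    using unit[OF that(1)] that(2) unfolding reducing_unitary_def by (blast+)
  have adj_add: "cadjoint (W (s + t)) = cadjoint (W s) \<circ> cadjoint (W t)" if "s \<ge> 0" "t \<ge> 0" for s t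
    unfolding add.commute[of s t] W_add[OF that(2,1)] using that by (intro cadjoint_comp lin)
  have W_comm: "W s (W t x) = W t (W s x)" if "s \<ge> 0" "t \<ge> 0" for s t x
    by (metis W_add[OF that] W_add[OF that(2,1)] add.commute comp_apply)
  have adj_comm: "cadjoint (W s) (W t x) = W t (cadjoint (W s) x)" if "s \<ge> 0" "t \<ge> 0" "x \<in> M" for s t x
    using unit[OF that(1)] unit[OF that(2)] W_comm[OF that(1,2)] that(3) by (rule reducing_unitary_commute)
  have neg: "cadjoint (restrict_op M (W t)) x = cadjoint (W t) (?P x)" if t: "t \<ge> 0" for t x
  proof -
    have "cadjoint (restrict_op M (W t)) x = ?P (cadjoint (W t) x)"
      unfolding restrict_op_def cadjoint_comp[OF lin[OF t] bounded_clinear_ortho_proj[OF M]]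
        cadjoint_ortho_proj[OF M] by simp
    also have "\<dots> = cadjoint (W t) (?P x)"
      by (rule ortho_proj_commute[OF M bounded_clinear_cadjoint[OF lin[OF t]]])
        (use W t in \<open>auto simp: cadjoint_cadjoint[OF lin[OF t]]\<close>)
    finally show ?thesis .
  qed
  have S: "S (a - b) x = W a (cadjoint (W b) (?P x))" if a: "a \<ge> 0" and b: "b \<ge> 0" for a b x
  proof (cases "a \<ge> b")
    case True
    have "W a = W (a - b) \<circ> W b"
      using W_add[of "a - b" b] True b by simp
    then show ?thesis
      using True W(4)[OF b P(1)] by (simp add: S_def restrict_op_def)
  next
    case False
    have "cadjoint (W b) = cadjoint (W a) \<circ> cadjoint (W (b - a))"
      using adj_add[of a "b - a"] False a by simp
    moreover have "cadjoint (W (b - a)) (?P x) \<in> M"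
      using False by (intro W P) simp
    ultimately show ?thesis
      using False neg[of "b - a"] W(4)[OF a] by (simp add: S_def)
  qed
  have split: "\<exists>a b. a \<ge> 0 \<and> b \<ge> 0 \<and> t = a - b" for t :: 't
  proof (cases "t \<ge> 0")
    case True
    then show ?thesis
      by (intro exI[of _ t] exI[of _ 0]) simp
  next
    case False
    then show ?thesis
      by (intro exI[of _ 0] exI[of _ "- t"]) simp
  qed
  have lin_ab: "bounded_clinear (\<lambda>x. W a (cadjoint (W b) (?P x)))" if "a \<ge> 0" "b \<ge> 0" for a b
    using bounded_clinear_comp[OF lin[OF that(1)] bounded_clinear_comp[OF
        bounded_clinear_cadjoint[OF lin[OF that(2)]] bounded_clinear_ortho_proj[OF M]]]
    by (simp add: o_def)
  have "unitary_flow M S"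
  proof (rule unitary_flow.intro)
    show "closed_csubspace M"
      by (rule M)
    show "S 0 = ?P"
      by (simp add: S_def restrict_op_def W_0)
    fix t :: 't
    obtain a b :: 't where t: "a \<ge> 0" "b \<ge> 0" "t = a - b"
      using split by blast
    have St: "S t = (\<lambda>x. W a (cadjoint (W b) (?P x)))"
      using S[OF t(1,2)] by (simp add: t(3) fun_eq_iff)
    show "S t \<in> operators_on M"
      unfolding St by (intro operators_onI lin_ab t W P) (simp add: P)
    show "cadjoint (S t) = S (- t)"
    proof (rule cadjoint_eqI)
      show "bounded_clinear (S t)"
        unfolding St by (intro lin_ab t)
      fix x y
      have Smt: "S (- t) y = W b (cadjoint (W a) (?P y))"
        using S[OF t(2,1), of y] by (simp add: t(3))
      have "cinner (W a (cadjoint (W b) (?P x))) y = cinner (?P (W a (cadjoint (W b) (?P x)))) y"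
        using W P t by simp
      also have "\<dots> = cinner (?P x) (W b (cadjoint (W a) (?P y)))"
        by (simp add: cinner_ortho_proj[OF M, of _ y] cinner_cadjoint[OF lin[OF t(1)]]
            cinner_cadjoint'[OF lin[OF t(2)]])
      also have "\<dots> = cinner x (?P (W b (cadjoint (W a) (?P y))))"
        by (rule cinner_ortho_proj[OF M])
      also have "?P (W b (cadjoint (W a) (?P y))) = W b (cadjoint (W a) (?P y))"
        using W P t by simp
      finally show "cinner (S t x) y = cinner x (S (- t) y)"
        unfolding St Smt .
    qed
    fix s :: 't
    obtain c d :: 't where s: "c \<ge> 0" "d \<ge> 0" "s = c - d"
      using split by blast
    have Ss: "S s = (\<lambda>x. W c (cadjoint (W d) (?P x)))"
      using S[OF s(1,2)] by (simp add: s(3) fun_eq_iff)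
    show "S (s + t) = S s \<circ> S t"
    proof
      fix x
      have m: "cadjoint (W b) (?P x) \<in> M" "W a (cadjoint (W b) (?P x)) \<in> M"
        using W P t by simp_all
      have st: "s + t = (c + a) - (d + b)"
        by (simp add: s(3) t(3))
      have "S (s + t) x = W (c + a) (cadjoint (W (d + b)) (ortho_proj M x))"
        unfolding st by (rule S) (simp_all add: s t)
      also have "\<dots> = W c (W a (cadjoint (W d) (cadjoint (W b) (?P x))))"
        unfolding adj_add[OF s(2) t(2)] using s t by (simp add: W_add)
      also have "\<dots> = W c (cadjoint (W d) (W a (cadjoint (W b) (?P x))))"
        using adj_comm[OF s(2) t(1) m(1)] by simp
      also have "\<dots> = (S s \<circ> S t) x"
        using m(2) P(2) unfolding Ss St o_apply by simp
      finally show "S (s + t) x = (S s \<circ> S t) x" .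
    qed
  qed
  then show ?thesis
    by (simp add: S_def)
qed

text \<open>For \<open>X = id\<close> this is the algebra of the operators that preserve \<open>M\<close>.\<close>

lemma strong_operator_algebra_commutant:
  assumes M: "closed_csubspace M" and X: "bounded_clinear X"
  shows "strong_operator_algebra {W. bounded_clinear W \<and> (\<forall>x\<in>M. W x \<in> M \<and> W (X x) = X (W x))}"
    (is "strong_operator_algebra ?B")
  unfolding strong_operator_algebra_def
proof (intro conjI ballI allI impI)
  show "id \<in> ?B"
    by (simp add: bounded_clinear_id)
  show "(\<lambda>x. V x + W x) \<in> ?B" if "V \<in> ?B" "W \<in> ?B" for V W
    using that by (simp add: bounded_clinear_add closed_csubspaceD(3)[OF M] bounded_clinearD(3)[OF X])
  show "(\<lambda>x. c *\<^sub>C V x) \<in> ?B" if "V \<in> ?B" for c V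
    using that by (simp add: bounded_clinear_scaleC closed_csubspaceD(4)[OF M] bounded_clinearD(2)[OF X])
  show "V \<circ> W \<in> ?B" if "V \<in> ?B" "W \<in> ?B" for V W
    using that by (simp add: bounded_clinear_comp)
  fix Y :: "nat \<Rightarrow> 'a \<Rightarrow> 'a" and V
  assume Y: "\<forall>n. Y n \<in> ?B" and V: "bounded_clinear V" and lim: "\<forall>x. (\<lambda>n. Y n x) \<longlonglongrightarrow> V x"
  have "V x \<in> M \<and> V (X x) = X (V x)" if x: "x \<in> M" for x
  proof
    show "V x \<in> M"
      by (rule closed_sequentially[OF closed_csubspaceD(1)[OF M] _ lim[rule_format]]) (use Y x in simp)
    have "(\<lambda>n. X (Y n x)) \<longlonglongrightarrow> X (V x)"
      using lim by (intro bounded_linear.tendsto[OF bounded_clinearD(1)[OF X]]) simp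
    moreover have "X (Y n x) = Y n (X x)" for n
      using Y x by simp
    ultimately have "(\<lambda>n. Y n (X x)) \<longlonglongrightarrow> X (V x)"
      by simp
    then show "V (X x) = X (V x)"
      using lim LIMSEQ_unique by blast
  qed
  then show "V \<in> ?B"
    using V by simp
qed simp

lemma strong_operator_algebra_restriction:
  assumes M: "closed_csubspace M" and B: "weakly_closed_star_subalgebra M B" and P: "ortho_proj M \<in> B"
  shows "strong_operator_algebra {W. bounded_clinear W \<and> (\<forall>x\<in>M. W x \<in> M) \<and> restrict_op M W \<in> B}"
    (is "strong_operator_algebra ?B")
  unfolding strong_operator_algebra_def
proof (intro conjI ballI allI impI)
  have P_in: "ortho_proj M x \<in> M" for x
    by (rule ortho_proj_in[OF M])
  show "id \<in> ?B"
    using P by (simp add: bounded_clinear_id restrict_op_def)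
  show "(\<lambda>x. V x + W x) \<in> ?B" if "V \<in> ?B" "W \<in> ?B" for V W
    using that wcsaD(3)[OF B, of "restrict_op M V" "restrict_op M W"]
    by (simp add: bounded_clinear_add closed_csubspaceD(3)[OF M] restrict_op_def o_def)
  show "(\<lambda>x. c *\<^sub>C V x) \<in> ?B" if "V \<in> ?B" for c V
    using that wcsaD(4)[OF B, of "restrict_op M V" c]
    by (simp add: bounded_clinear_scaleC closed_csubspaceD(4)[OF M] restrict_op_def o_def)
  show "V \<circ> W \<in> ?B" if "V \<in> ?B" "W \<in> ?B" for V W
  proof -
    have "restrict_op M V \<circ> restrict_op M W = restrict_op M (V \<circ> W)"
      using that P_in by (auto simp: restrict_op_def fun_eq_iff ortho_proj_ident[OF M])
    then show ?thesis
      using that wcsaD(5)[OF B, of "restrict_op M V" "restrict_op M W"]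
      by (simp add: bounded_clinear_comp)
  qed
  fix Y :: "nat \<Rightarrow> 'a \<Rightarrow> 'a" and V
  assume Y: "\<forall>n. Y n \<in> ?B" and V: "bounded_clinear V" and lim: "\<forall>x. (\<lambda>n. Y n x) \<longlonglongrightarrow> V x"
  have inv: "V x \<in> M" if x: "x \<in> M" for x
    by (rule closed_sequentially[OF closed_csubspaceD(1)[OF M] _ lim[rule_format]]) (use Y x in simp)
  have "restrict_op M V \<in> B"
  proof (rule wcsa_limit[OF B])
    show "eventually (\<lambda>n. restrict_op M (Y n) \<in> B) sequentially"
      using Y by simp
    show "(\<lambda>n. cinner (restrict_op M (Y n) x) y) \<longlonglongrightarrow> cinner (restrict_op M V x) y" for x y
      using lim unfolding restrict_op_def o_apply by (intro cinner.tendsto tendsto_const) simp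
    show "restrict_op M V \<in> operators_on M"
      unfolding restrict_op_def using P_in inv
      by (intro operators_onI bounded_clinear_comp V bounded_clinear_ortho_proj[OF M])
        (simp_all add: ortho_proj_ident[OF M])
  qed simp
  then show "V \<in> ?B"
    using V inv by simp
qed simp

context contraction_semigroup
begin

text \<open>The conditions defining \<^const>\<open>unitary_part\<close> pass to the closed span of all subspaces that satisfy
  them, so a greatest such subspace exists.\<close>

lemma unitary_part:
  shows closed_csubspace_unitary_part: "closed_csubspace (unitary_part T)"
    and unitary_part_reducing: "t \<ge> 0 \<Longrightarrow> reducing_unitary (unitary_part T) (T t)"
proof -
  define \<Phi> where "\<Phi> M \<longleftrightarrow> closed_csubspace M \<and> (\<forall>t\<ge>0. reduces M (T t) \<and> unitary_on M (T t))" for M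
  have \<Phi>: "\<Phi> M \<longleftrightarrow> closed_csubspace M \<and> (\<forall>t\<ge>0. reducing_unitary M (T t))" for M
    unfolding \<Phi>_def using reducing_unitary_iff T_lin by blast
  define H where "H = closure (cspan (\<Union>{M. \<Phi> M}))"
  have H: "closed_csubspace H"
    unfolding H_def by (rule closed_csubspace_closure_cspan)
  have sub: "M \<subseteq> H" if "\<Phi> M" for M
    using that subset_closure_cspan[of "\<Union>{M. \<Phi> M}"] unfolding H_def by blast
  have minimal: "H \<subseteq> N" if "closed_csubspace N" "\<And>M. \<Phi> M \<Longrightarrow> M \<subseteq> N" for N
    unfolding H_def using that by (intro closure_cspan_minimal) auto
  have "reducing_unitary H (T t)" if t: "t \<ge> 0" for t
  proof -
    note A = T_lin[OF t] and A' = bounded_clinear_cadjoint[OF T_lin[OF t]]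
    have M: "T t x \<in> M" "cadjoint (T t) x \<in> M" "cadjoint (T t) (T t x) = x" "T t (cadjoint (T t) x) = x"
      if "\<Phi> M" "x \<in> M" for M x
      using that t by (auto simp: \<Phi> reducing_unitary_def)
    have 1: "H \<subseteq> {x. T t x \<in> H}"
      using M(1) sub by (intro minimal closed_csubspace_vimage A H) auto
    have 2: "H \<subseteq> {x. cadjoint (T t) x \<in> H}"
      using M(2) sub by (intro minimal closed_csubspace_vimage A' H) auto
    have "closed_csubspace {x. (cadjoint (T t) \<circ> T t) x - id x = 0}"
      by (intro closed_csubspace_ker bounded_clinear_diff bounded_clinear_comp A A' bounded_clinear_id)
    then have 3: "H \<subseteq> {x. cadjoint (T t) (T t x) = x}"
      using M(3) by (intro minimal) auto
    have "closed_csubspace {x. (T t \<circ> cadjoint (T t)) x - id x = 0}"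
      by (intro closed_csubspace_ker bounded_clinear_diff bounded_clinear_comp A A' bounded_clinear_id)
    then have 4: "H \<subseteq> {x. T t (cadjoint (T t) x) = x}"
      using M(4) by (intro minimal) auto
    from 1 2 3 4 show ?thesis
      unfolding reducing_unitary_def by blast
  qed
  then have "\<Phi> H"
    using H by (simp add: \<Phi>)
  then have "unitary_part T = H"
    unfolding unitary_part_def \<Phi>_def[symmetric] using sub by (rule Greatest_equality)
  with \<open>\<Phi> H\<close> show "closed_csubspace (unitary_part T)"
    "t \<ge> 0 \<Longrightarrow> reducing_unitary (unitary_part T) (T t)"
    by (simp_all add: \<Phi>)
qed

abbreviation Hu :: "'a set" where
  "Hu \<equiv> unitary_part T"

lemma T_Hu:
  assumes "t \<ge> 0" "x \<in> Hu"
  shows "T t x \<in> Hu" "cadjoint (T t) x \<in> Hu" "cadjoint (T t) (T t x) = x" "T t (cadjoint (T t) x) = x"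
  using unitary_part_reducing[OF assms(1)] assms(2) by (auto simp: reducing_unitary_def)

text \<open>If the semigroup preserves \<open>M\<close> and commutes there with \<open>X\<close>, then so does the cogenerator.\<close>

lemma C_commutes:
  assumes M: "closed_csubspace M" and X: "bounded_clinear X"
    and T: "\<And>t x. t \<ge> 0 \<Longrightarrow> x \<in> M \<Longrightarrow> T t x \<in> M \<and> T t (X x) = X (T t x)"
    and x: "x \<in> M"
  shows "C x \<in> M \<and> C (X x) = X (C x)"
  using cogenerator_in_strong_operator_algebra[OF strong_operator_algebra_commutant[OF M X]] T_lin T x
  by simp

lemma C_Hu: "x \<in> Hu \<Longrightarrow> C x \<in> Hu"
  using C_commutes[OF closed_csubspace_unitary_part bounded_clinear_id] T_Hu(1) by simp

lemma C_adjoint_Hu: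
  assumes x: "x \<in> Hu"
  shows "cadjoint C x \<in> Hu"
proof (rule in_closed_csubspaceI[OF closed_csubspace_unitary_part])
  fix y
  assume "\<And>m. m \<in> Hu \<Longrightarrow> cinner m y = 0"
  then have y: "y \<in> ocompl Hu"
    using cinner_eq_0_sym by (auto simp: ocompl_def)
  have "T t z \<in> ocompl Hu" if "t \<ge> 0" "z \<in> ocompl Hu" for t z
    using that T_Hu(2) by (simp add: ocompl_def cinner_cadjoint[OF T_lin])
  then have "C y \<in> ocompl Hu"
    using C_commutes[OF closed_csubspace_ocompl bounded_clinear_id _ y] by simp
  then have "cinner (C y) x = 0"
    using x by (simp add: ocompl_def)
  then show "cinner (cadjoint C x) y = 0"
    unfolding cinner_cadjoint'[OF C_lin] using cinner_eq_0_sym by blast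
qed

text \<open>On the unitary part \<open>C\<close> commutes with all \<open>T\<^sub>s\<^sup>*\<close>, hence \<open>C\<^sup>*\<close> commutes with all \<open>T\<^sub>s\<close>, and
  therefore with \<open>C\<close>.\<close>

lemma C_normal_on_Hu:
  assumes x: "x \<in> Hu"
  shows "C (cadjoint C x) = cadjoint C (C x)"
proof -
  note H = closed_csubspace_unitary_part
  have T_comm: "T t (cadjoint (T s) x) = cadjoint (T s) (T t x)" if "s \<ge> 0" "t \<ge> 0" "x \<in> Hu" for s t x
    using reducing_unitary_commute[OF unitary_part_reducing[OF that(1)] unitary_part_reducing[OF that(2)]
        T_commute[OF that(1,2)] that(3)] by simp
  have C_T: "C (cadjoint (T s) x) = cadjoint (T s) (C x)" if s: "s \<ge> 0" and x: "x \<in> Hu" for s x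
    using C_commutes[OF H bounded_clinear_cadjoint[OF T_lin[OF s]] _ x] T_Hu(1) T_comm[OF s] by blast
  have "T s (cadjoint C x) = cadjoint C (T s x)" if s: "s \<ge> 0" and x: "x \<in> Hu" for s x
  proof (rule eq_on_closed_csubspaceI[OF H])
    show "T s (cadjoint C x) \<in> Hu" "cadjoint C (T s x) \<in> Hu"
      using T_Hu(1)[OF s C_adjoint_Hu[OF x]] C_adjoint_Hu[OF T_Hu(1)[OF s x]] by simp_all
    show "cinner (T s (cadjoint C x)) y = cinner (cadjoint C (T s x)) y" if "y \<in> Hu" for y
      by (simp add: cinner_cadjoint[OF T_lin[OF s]] cinner_cadjoint'[OF C_lin] C_T[OF s that])
  qed
  then show ?thesis
    using C_commutes[OF H bounded_clinear_cadjoint[OF C_lin] _ x] T_Hu(1) by blast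
qed

text \<open>Differentiating the constant function \<open>h \<mapsto> cinner (T\<^sub>h x) (T\<^sub>h x')\<close> at 0 shows that the generator is
  skew-symmetric on the unitary part.\<close>

lemma gen_skew_on_Hu:
  assumes x: "x \<in> Hu" "gen x y" and x': "x' \<in> Hu" "gen x' y'"
  shows "cinner y x' + cinner x y' = 0"
proof -
  let ?f = "\<lambda>h. cinner ((T h x - x) /\<^sub>R h) x' + cinner (T h x) ((T h x' - x') /\<^sub>R h)"
  have "?f h = 0" if h: "h > 0" for h
  proof -
    have "cinner (T h x) (T h x') = cinner x x'"
      using h T_Hu(3)[of h x] x(1) by (simp add: cinner_cadjoint'[OF T_lin, symmetric])
    then show ?thesis
      by (simp add: cinner.scaleR_left cinner.scaleR_right cinner.diff_left cinner.diff_right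
          flip: distrib_left scaleR_add_right)
  qed
  then have "eventually (\<lambda>h. ?f h = 0) (at_right 0)"
    by (rule eventually_at_right_pos)
  then have "(?f \<longlongrightarrow> 0) (at_right 0)"
    by (rule tendsto_eventually)
  moreover have "(?f \<longlongrightarrow> cinner y x' + cinner x y') (at_right 0)"
    using x(2) x'(2) unfolding gen_def
    by (intro tendsto_add cinner.tendsto tendsto_const T_right)
  ultimately show ?thesis
    using tendsto_unique[OF trivial_limit_at_right_real] by blast
qed

lemma R_Hu: "x \<in> Hu \<Longrightarrow> R x \<in> Hu"
  unfolding R_def using C_Hu closed_csubspaceD(5,6)[OF closed_csubspace_unitary_part] by blast

lemma C_isometric_on_Hu:
  assumes "z \<in> Hu" "w \<in> Hu"
  shows "cinner (C z) (C w) = cinner z w"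
proof -
  have "cinner (R z - z) (R w) + cinner (R z) (R w - w) = 0"
    using assms by (intro gen_skew_on_Hu R_Hu gen_R)
  then have "2 * cinner (R z) (R w) = cinner z (R w) + cinner (R z) w"
    by (simp add: cinner.diff_left cinner.diff_right algebra_simps)
  then show ?thesis
    by (simp add: C_eq cinner.diff_left cinner.diff_right cinner.scaleR_left cinner.scaleR_right
        algebra_simps scaleR_conv_of_real)
qed

text \<open>The cogenerator is isometric and normal on the unitary part, hence unitary there.\<close>

lemma C_reducing_unitary: "reducing_unitary Hu C"
proof -
  have left: "cadjoint C (C x) = x" if "x \<in> Hu" for x
  proof (rule eq_on_closed_csubspaceI[OF closed_csubspace_unitary_part])
    show "cinner (cadjoint C (C x)) y = cinner x y" if "y \<in> Hu" for y
      using \<open>x \<in> Hu\<close> that by (simp add: cinner_cadjoint'[OF C_lin] C_isometric_on_Hu)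
  qed (use that in \<open>auto intro: C_Hu C_adjoint_Hu\<close>)
  then show ?thesis
    unfolding reducing_unitary_def by (simp add: C_Hu C_adjoint_Hu C_normal_on_Hu)
qed

lemma reducing_unitary_funpow: "reducing_unitary Hu (C ^^ n)"
proof (induction n)
  case 0
  have "cadjoint id = (id :: 'a \<Rightarrow> 'a)"
    by (rule cadjoint_eqI[OF bounded_clinear_id]) simp
  then show ?case
    by (simp add: reducing_unitary_def id_def)
next
  case (Suc n)
  have "cadjoint (C ^^ Suc n) = cadjoint (C ^^ n) \<circ> cadjoint C"
    by (simp add: cadjoint_comp[OF C_lin bounded_clinear_funpow[OF C_lin]])
  then show ?case
    using Suc C_reducing_unitary unfolding reducing_unitary_def by simp
qed

lemma unitary_flow_unitary_group: "unitary_flow Hu (unitary_group T)"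
proof -
  have "unitary_flow Hu (\<lambda>t. if t \<ge> 0 then restrict_op Hu (T t) else cadjoint (restrict_op Hu (T (- t))))"
    by (rule unitary_flow_of_semigroup[OF closed_csubspace_unitary_part T_lin unitary_part_reducing T_0 T_add])
  then show ?thesis
    by (simp add: unitary_group_def[abs_def])
qed

lemma unitary_flow_cogenerator_group: "unitary_flow Hu (cogenerator_group T)"
proof -
  have "unitary_flow Hu (\<lambda>n :: int. if n \<ge> 0 then restrict_op Hu (C ^^ nat n)
      else cadjoint (restrict_op Hu (C ^^ nat (- n))))"
  proof (rule unitary_flow_of_semigroup[where W = "\<lambda>n. C ^^ nat n"])
    show "C ^^ nat (m + n) = C ^^ nat m \<circ> C ^^ nat n" if "m \<ge> 0" "n \<ge> 0" for m n
      using that by (simp add: nat_add_distrib funpow_add)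
  qed (simp_all add: closed_csubspace_unitary_part bounded_clinear_funpow C_lin reducing_unitary_funpow)
  then show ?thesis
    by (simp add: cogenerator_group_def[abs_def])
qed

theorem groups_generate_same_algebras:
  assumes B: "weakly_closed_star_subalgebra Hu B"
  shows "range (unitary_group T) \<subseteq> B \<longleftrightarrow> range (cogenerator_group T) \<subseteq> B"
proof
  note H = closed_csubspace_unitary_part
  let ?B = "{W. bounded_clinear W \<and> (\<forall>x\<in>Hu. W x \<in> Hu) \<and> restrict_op Hu W \<in> B}"
  {
    assume U: "range (unitary_group T) \<subseteq> B"
    have "ortho_proj Hu \<in> B"
      using U unitary_flow.S_0[OF unitary_flow_unitary_group] by (metis range_subsetD)
    then have alg: "strong_operator_algebra ?B"
      by (rule strong_operator_algebra_restriction[OF H B])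
    have "T t \<in> ?B" if "t \<ge> 0" for t
      using range_subsetD[OF U, of t] that T_lin T_Hu(1) by (simp add: unitary_group_def)
    then have "C \<in> ?B"
      by (rule cogenerator_in_strong_operator_algebra[OF alg])
    then have "restrict_op Hu (C ^^ n) \<in> B" for n
      using strong_operator_algebra_funpow[OF alg] by blast
    then show "range (cogenerator_group T) \<subseteq> B"
      using wcsaD(6)[OF B] by (auto simp: cogenerator_group_def)
  next
    assume U: "range (cogenerator_group T) \<subseteq> B"
    have "ortho_proj Hu \<in> B"
      using U unitary_flow.S_0[OF unitary_flow_cogenerator_group] by (metis range_subsetD)
    then have alg: "strong_operator_algebra ?B"
      by (rule strong_operator_algebra_restriction[OF H B])
    have "C \<in> ?B"
      using range_subsetD[OF U, of 1] C_lin C_Hu by (simp add: cogenerator_group_def)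
    then have "restrict_op Hu (T t) \<in> B" if "t \<ge> 0" for t
      using semigroup_in_strong_operator_algebra[OF alg _ that] by blast
    then show "range (unitary_group T) \<subseteq> B"
      using wcsaD(6)[OF B] by (auto simp: unitary_group_def)
  }
qed

end

theorem theorem5p3:
  fixes T :: "real \<Rightarrow> 'a::complex_hilbert \<Rightarrow> 'a"
  assumes "c0_contraction_semigroup T"
    and "\<And>x. flight_vector T x"
  defines "Hu \<equiv> unitary_part T"
    and "\<U> \<equiv> unitary_group T"
    and "\<C> \<equiv> cogenerator_group T"
  shows "(entangled Hu \<U> \<C> \<longleftrightarrow> common_limit_algebra Hu \<U> \<C>) \<and>
         (common_limit_algebra Hu \<U> \<C> \<longleftrightarrow> poisson_recurrent Hu \<C> = poisson_recurrent Hu \<U>)"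
proof -
  interpret contraction_semigroup T
    by unfold_locales (rule assms(1))
  show ?thesis
    unfolding assms(3-5)
    by (rule flows_equivalences[OF unitary_flow_unitary_group unitary_flow_cogenerator_group
          groups_generate_same_algebras])
qed

end
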